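(* Let $V\subset\underline{\mathbb{C}}^{n+2}$ be a $q$-constrained harmonic bundle, let $\alpha,\beta,L^\alpha,L^\beta$ be Bäcklund transformation parameters to $V$, let $\lambda\in\mathbb{C}\backslash\{0,\pm\alpha,\pm\beta\}$, and let $\phi^\lambda:(\underline{\mathbb{C}}^{n+2},d^{\lambda,q}_V)\to(\underline{\mathbb{C}}^{n+2},d)$ be an isometry preserving connections. Then the Bäcklund transform of parameters $\frac{\alpha}{\lambda},\frac{\beta}{\lambda},\phi^\lambda L^\alpha,\phi^\lambda L^\beta$ of the spectral deformation $\phi^\lambda V$ of $V$ of parameter $\lambda$ (corresponding to the multiplier $q$) coincides with the spectral deformation of parameter $\lambda$ (corresponding to the multiplier $q^*$) of the Bäcklund transform $V^*$ of $V$ of parameters $\alpha,\beta,L^\alpha,L^\beta$. Furthermore, if $V$ is a $(q,d)$-central sphere congruence of a $q$-constrained Willmore surface $(\Delta^{1,0},\Delta^{0,1})$ and $\phi^\lambda_*:(\underline{\mathbb{C}}^{n+2},d^{\lambda,q^*}_{V^*})\to(\underline{\mathbb{C}}^{n+2},d)$ is an isometry preserving connections, then the Bäcklund transform of parameters $\frac{\alpha}{\lambda},\frac{\beta}{\lambda},\phi^\lambda L^\alpha,\phi^\lambda L^\beta$ of $(\phi^\lambda\Delta^{1,0},\phi^\lambda\Delta^{0,1})$ coincides with the spectral deformation, by $\phi^\lambda_*$, of the Bäcklund transform $((\Delta^* )^{1,0},(\Delta^* )^{0,1})$ of $(\Delta^{1,0},\Delta^{0,1})$ of parameters $\alpha,\beta,L^\alpha,L^\beta$.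 (Spectral deformations are defined, and the coincidences hold, up to a constant orthogonal transformation of $\mathbb{C}^{n+2}$.)
   Context: $M$ is an oriented surface with a fixed conformal structure; $(1,0)$- and $(0,1)$-parts refer to it, and $*\omega=-\omega\circ J$ on $1$-forms. $\mathbb{R}^{n+1,1}$ ($n\ge 3$) has metric $(\,,\,)$ of signature $(n+1,1)$, extended complex bilinearly to $\mathbb{C}^{n+2}$; $\underline{\mathbb{C}}^{n+2}=M\times\mathbb{C}^{n+2}$ with trivial flat connection $d$. The theory is local: restriction to a suitable non-empty open subset of $M$ is always understood. $\wedge^{2}\mathbb{C}^{n+2}\cong o(\mathbb{C}^{n+2})$ by $(v_1\wedge v_2)(w)=(w,v_1)v_2-(w,v_2)v_1$; $[\mu\wedge\eta](X,Y)=[\mu_X,\eta_Y]-[\mu_Y,\eta_X]$; $d^\nabla$ is the exterior derivative on endomorphism-valued forms. An isometry $\phi:(\underline{\mathbb{C}}^{n+2},\nabla)\to(\underline{\mathbb{C}}^{n+2},\nabla')$ preserves connections if $\phi\circ\nabla=\nabla'\circ\phi$. For a non-degenerate subbundle $V$: $\mathcal{D}_V:=\pi_V\circ d\circ\pi_V+\pi_{V^\perp}\circ d\circ\pi_{V^\perp}$, $\mathcal{N}_V:=d-\mathcal{D}_V$, and for $q\in\Omega^1(\wedge^2V\oplus\wedge^2V^\perp)$, $d^{\lambda,q}_V:=\mathcal{D}_V+\lambda^{-1}\mathcal{N}_V^{1,0}+\lambda\mathcal{N}_V^{0,1}+(\lambda^{-2}-1)q^{1,0}+(\lambda^2-1)q^{0,1}$.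 $V$ is $q$-constrained harmonic if $d^{\mathcal{D}_V}q^{1,0}=\frac12[q\wedge q]=d^{\mathcal{D}_V}q^{0,1}$ and $d^{\mathcal{D}_V}*\mathcal{N}_V=2[q\wedge*\mathcal{N}_V]$; then all $d^{\lambda,q}_V$ are flat metric connections. A (complexified) surface is a pair $(\Delta^{1,0},\Delta^{0,1})$ of isotropic rank $2$ subbundles intersecting in a rank $1$ bundle $\Delta$ with $d^{1,0}\Gamma(\Delta)\subset\Omega^{1,0}(\Delta^{1,0})$, $d^{0,1}\Gamma(\Delta)\subset\Omega^{0,1}(\Delta^{0,1})$. A central sphere congruence of it is a non-degenerate rank $4$ subbundle $V\supset\Delta^{1,0}+\Delta^{0,1}$ with $\mathcal{N}_V^{1,0}\Delta^{0,1}=0=\mathcal{N}_V^{0,1}\Delta^{1,0}$. The pair is a $q$-constrained Willmore surface if $q^{1,0}\in\Omega^{1,0}(\wedge^2\Delta^{0,1})$, $q^{0,1}\in\Omega^{0,1}(\wedge^2\Delta^{1,0})$ and it admits a $q$-constrained harmonic central sphere congruence, called a $(q,d)$-central sphere congruence. Spectral deformation. For $\phi^\lambda$ as in the claim, the spectral deformation of parameter $\lambda$ corresponding to $q$ is $\phi^\lambda V$ (respectively $(\phi^\lambda\Delta^{1,0},\phi^\lambda\Delta^{0,1})$); it is constrained harmonic (constrained Willmore) with multiplier $\mathrm{Ad}_{\phi^\lambda}q_\lambda$, $q_\lambda=\lambda^{-2}q^{1,0}+\lambda^2q^{0,1}$, and its Bäcklund transforms are taken with respect to this multiplier. $\phi^\lambda$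 is unique up to left composition with a constant element of $O(\mathbb{C}^{n+2})$. Bäcklund transformation. Let $\rho=\pi_V-\pi_{V^\perp}$. For $a\in\mathbb{C}\backslash\{-1,0,1\}$ and a null line subbundle $L$ with $\rho L\cap L^\perp=\{0\}$, let $\pi_L,\pi_{\rho L},\pi_\perp$ be the projections for $\underline{\mathbb{C}}^{n+2}=L\oplus\rho L\oplus(L\oplus\rho L)^\perp$, and $$p_{a,L}(\lambda)=\tfrac{a-\lambda}{a+\lambda}\pi_L+\pi_\perp+\tfrac{a+\lambda}{a-\lambda}\pi_{\rho L},\qquad q_{a,L}(\lambda)=\tfrac{\lambda-a}{\lambda+a}\pi_L+\pi_\perp+\tfrac{\lambda+a}{\lambda-a}\pi_{\rho L},$$ $p_{a,L}(\infty)=-\pi_L+\pi_\perp-\pi_{\rho L}$, $q_{a,L}(\infty)=I$. Bäcklund transformation parameters to $V$ (for $q$) are $\alpha,\beta\in\mathbb{C}\backslash\{-1,0,1\}$ with $\beta\ne\pm\alpha$, a $d^{\alpha,q}_V$-parallel null line subbundle $L^\alpha$ and a $d^{\beta,q}_V$-parallel null line subbundle $L^\beta$ such that, locally, $\rho L\cap L^\perp=\{0\}$ for each of $L=L^\alpha$, $L=L^\beta$, $L=\tilde L^\beta_\alpha:=q_{\alpha,L^\alpha}(\beta)L^\beta$ and $L=\tilde L^\alpha_\beta:=q_{\beta,L^\beta}(\alpha)L^\alpha$. With $r^*:=p_{\alpha,\tilde L^\alpha_\beta}\,q_{\beta,L^\beta}$, the Bäcklund transform of $V$ is $V^*:=r^*(1)^{-1}V$,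 that of $(\Delta^{1,0},\Delta^{0,1})$ is $((\Delta^* )^{1,0},(\Delta^* )^{0,1}):=(r^*(1)^{-1}r^*(\infty)\Delta^{1,0},\,r^*(1)^{-1}r^*(0)\Delta^{0,1})$, and $q^*:=\mathrm{Ad}_{r^*(1)^{-1}}(\mathrm{Ad}_{r^*(0)}q^{1,0}+\mathrm{Ad}_{r^*(\infty)}q^{0,1})$. *)

theory Defs
  imports "HOL-Analysis.Analysis"
begin

section \<open>The complexified Lorentzian space\<close>

text \<open>
  The standard basis of $\mathbf{R}^{n+1,1}$ is indexed by \<open>'k option\<close> with \<open>CARD('k) = n + 1\<close>;
  the index \<open>None\<close> is the time-like direction.
\<close>

type_synonym 'k cvec = "complex ^ ('k option)"
type_synonym 'k cmat = "complex ^ ('k option) ^ ('k option)"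

definition mink :: "'k::finite cvec \<Rightarrow> 'k cvec \<Rightarrow> complex" where
  "mink v w = (\<Sum>i\<in>UNIV. v $ Some i * w $ Some i) - v $ None * w $ None"

definition orth :: "'k::finite cvec set \<Rightarrow> 'k cvec set" where
  "orth W = {w. \<forall>u\<in>W. mink u w = 0}"

definition nondegenerate :: "'k::finite cvec set \<Rightarrow> bool" where
  "nondegenerate W \<longleftrightarrow> W \<inter> orth W = {0}"

definition isotropic :: "'k::finite cvec set \<Rightarrow> bool" where
  "isotropic W \<longleftrightarrow> (\<forall>u\<in>W. \<forall>w\<in>W. mink u w = 0)"

definition orthogonal_maps :: "'k::finite cmat set" where
  "orthogonal_maps = {A. \<forall>v w. mink (A *v v) (A *v w) = mink v w}"

definition mscale :: "complex \<Rightarrow> 'k::finite cmat \<Rightarrow> 'k cmat"  (infixr \<open>*m\<close> 75) where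
  "c *m A = (\<chi> i j. c * A $ i $ j)"

definition commutator :: "'k::finite cmat \<Rightarrow> 'k cmat \<Rightarrow> 'k cmat" where
  "commutator A B = A ** B - B ** A"

definition Ad :: "'k::finite cmat \<Rightarrow> 'k cmat \<Rightarrow> 'k cmat" where
  "Ad A B = A ** B ** matrix_inv A"

definition wedge :: "'k::finite cvec \<Rightarrow> 'k cvec \<Rightarrow> 'k cmat" where
  "wedge v1 v2 = matrix (\<lambda>w. mink w v1 *s v2 - mink w v2 *s v1)"

text \<open>
  \<open>span\<close> is the real span. The generating set is closed under complex multiples whenever \<open>W\<close> is a
  complex subspace, so this is the complex span.
\<close>

definition Wedge2 :: "'k::finite cvec set \<Rightarrow> 'k cmat set" where
  "Wedge2 W = span {wedge u w | u w. u \<in> W \<and> w \<in> W}"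

definition set_sum :: "'a::plus set \<Rightarrow> 'a set \<Rightarrow> 'a set" where
  "set_sum A B = {x + y | x y. x \<in> A \<and> y \<in> B}"

text \<open>Projection onto \<open>W1\<close> along \<open>W2\<close>; only meaningful when the space is the direct sum of the two.\<close>

definition proj :: "'k::finite cvec set \<Rightarrow> 'k cvec set \<Rightarrow> 'k cmat" where
  "proj W1 W2 = matrix (\<lambda>w. THE u. u \<in> W1 \<and> w - u \<in> W2)"

definition reflection :: "'k::finite cvec set \<Rightarrow> 'k cmat" where
  "reflection W = proj W (orth W) - proj (orth W) W"


section \<open>Surfaces, smoothness and differential forms\<close>

primrec Ck_on :: "nat \<Rightarrow> complex set \<Rightarrow> (complex \<Rightarrow> 'v::real_normed_vector) \<Rightarrow> bool" where
  "Ck_on 0 S f \<longleftrightarrow> continuous_on S f"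
| "Ck_on (Suc k) S f \<longleftrightarrow> (\<forall>x\<in>S. f differentiable (at x)) \<and>
      (\<forall>v. Ck_on k S (\<lambda>x. frechet_derivative f (at x) v))"

type_synonym 'm chart = "'m set \<times> ('m \<Rightarrow> complex)"

abbreviation chart_inv :: "'m chart \<Rightarrow> complex \<Rightarrow> 'm" where
  "chart_inv c \<equiv> inv_into (fst c) (snd c)"

text \<open>
  An oriented surface with a conformal structure, given by its atlas of oriented isothermal
  (conformal) coordinates: transition maps between these are the orientation-preserving conformal
  maps between plane domains, i.e. the biholomorphic ones. In such a coordinate \<open>J\<close> is
  multiplication by \<open>\<i>\<close>.
\<close>

definition conformal_atlas :: "'m::topological_space chart set \<Rightarrow> bool" where
  "conformal_atlas \<A> \<longleftrightarrow>
     (\<forall>c\<in>\<A>. open (fst c) \<and> open (snd c ` fst c) \<and>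
        homeomorphism (fst c) (snd c ` fst c) (snd c) (chart_inv c)) \<and>
     (\<forall>c\<in>\<A>. \<forall>c'\<in>\<A>. (snd c' \<circ> chart_inv c) holomorphic_on snd c ` (fst c \<inter> fst c'))"

definition points :: "'m chart set \<Rightarrow> 'm set" where
  "points \<A> = (\<Union>c\<in>\<A>. fst c)"

definition smooth_map_on ::
    "'m chart set \<Rightarrow> 'm set \<Rightarrow> ('m \<Rightarrow> 'v::real_normed_vector) \<Rightarrow> bool" where
  "smooth_map_on \<A> W f \<longleftrightarrow>
     (\<forall>c\<in>\<A>. \<forall>k. Ck_on k (snd c ` (fst c \<inter> W)) (f \<circ> chart_inv c))"

text \<open>
  A 1-form assigns to a chart \<open>c\<close>, a point \<open>p\<close> in its domain and a real tangent vector at \<open>p\<close>,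
  written as a complex number by means of \<open>c\<close>, its value; \<open>one_form\<close> below requires independence
  of the chart.
\<close>

type_synonym ('m, 'v) form1 = "'m chart \<Rightarrow> 'm \<Rightarrow> complex \<Rightarrow> 'v"

definition one_form :: "'m chart set \<Rightarrow> ('m, 'v::real_normed_vector) form1 \<Rightarrow> bool" where
  "one_form \<A> \<omega> \<longleftrightarrow>
     (\<forall>c\<in>\<A>. \<forall>p\<in>fst c. linear (\<omega> c p)) \<and>
     (\<forall>c\<in>\<A>. \<forall>v. smooth_map_on \<A> (fst c) (\<lambda>p. \<omega> c p v)) \<and>
     (\<forall>c\<in>\<A>. \<forall>c'\<in>\<A>. \<forall>p\<in>fst c \<inter> fst c'. \<forall>v.
        \<omega> c' p (deriv (snd c' \<circ> chart_inv c) (snd c p) * v) = \<omega> c p v)"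

definition form10 :: "('m, 'k::finite cmat) form1 \<Rightarrow> ('m, 'k cmat) form1" where
  "form10 \<omega> c p v = (1/2) *m (\<omega> c p v - \<i> *m \<omega> c p (\<i> * v))"

definition form01 :: "('m, 'k::finite cmat) form1 \<Rightarrow> ('m, 'k cmat) form1" where
  "form01 \<omega> c p v = (1/2) *m (\<omega> c p v + \<i> *m \<omega> c p (\<i> * v))"

definition vform10 :: "('m, 'k::finite cvec) form1 \<Rightarrow> ('m, 'k cvec) form1" where
  "vform10 \<omega> c p v = (1/2) *s (\<omega> c p v - \<i> *s \<omega> c p (\<i> * v))"

definition vform01 :: "('m, 'k::finite cvec) form1 \<Rightarrow> ('m, 'k cvec) form1" where
  "vform01 \<omega> c p v = (1/2) *s (\<omega> c p v + \<i> *s \<omega> c p (\<i> * v))"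

definition form_star :: "('m, 'k::finite cmat) form1 \<Rightarrow> ('m, 'k cmat) form1" where
  "form_star \<omega> c p v = - \<omega> c p (\<i> * v)"

definition bracket_wedge :: "('m, 'k::finite cmat) form1 \<Rightarrow> ('m, 'k cmat) form1 \<Rightarrow>
    'm chart \<Rightarrow> 'm \<Rightarrow> complex \<Rightarrow> complex \<Rightarrow> 'k cmat" where
  "bracket_wedge \<mu> \<eta> c p x y =
     commutator (\<mu> c p x) (\<eta> c p y) - commutator (\<mu> c p y) (\<eta> c p x)"


section \<open>Connections and subbundles\<close>

text \<open>Connections on the trivial bundle, as operators from sections to vector-valued 1-forms.\<close>

type_synonym ('m, 'k) connection = "('m \<Rightarrow> 'k cvec) \<Rightarrow> ('m, 'k cvec) form1"

definition dtriv :: "('m, 'k::finite) connection" where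
  "dtriv \<sigma> c p v = frechet_derivative (\<sigma> \<circ> chart_inv c) (at (snd c p)) v"

text \<open>The induced connection on endomorphisms (\<open>w\<close> stands for a constant section).\<close>

definition end_conn :: "('m, 'k::finite) connection \<Rightarrow> ('m \<Rightarrow> 'k cmat) \<Rightarrow> ('m, 'k cmat) form1" where
  "end_conn D \<xi> c p v =
     matrix (\<lambda>w. D (\<lambda>x. \<xi> x *v w) c p v - \<xi> p *v D (\<lambda>x. w) c p v)"

text \<open>
  The exterior derivative, evaluated on the vector fields that have constant coordinates \<open>x\<close>, \<open>y\<close>
  in the chart; these commute, so the term in \<open>[X, Y]\<close> is absent.
\<close>

definition ext_deriv :: "('m, 'k::finite) connection \<Rightarrow> ('m, 'k cmat) form1 \<Rightarrow>
    'm chart \<Rightarrow> 'm \<Rightarrow> complex \<Rightarrow> complex \<Rightarrow> 'k cmat" where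
  "ext_deriv D \<omega> c p x y =
     end_conn D (\<lambda>r. \<omega> c r y) c p x - end_conn D (\<lambda>r. \<omega> c r x) c p y"

type_synonym ('m, 'k) vbundle = "'m \<Rightarrow> 'k cvec set"

definition subbundle ::
    "'m::topological_space chart set \<Rightarrow> nat \<Rightarrow> ('m, 'k::finite) vbundle \<Rightarrow> bool" where
  "subbundle \<A> k V \<longleftrightarrow>
     (\<forall>p\<in>points \<A>. vec.subspace (V p) \<and> vec.dim (V p) = k \<and>
        (\<exists>W s. open W \<and> p \<in> W \<and> W \<subseteq> points \<A> \<and>
           (\<forall>i<k. smooth_map_on \<A> W (s i)) \<and>
           (\<forall>x\<in>W. V x = vec.span {s i x | i. i < (k::nat)})))"

definition nondeg_bundle :: "'m chart set \<Rightarrow> ('m, 'k::finite) vbundle \<Rightarrow> bool" where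
  "nondeg_bundle \<A> V \<longleftrightarrow> (\<forall>p\<in>points \<A>. nondegenerate (V p))"

definition isotropic_bundle :: "'m chart set \<Rightarrow> ('m, 'k::finite) vbundle \<Rightarrow> bool" where
  "isotropic_bundle \<A> V \<longleftrightarrow> (\<forall>p\<in>points \<A>. isotropic (V p))"

definition local_section :: "'m::topological_space chart set \<Rightarrow> ('m, 'k::finite) vbundle \<Rightarrow>
    'm set \<Rightarrow> ('m \<Rightarrow> 'k cvec) \<Rightarrow> bool" where
  "local_section \<A> V W \<sigma> \<longleftrightarrow>
     open W \<and> W \<subseteq> points \<A> \<and> smooth_map_on \<A> W \<sigma> \<and> (\<forall>x\<in>W. \<sigma> x \<in> V x)"

definition parallel :: "'m::topological_space chart set \<Rightarrow> ('m, 'k::finite) connection \<Rightarrow>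
    ('m, 'k) vbundle \<Rightarrow> bool" where
  "parallel \<A> D L \<longleftrightarrow>
     (\<forall>W \<sigma>. local_section \<A> L W \<sigma> \<longrightarrow>
        (\<forall>c\<in>\<A>. \<forall>p\<in>fst c \<inter> W. \<forall>v. D \<sigma> c p v \<in> L p))"

definition map_bundle :: "('m \<Rightarrow> 'k::finite cmat) \<Rightarrow> ('m, 'k) vbundle \<Rightarrow> ('m, 'k) vbundle" where
  "map_bundle \<phi> V p = (*v) (\<phi> p) ` V p"

definition connection_isometry :: "'m chart set \<Rightarrow> ('m, 'k::finite) connection \<Rightarrow>
    ('m, 'k) connection \<Rightarrow> ('m \<Rightarrow> 'k cmat) \<Rightarrow> bool" where
  "connection_isometry \<A> D D' \<phi> \<longleftrightarrow>
     smooth_map_on \<A> (points \<A>) \<phi> \<and>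
     (\<forall>p\<in>points \<A>. \<phi> p \<in> orthogonal_maps) \<and>
     (\<forall>\<sigma>. smooth_map_on \<A> (points \<A>) \<sigma> \<longrightarrow>
        (\<forall>c\<in>\<A>. \<forall>p\<in>fst c. \<forall>v. \<phi> p *v D \<sigma> c p v = D' (\<lambda>x. \<phi> x *v \<sigma> x) c p v))"


section \<open>Constrained harmonic bundles\<close>

definition DV :: "('m, 'k::finite) vbundle \<Rightarrow> ('m, 'k) connection" where
  "DV V \<sigma> c p v =
     proj (V p) (orth (V p)) *v dtriv (\<lambda>x. proj (V x) (orth (V x)) *v \<sigma> x) c p v +
     proj (orth (V p)) (V p) *v dtriv (\<lambda>x. proj (orth (V x)) (V x) *v \<sigma> x) c p v"

text \<open>The difference of \<open>d\<close> and \<open>DV V\<close> is tensorial, hence determined by its values on constant sections.\<close>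

definition NV :: "('m, 'k::finite) vbundle \<Rightarrow> ('m, 'k cmat) form1" where
  "NV V c p v = matrix (\<lambda>w. dtriv (\<lambda>x. w) c p v - DV V (\<lambda>x. w) c p v)"

definition dlam :: "('m, 'k::finite) vbundle \<Rightarrow> ('m, 'k cmat) form1 \<Rightarrow> complex \<Rightarrow>
    ('m, 'k) connection" where
  "dlam V q l \<sigma> c p v =
     DV V \<sigma> c p v +
     (inverse l *m form10 (NV V) c p v + l *m form01 (NV V) c p v +
      (inverse (l^2) - 1) *m form10 q c p v + (l^2 - 1) *m form01 q c p v) *v \<sigma> p"

definition constrained_harmonic :: "'m::topological_space chart set \<Rightarrow> ('m, 'k::finite) vbundle \<Rightarrow>
    ('m, 'k cmat) form1 \<Rightarrow> bool" where
  "constrained_harmonic \<A> V q \<longleftrightarrow>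
     (\<exists>k. subbundle \<A> k V) \<and> nondeg_bundle \<A> V \<and> one_form \<A> q \<and>
     (\<forall>c\<in>\<A>. \<forall>p\<in>fst c.
        (\<forall>v. q c p v \<in> set_sum (Wedge2 (V p)) (Wedge2 (orth (V p)))) \<and>
        (\<forall>x y.
           ext_deriv (DV V) (form10 q) c p x y = (1/2) *m bracket_wedge q q c p x y \<and>
           ext_deriv (DV V) (form01 q) c p x y = (1/2) *m bracket_wedge q q c p x y \<and>
           ext_deriv (DV V) (form_star (NV V)) c p x y =
             2 *m bracket_wedge q (form_star (NV V)) c p x y))"


section \<open>Constrained Willmore surfaces\<close>

definition surface_pair :: "'m::topological_space chart set \<Rightarrow> ('m, 'k::finite) vbundle \<Rightarrow>
    ('m, 'k) vbundle \<Rightarrow> bool" where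
  "surface_pair \<A> \<Delta>10 \<Delta>01 \<longleftrightarrow>
     subbundle \<A> 2 \<Delta>10 \<and> isotropic_bundle \<A> \<Delta>10 \<and>
     subbundle \<A> 2 \<Delta>01 \<and> isotropic_bundle \<A> \<Delta>01 \<and>
     subbundle \<A> 1 (\<lambda>p. \<Delta>10 p \<inter> \<Delta>01 p) \<and>
     (\<forall>W \<sigma>. local_section \<A> (\<lambda>p. \<Delta>10 p \<inter> \<Delta>01 p) W \<sigma> \<longrightarrow>
        (\<forall>c\<in>\<A>. \<forall>p\<in>fst c \<inter> W. \<forall>v.
           vform10 (dtriv \<sigma>) c p v \<in> \<Delta>10 p \<and> vform01 (dtriv \<sigma>) c p v \<in> \<Delta>01 p))"

definition central_sphere_congruence :: "'m::topological_space chart set \<Rightarrow>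
    ('m, 'k::finite) vbundle \<Rightarrow> ('m, 'k) vbundle \<Rightarrow> ('m, 'k) vbundle \<Rightarrow> bool" where
  "central_sphere_congruence \<A> V \<Delta>10 \<Delta>01 \<longleftrightarrow>
     subbundle \<A> 4 V \<and> nondeg_bundle \<A> V \<and>
     (\<forall>p\<in>points \<A>. set_sum (\<Delta>10 p) (\<Delta>01 p) \<subseteq> V p) \<and>
     (\<forall>c\<in>\<A>. \<forall>p\<in>fst c. \<forall>v.
        (\<forall>w\<in>\<Delta>01 p. form10 (NV V) c p v *v w = 0) \<and>
        (\<forall>w\<in>\<Delta>10 p. form01 (NV V) c p v *v w = 0))"

definition qd_central_sphere_congruence :: "'m::topological_space chart set \<Rightarrow>
    ('m, 'k::finite) vbundle \<Rightarrow> ('m, 'k cmat) form1 \<Rightarrow> ('m, 'k) vbundle \<Rightarrow> ('m, 'k) vbundle \<Rightarrow> bool" where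
  "qd_central_sphere_congruence \<A> V q \<Delta>10 \<Delta>01 \<longleftrightarrow>
     central_sphere_congruence \<A> V \<Delta>10 \<Delta>01 \<and> constrained_harmonic \<A> V q"

definition constrained_willmore :: "'m::topological_space chart set \<Rightarrow> ('m, 'k::finite cmat) form1 \<Rightarrow>
    ('m, 'k) vbundle \<Rightarrow> ('m, 'k) vbundle \<Rightarrow> bool" where
  "constrained_willmore \<A> q \<Delta>10 \<Delta>01 \<longleftrightarrow>
     surface_pair \<A> \<Delta>10 \<Delta>01 \<and>
     (\<forall>c\<in>\<A>. \<forall>p\<in>fst c. \<forall>v.
        form10 q c p v \<in> Wedge2 (\<Delta>01 p) \<and> form01 q c p v \<in> Wedge2 (\<Delta>10 p)) \<and>
     (\<exists>V. qd_central_sphere_congruence \<A> V q \<Delta>10 \<Delta>01)"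


section \<open>Spectral deformation and Baecklund transformation\<close>

definition spectral_multiplier :: "('m \<Rightarrow> 'k::finite cmat) \<Rightarrow> ('m, 'k cmat) form1 \<Rightarrow> complex \<Rightarrow>
    ('m, 'k cmat) form1" where
  "spectral_multiplier \<phi> q l c p v =
     Ad (\<phi> p) (inverse (l^2) *m form10 q c p v + l^2 *m form01 q c p v)"

datatype csphere = Fin complex | Infty

text \<open>
  The dressing factors are defined fibrewise, for the fibre \<open>W\<close> of the bundle \<open>V\<close> and a null line
  \<open>L\<close>; \<open>reflected W L\<close> is the line \<open>\<rho> L\<close>. They have poles at \<open>\<plusminus>a\<close>, where the values
  are not used.
\<close>

definition reflected :: "'k::finite cvec set \<Rightarrow> 'k cvec set \<Rightarrow> 'k cvec set" where
  "reflected W L = (*v) (reflection W) ` L"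

definition pi_line :: "'k::finite cvec set \<Rightarrow> 'k cvec set \<Rightarrow> 'k cmat" where
  "pi_line W L = proj L (set_sum (reflected W L) (orth (set_sum L (reflected W L))))"

definition pi_refl :: "'k::finite cvec set \<Rightarrow> 'k cvec set \<Rightarrow> 'k cmat" where
  "pi_refl W L = proj (reflected W L) (set_sum L (orth (set_sum L (reflected W L))))"

definition pi_perp :: "'k::finite cvec set \<Rightarrow> 'k cvec set \<Rightarrow> 'k cmat" where
  "pi_perp W L = proj (orth (set_sum L (reflected W L))) (set_sum L (reflected W L))"

fun pfactor :: "'k::finite cvec set \<Rightarrow> complex \<Rightarrow> 'k cvec set \<Rightarrow> csphere \<Rightarrow> 'k cmat" where
  "pfactor W a L (Fin l) =
     ((a - l) / (a + l)) *m pi_line W L + pi_perp W L + ((a + l) / (a - l)) *m pi_refl W L"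
| "pfactor W a L Infty = - pi_line W L + pi_perp W L - pi_refl W L"

fun qfactor :: "'k::finite cvec set \<Rightarrow> complex \<Rightarrow> 'k cvec set \<Rightarrow> csphere \<Rightarrow> 'k cmat" where
  "qfactor W a L (Fin l) =
     ((l - a) / (l + a)) *m pi_line W L + pi_perp W L + ((l + a) / (l - a)) *m pi_refl W L"
| "qfactor W a L Infty = mat 1"

text \<open>\<open>dressed_line V \<alpha> L\<alpha> \<beta> L\<beta>\<close> is the line bundle $q_{\alpha,L^\alpha}(\beta)L^\beta$.\<close>

definition dressed_line :: "('m, 'k::finite) vbundle \<Rightarrow> complex \<Rightarrow> ('m, 'k) vbundle \<Rightarrow> complex \<Rightarrow>
    ('m, 'k) vbundle \<Rightarrow> ('m, 'k) vbundle" where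
  "dressed_line V a L b L' = map_bundle (\<lambda>p. qfactor (V p) a (L p) (Fin b)) L'"

definition null_line_bundle ::
    "'m::topological_space chart set \<Rightarrow> ('m, 'k::finite) vbundle \<Rightarrow> bool" where
  "null_line_bundle \<A> L \<longleftrightarrow> subbundle \<A> 1 L \<and> isotropic_bundle \<A> L"

definition backlund_parameters :: "'m::topological_space chart set \<Rightarrow> ('m, 'k::finite) vbundle \<Rightarrow>
    ('m, 'k cmat) form1 \<Rightarrow> complex \<Rightarrow> complex \<Rightarrow> ('m, 'k) vbundle \<Rightarrow> ('m, 'k) vbundle \<Rightarrow> bool" where
  "backlund_parameters \<A> V q \<alpha> \<beta> L\<alpha> L\<beta> \<longleftrightarrow>
     \<alpha> \<notin> {-1, 0, 1} \<and> \<beta> \<notin> {-1, 0, 1} \<and> \<beta> \<noteq> \<alpha> \<and> \<beta> \<noteq> - \<alpha> \<and>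
     null_line_bundle \<A> L\<alpha> \<and> parallel \<A> (dlam V q \<alpha>) L\<alpha> \<and>
     null_line_bundle \<A> L\<beta> \<and> parallel \<A> (dlam V q \<beta>) L\<beta> \<and>
     (\<forall>L\<in>{L\<alpha>, L\<beta>, dressed_line V \<alpha> L\<alpha> \<beta> L\<beta>, dressed_line V \<beta> L\<beta> \<alpha> L\<alpha>}.
        \<forall>p\<in>points \<A>. reflected (V p) (L p) \<inter> orth (L p) = {0})"

definition rstar :: "('m, 'k::finite) vbundle \<Rightarrow> complex \<Rightarrow> complex \<Rightarrow> ('m, 'k) vbundle \<Rightarrow>
    ('m, 'k) vbundle \<Rightarrow> csphere \<Rightarrow> 'm \<Rightarrow> 'k cmat" where
  "rstar V \<alpha> \<beta> L\<alpha> L\<beta> \<mu> p =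
     pfactor (V p) \<alpha> (dressed_line V \<beta> L\<beta> \<alpha> L\<alpha> p) \<mu> ** qfactor (V p) \<beta> (L\<beta> p) \<mu>"

definition backlund :: "('m, 'k::finite) vbundle \<Rightarrow> complex \<Rightarrow> complex \<Rightarrow> ('m, 'k) vbundle \<Rightarrow>
    ('m, 'k) vbundle \<Rightarrow> ('m, 'k) vbundle" where
  "backlund V \<alpha> \<beta> L\<alpha> L\<beta> =
     map_bundle (\<lambda>p. matrix_inv (rstar V \<alpha> \<beta> L\<alpha> L\<beta> (Fin 1) p)) V"

definition backlund10 :: "('m, 'k::finite) vbundle \<Rightarrow> complex \<Rightarrow> complex \<Rightarrow> ('m, 'k) vbundle \<Rightarrow>
    ('m, 'k) vbundle \<Rightarrow> ('m, 'k) vbundle \<Rightarrow> ('m, 'k) vbundle" where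
  "backlund10 V \<alpha> \<beta> L\<alpha> L\<beta> \<Delta>10 =
     map_bundle (\<lambda>p. matrix_inv (rstar V \<alpha> \<beta> L\<alpha> L\<beta> (Fin 1) p) ** rstar V \<alpha> \<beta> L\<alpha> L\<beta> Infty p) \<Delta>10"

definition backlund01 :: "('m, 'k::finite) vbundle \<Rightarrow> complex \<Rightarrow> complex \<Rightarrow> ('m, 'k) vbundle \<Rightarrow>
    ('m, 'k) vbundle \<Rightarrow> ('m, 'k) vbundle \<Rightarrow> ('m, 'k) vbundle" where
  "backlund01 V \<alpha> \<beta> L\<alpha> L\<beta> \<Delta>01 =
     map_bundle (\<lambda>p. matrix_inv (rstar V \<alpha> \<beta> L\<alpha> L\<beta> (Fin 1) p) ** rstar V \<alpha> \<beta> L\<alpha> L\<beta> (Fin 0) p) \<Delta>01"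

definition backlund_multiplier :: "('m, 'k::finite) vbundle \<Rightarrow> complex \<Rightarrow> complex \<Rightarrow> ('m, 'k) vbundle \<Rightarrow>
    ('m, 'k) vbundle \<Rightarrow> ('m, 'k cmat) form1 \<Rightarrow> ('m, 'k cmat) form1" where
  "backlund_multiplier V \<alpha> \<beta> L\<alpha> L\<beta> q c p v =
     Ad (matrix_inv (rstar V \<alpha> \<beta> L\<alpha> L\<beta> (Fin 1) p))
       (Ad (rstar V \<alpha> \<beta> L\<alpha> L\<beta> (Fin 0) p) (form10 q c p v) +
        Ad (rstar V \<alpha> \<beta> L\<alpha> L\<beta> Infty p) (form01 q c p v))"

text \<open>
  Equality up to one constant orthogonal transformation for all the given pairs of bundles. The
  surface is not assumed connected, so the constant is taken on each connected open subset; for a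
  connected surface it is global.
\<close>

definition coincide_up_to_constant :: "'m::topological_space chart set \<Rightarrow>
    (('m, 'k::finite) vbundle \<times> ('m, 'k) vbundle) set \<Rightarrow> bool" where
  "coincide_up_to_constant \<A> P \<longleftrightarrow>
     (\<forall>U. open U \<and> connected U \<and> U \<subseteq> points \<A> \<longrightarrow>
        (\<exists>A\<in>orthogonal_maps. \<forall>(E, F)\<in>P. \<forall>p\<in>U. E p = (*v) A ` F p))"

end

theory Submission
  imports Defs
begin

text \<open>
  Let \<open>\<rho>\<close> be the reflection in \<open>V\<close>. Since \<open>N = - \<rho> d\<rho> / 2\<close>, the connection of parameter \<open>x\<close> is
  \<open>d + \<Omega>(x)\<close> with \<open>\<Omega>\<close> a Laurent polynomial in \<open>x\<close>, skew, and conjugation by \<open>\<rho>\<close> exchanges \<open>x\<close> and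
  \<open>- x\<close>. Conversely such a family is determined by its extreme coefficients after a gauge
  transformation that trivialises it at one parameter: the part anticommuting with the reflection must
  be the second fundamental form. Dressing by \<open>p\<^sub>a\<^sub>,\<^sub>L\<close> or \<open>q\<^sub>a\<^sub>,\<^sub>L\<close> keeps this shape, because the parallelism
  of \<open>L\<close> and of \<open>\<rho>L\<close> cancels the poles at \<open>\<plusminus>a\<close>. Hence the dressed family, gauged by \<open>r\<^sup>*(1)\<close>, is the
  family of \<open>(V\<^sup>*, q\<^sup>*)\<close>, and \<open>\<phi> r\<^sup>*(l)\<^sup>-\<^sup>1 r\<^sup>*(1)\<close> trivialises it at \<open>l\<close>. On the other side the
  dressing factors of \<open>\<phi>V\<close> at \<open>\<mu>\<close> are the conjugates by \<open>\<phi>\<close> of those of \<open>V\<close> at \<open>l \<mu>\<close>, so both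
  constructions give \<open>\<phi> r\<^sup>*(l)\<^sup>-\<^sup>1 V\<close>. Two trivialisations differ by a locally constant orthogonal map.
\<close>

section \<open>Matrices and the Minkowski adjoint\<close>

text \<open>At one point of one chart the argument is matrix algebra: reflections, projections and
  gauges enter with derivative values as separate matrices, tied by the differentiated relations.
  The obstacle is the order of the poles. Conjugation by a factor with eigenvalue \<open>f\<close>
  on L and \<open>inverse f\<close> on its reflected line scales the blocks of a form by powers of
  \<open>f\<close> from -2 to 2. The blocks of weight 2 and -2 join the two null lines; a skew form
  has none, because its value on a single vector is orthogonal to that vector. What remains are
  simple poles, one group of blocks at \<open>a\<close> and its mirror at \<open>-a\<close>. The
  first group vanishes at \<open>a\<close> because L is parallel there, the mirror group vanishes at
  \<open>-a\<close> because the reflected line is. Dividing such a pole out keeps the exponents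
  between -2 and 2, and the extreme coefficients are conjugated by the values of the factor at 0 and
  at infinity: this is the origin of these two values in the transformed multiplier. The coefficient
  of index 0 is recovered from the vanishing of the gauged form at one parameter. The deformation of
  the transformed bundle exists by an explicit formula, with no integration of a flat
  connection.\<close>

lemma mscale_nth [simp]: "(c *m A) $ i $ j = c * A $ i $ j"
  by (simp add: mscale_def)

lemma mscale_mult_left: "(c *m A) ** B = c *m (A ** B)"
  by (simp add: vec_eq_iff matrix_matrix_mult_def sum_distrib_left mult.assoc)

lemma mscale_mult_right: "A ** (c *m B) = c *m (A ** B)"
  by (simp add: vec_eq_iff matrix_matrix_mult_def sum_distrib_left mult.left_commute)

lemma mscale_vec: "(c *m A) *v w = c *s (A *v w)"
  by (simp add: vec_eq_iff matrix_vector_mult_def sum_distrib_left mult.assoc)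

lemma mult_vec_scale: "A *v (c *s w) = c *s (A *v w)" for A :: "'k::finite cmat"
  by (simp add: vec_eq_iff matrix_vector_mult_def sum_distrib_left mult.left_commute)

lemma mscale_add: "c *m (A + B) = c *m A + c *m B"
  by (simp add: vec_eq_iff distrib_left)

lemma mscale_diff: "c *m (A - B) = c *m A - c *m B"
  by (simp add: vec_eq_iff right_diff_distrib)

lemma mscale_minus: "c *m (- A) = - (c *m A)"
  by (simp add: vec_eq_iff)

lemma mscale_zero [simp]: "c *m 0 = 0"
  by (simp add: vec_eq_iff)

lemma zero_mscale [simp]: "0 *m A = 0"
  by (simp add: vec_eq_iff)

lemma one_mscale [simp]: "1 *m A = A"
  by (simp add: vec_eq_iff)

lemma mscale_mscale [simp]: "c *m (d *m A) = (c * d) *m A"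
  by (simp add: vec_eq_iff mult.assoc)

lemma add_mscale: "(c + d) *m A = c *m A + d *m A"
  by (simp add: vec_eq_iff distrib_right)

lemma diff_mscale: "(c - d) *m A = c *m A - d *m A"
  by (simp add: vec_eq_iff left_diff_distrib)

lemma minus_mscale: "(- c) *m A = - (c *m A)"
  by (simp add: vec_eq_iff)

lemma mat_mult_minus_left: "(- A) ** B = - (A ** B)" for A :: "'k::finite cmat"
  by (simp add: vec_eq_iff matrix_matrix_mult_def sum_negf)

lemma mat_mult_minus_right: "A ** (- B) = - (A ** B)" for A :: "'k::finite cmat"
  by (simp add: vec_eq_iff matrix_matrix_mult_def sum_negf)

lemma mat_mult_diff_left: "(A - B) ** C = A ** C - B ** C" for A :: "'k::finite cmat"
  by (simp add: vec_eq_iff matrix_matrix_mult_def sum_subtractf left_diff_distrib)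

lemma mat_mult_diff_right: "A ** (B - C) = A ** B - A ** C" for A :: "'k::finite cmat"
  by (simp add: vec_eq_iff matrix_matrix_mult_def sum_subtractf right_diff_distrib)

lemma mat_mult_add_left: "(A + B) ** C = A ** C + B ** C" for A :: "'k::finite cmat"
  by (simp add: vec_eq_iff matrix_matrix_mult_def sum.distrib distrib_right)

lemma mat_mult_zero [simp]: "A ** 0 = 0" "0 ** A = 0" for A :: "'k::finite cmat"
  by (simp_all add: vec_eq_iff matrix_matrix_mult_def)

lemma minus_mat_vec: "(- A) *v w = - (A *v w)" for A :: "'k::finite cmat"
  by (simp add: vec_eq_iff matrix_vector_mult_def sum_negf)

lemma mat_vec_minus: "A *v (- w) = - (A *v w)" for A :: "'k::finite cmat"
  by (simp add: vec_eq_iff matrix_vector_mult_def sum_negf)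

lemma mat_eqI: "(\<And>w. A *v w = B *v w) \<Longrightarrow> A = B" for A B :: "'k::finite cmat"
  by (simp add: matrix_eq)

lemmas mscale_ring = mscale_mult_left mscale_mult_right mscale_add mscale_diff mscale_minus
  add_mscale diff_mscale minus_mscale

text \<open>Expands products over sums and nests them to the right. Cancellation rules therefore
  come with a variant that carries a trailing factor.\<close>

lemmas mat_ring = matrix_add_ldistrib mat_mult_add_left mat_mult_diff_left mat_mult_diff_right
  mat_mult_minus_left mat_mult_minus_right matrix_mul_assoc[symmetric]

lemmas mat_vec_ring = matrix_vector_mult_add_rdistrib matrix_vector_mult_diff_rdistrib
  matrix_vector_right_distrib matrix_vector_mult_diff_distrib minus_mat_vec mat_vec_minus
  mscale_vec mult_vec_scale matrix_vector_mul_assoc[symmetric]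

section \<open>Adjoints and orthogonal maps of the Minkowski form\<close>

definition mink_mat :: "'k::finite cmat" where
  "mink_mat = (\<chi> i j. if i = j then (case i of None \<Rightarrow> -1 | Some _ \<Rightarrow> 1) else 0)"

text \<open>\<open>mink_mat\<close> is its own inverse, so this is the adjoint for
  \<open>mink\<close>. On orthogonal maps it is the inverse, yet linear in the entries, so inverses
  are easy to differentiate.\<close>

definition adj :: "'k::finite cmat \<Rightarrow> 'k cmat" where
  "adj A = mink_mat ** transpose A ** mink_mat"

text \<open>Bilinear, without conjugation, in contrast to the real-valued inner product of the type
  class.\<close>

definition tdot :: "complex ^ 'n \<Rightarrow> complex ^ 'n \<Rightarrow> complex" where
  "tdot v w = (\<Sum>i\<in>UNIV. v $ i * w $ i)"

lemma sum_option: "sum f (UNIV :: 'k::finite option set) = f None + (\<Sum>i\<in>UNIV. f (Some i))"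
proof -
  have "sum f (UNIV :: 'k option set) = f None + sum f (range Some)"
    by (simp add: UNIV_option_conv)
  then show ?thesis by (simp add: sum.reindex)
qed

lemma mink_mat_vec: "(mink_mat *v w) $ i = (case i of None \<Rightarrow> - w $ None | Some k \<Rightarrow> w $ Some k)"
  by (simp add: mink_mat_def matrix_vector_mult_def if_distrib[where f = "\<lambda>x. x * _"] cong: if_cong
      split: option.split)

lemma mink_mat_square [simp]: "mink_mat ** mink_mat = mat 1"
  by (rule mat_eqI) (simp add: vec_eq_iff matrix_vector_mul_assoc[symmetric] mink_mat_vec split: option.split)

lemma transpose_mink_mat [simp]: "transpose mink_mat = mink_mat"
  by (simp add: vec_eq_iff transpose_def mink_mat_def)

lemma mink_tdot: "mink v w = tdot v (mink_mat *v w)"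
  by (simp add: mink_def tdot_def sum_option mink_mat_vec)

lemma tdot_mat: "tdot (A *v v) w = tdot v (transpose A *v w)"
proof -
  have "tdot (A *v v) w = (\<Sum>i\<in>UNIV. \<Sum>j\<in>UNIV. A $ i $ j * v $ j * w $ i)"
    by (simp add: tdot_def matrix_vector_mult_def sum_distrib_right)
  also have "\<dots> = (\<Sum>j\<in>UNIV. \<Sum>i\<in>UNIV. A $ i $ j * v $ j * w $ i)"
    by (rule sum.swap)
  also have "\<dots> = tdot v (transpose A *v w)"
    unfolding tdot_def matrix_vector_mult_def transpose_def
    by (simp add: sum_distrib_left mult_ac)
  finally show ?thesis .
qed

lemma tdot_all_zero: "(\<And>v. tdot v w = 0) \<Longrightarrow> w = 0"
proof -
  assume *: "\<And>v. tdot v w = 0"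
  have "w $ i = 0" for i
    using *[of "axis i 1"] by (simp add: tdot_def axis_def if_distrib[where f = "\<lambda>x. x * _"] cong: if_cong)
  then show ?thesis by (simp add: vec_eq_iff)
qed

lemma mink_commute: "mink v w = mink w v"
  by (simp add: mink_def mult.commute)

lemma mink_add_left: "mink (u + v) w = mink u w + mink v w"
  by (simp add: mink_def distrib_right sum.distrib)
lemma mink_add_right: "mink w (u + v) = mink w u + mink w v"
  by (simp add: mink_def distrib_left sum.distrib)
lemma mink_diff_left: "mink (u - v) w = mink u w - mink v w"
  by (simp add: mink_def left_diff_distrib sum_subtractf)
lemma mink_diff_right: "mink w (u - v) = mink w u - mink w v"
  by (simp add: mink_def right_diff_distrib sum_subtractf)
lemma mink_minus_left: "mink (- u) w = - mink u w"
  by (simp add: mink_def sum_negf)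
lemma mink_minus_right: "mink w (- u) = - mink w u"
  by (simp add: mink_def sum_negf)
lemma mink_scale_left: "mink (c *s u) w = c * mink u w"
  by (simp add: mink_def sum_distrib_left right_diff_distrib mult.assoc)
lemma mink_scale_right: "mink w (c *s u) = c * mink w u"
  using mink_scale_left[of c u w] by (simp add: mink_commute)
lemma mink_zero [simp]: "mink 0 w = 0" "mink w 0 = 0"
  by (simp_all add: mink_def)

lemmas mink_simps = mink_add_left mink_add_right mink_diff_left mink_diff_right mink_minus_left
  mink_minus_right mink_scale_left mink_scale_right

lemma mink_all_zero: assumes "\<And>v. mink v w = 0" shows "w = 0"
proof -
  have "mink_mat *v w = 0"
    using assms by (intro tdot_all_zero) (simp add: mink_tdot)
  then have "mink_mat *v (mink_mat *v w) = 0" by simp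
  then show ?thesis by (simp only: matrix_vector_mul_assoc mink_mat_square matrix_vector_mul_lid)
qed

lemma mink_adj: "mink (A *v v) w = mink v (adj A *v w)"
proof -
  have "mink_mat ** adj A = transpose A ** mink_mat"
    by (simp add: adj_def matrix_mul_assoc)
  then show ?thesis
    by (simp add: mink_tdot tdot_mat matrix_vector_mul_assoc del: transpose_matrix_vector)
qed

text \<open>Nondegeneracy of \<open>mink\<close> makes the adjoint unique, so every rule for
  \<open>adj\<close> below reduces to moving maps across pairings.\<close>

lemma adj_eqI: assumes "\<And>v w. mink (A *v v) w = mink v (B *v w)" shows "adj A = B"
proof (rule mat_eqI)
  fix w
  have "mink v (adj A *v w - B *v w) = 0" for v
    using assms[of v w] by (simp add: mink_simps mink_adj)
  then show "adj A *v w = B *v w" using mink_all_zero by force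
qed

lemma mink_adj': "mink v (A *v w) = mink (adj A *v v) w"
  by (metis mink_adj mink_commute)

lemma adj_adj [simp]: "adj (adj A) = A"
  by (rule adj_eqI) (simp add: mink_adj')

lemma adj_mult: "adj (A ** B) = adj B ** adj A"
  by (rule adj_eqI) (simp add: mink_adj matrix_vector_mul_assoc[symmetric])

lemma adj_add: "adj (A + B) = adj A + adj B"
  by (rule adj_eqI) (simp add: mink_adj mat_vec_ring mink_simps)

lemma adj_diff: "adj (A - B) = adj A - adj B"
  by (rule adj_eqI) (simp add: mink_adj mat_vec_ring mink_simps)

lemma adj_minus: "adj (- A) = - adj A"
  by (rule adj_eqI) (simp add: mink_adj mat_vec_ring mink_simps)

lemma adj_mscale: "adj (c *m A) = c *m adj A"
  by (rule adj_eqI) (simp add: mink_adj mat_vec_ring mink_simps)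

lemma adj_one [simp]: "adj (mat 1) = mat 1"
  by (rule adj_eqI) simp

lemma adj_zero [simp]: "adj 0 = 0"
  by (rule adj_eqI) simp

lemmas adj_simps = adj_mult adj_add adj_diff adj_minus adj_mscale

lemma orthogonal_maps_adj: "A \<in> orthogonal_maps \<longleftrightarrow> adj A ** A = mat 1"
proof
  assume "A \<in> orthogonal_maps"
  then have "adj (mat 1) = adj A ** A"
    by (intro adj_eqI) (simp add: orthogonal_maps_def mink_adj' matrix_vector_mul_assoc[symmetric] del: adj_one)
  then show "adj A ** A = mat 1" by simp
next
  assume *: "adj A ** A = mat 1"
  have "mink (A *v v) (A *v w) = mink v w" for v w
    by (simp only: mink_adj matrix_vector_mul_assoc * matrix_vector_mul_lid)
  then show "A \<in> orthogonal_maps" by (simp add: orthogonal_maps_def)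
qed

lemma orthogonal_maps_adj': "A \<in> orthogonal_maps \<longleftrightarrow> A ** adj A = mat 1"
  by (simp add: orthogonal_maps_adj matrix_left_right_inverse)

lemma orthogonal_maps_mult: "A \<in> orthogonal_maps \<Longrightarrow> B \<in> orthogonal_maps \<Longrightarrow> A ** B \<in> orthogonal_maps"
  by (simp add: orthogonal_maps_def matrix_vector_mul_assoc[symmetric])

lemma orthogonal_maps_adj_mem: "A \<in> orthogonal_maps \<Longrightarrow> adj A \<in> orthogonal_maps"
  by (metis adj_adj orthogonal_maps_adj orthogonal_maps_adj')

lemma orthogonal_maps_one: "mat 1 \<in> orthogonal_maps"
  by (simp add: orthogonal_maps_def)

text \<open>A one-sided inverse of a square matrix is two-sided, which pins down the choice inside
  \<open>matrix_inv\<close>.\<close>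

lemma matrix_inv_unique:
  fixes A :: "'k::finite cmat"
  assumes "A ** B = mat 1"
  shows "matrix_inv A = B"
proof -
  have BA: "B ** A = mat 1" using assms by (simp add: matrix_left_right_inverse)
  have "A ** matrix_inv A = mat 1 \<and> matrix_inv A ** A = mat 1"
    unfolding matrix_inv_def by (rule someI[of _ B]) (use assms BA in simp)
  then have "matrix_inv A ** (A ** B) = B" by (simp add: matrix_mul_assoc)
  then show ?thesis by (simp add: assms)
qed

lemma matrix_inv_orthogonal: "A \<in> orthogonal_maps \<Longrightarrow> matrix_inv A = adj A"
  by (intro matrix_inv_unique) (simp add: orthogonal_maps_adj')

lemma orthogonal_cancel:
  assumes "A \<in> orthogonal_maps"
  shows "adj A ** A = mat 1" "A ** adj A = mat 1" "adj A ** (A ** B) = B" "A ** (adj A ** B) = B"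
    "adj A *v (A *v w) = w" "A *v (adj A *v w) = w"
  using assms orthogonal_maps_adj[of A] orthogonal_maps_adj'[of A]
  by (simp_all add: matrix_mul_assoc matrix_vector_mul_assoc)

section \<open>Bivectors as skew endomorphisms\<close>

lemma wedge_vec: "wedge u w *v x = mink x u *s w - mink x w *s u"
proof -
  have "Vector_Spaces.linear (*s) (*s) (\<lambda>x. mink x u *s w - mink x w *s u)"
    by unfold_locales (auto simp: mink_simps vec_eq_iff algebra_simps)
  then show ?thesis by (simp add: wedge_def matrix_works)
qed

lemma adj_wedge: "adj (wedge u w) = - wedge u w"
  by (rule adj_eqI) (simp add: mat_vec_ring wedge_vec mink_simps mink_commute)

lemma wedge_conj: "A \<in> orthogonal_maps \<Longrightarrow> A ** wedge u w ** adj A = wedge (A *v u) (A *v w)"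
  by (rule mat_eqI) (simp add: mat_vec_ring wedge_vec mink_adj)

lemma mscale_scaleR: "r *\<^sub>R A = complex_of_real r *m A" for A :: "'k::finite cmat"
  by (simp add: vec_eq_iff scaleR_conv_of_real[where 'a=complex])

lemma Wedge2_skew: "X \<in> Wedge2 W \<Longrightarrow> adj X = - X"
  unfolding Wedge2_def
proof (induction rule: span_induct_alt)
  case base then show ?case by simp
next
  case (step c x y)
  then show ?case by (auto simp: adj_simps adj_wedge mscale_scaleR mscale_minus)
qed

text \<open>Bivectors are quadratic in vectors, so a sign acting on \<open>W\<close> squares away.
  With the reflection for \<open>A\<close>, the sign is 1 on the bundle and -1 on its complement,
  and the multiplier turns out to commute with the reflection.\<close>

lemma Wedge2_conj:
  assumes "A \<in> orthogonal_maps" "X \<in> Wedge2 W" "\<And>w. w \<in> W \<Longrightarrow> A *v w = c *s w" "c * c = 1"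
  shows "A ** X ** adj A = X"
  using assms(2) unfolding Wedge2_def
proof (induction rule: span_induct_alt)
  case base then show ?case by simp
next
  case (step r x y)
  then obtain u w where uw: "u \<in> W" "w \<in> W" "x = wedge u w" by auto
  have "wedge (c *s u) (c *s w) = wedge u w"
  proof (rule mat_eqI)
    fix x
    have "wedge (c *s u) (c *s w) *v x = (c * c) *s (wedge u w *v x)"
      by (simp add: wedge_vec mink_simps vec_eq_iff right_diff_distrib)
    then show "wedge (c *s u) (c *s w) *v x = wedge u w *v x" by (simp add: assms(4))
  qed
  then have "A ** x ** adj A = x"
    using uw assms(1,3) by (simp add: wedge_conj)
  with step show ?case by (simp add: mscale_scaleR mat_ring mscale_ring)
qed

section \<open>Smooth functions on plane domains\<close>

lemma bounded_linear_finite_dim: "linear f \<Longrightarrow> bounded_linear f"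
  for f :: "'a::euclidean_space \<Rightarrow> 'b::real_normed_vector"
  by (rule linear_conv_bounded_linear[THEN iffD1])

text \<open>The algebra is complex but tangent vectors and derivatives are real, so the product rule
  asks for bilinearity over the reals.\<close>

lemma bounded_bilinear_mat_mult: "bounded_bilinear ((**) :: 'k::finite cmat \<Rightarrow> 'k cmat \<Rightarrow> 'k cmat)"
proof -
  have "bilinear ((**) :: 'k cmat \<Rightarrow> 'k cmat \<Rightarrow> 'k cmat)"
    unfolding bilinear_def
    by (auto intro!: linearI simp: mat_ring mscale_scaleR mscale_ring)
  then show ?thesis by (simp add: bilinear_conv_bounded_bilinear)
qed

lemma bounded_bilinear_mat_vec: "bounded_bilinear ((*v) :: 'k::finite cmat \<Rightarrow> 'k cvec \<Rightarrow> 'k cvec)"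
proof -
  have "(r *\<^sub>R A) *v w = r *\<^sub>R (A *v w)" "A *v (r *\<^sub>R w) = r *\<^sub>R (A *v w)" for r and A :: "'k cmat" and w
    by (simp_all add: vec_eq_iff matrix_vector_mult_def scaleR_sum_right)
  then have "bilinear ((*v) :: 'k cmat \<Rightarrow> 'k cvec \<Rightarrow> 'k cvec)"
    unfolding bilinear_def by (auto intro!: linearI simp: mat_vec_ring)
  then show ?thesis by (simp add: bilinear_conv_bounded_bilinear)
qed

lemma bounded_linear_adj: "bounded_linear (adj :: 'k::finite cmat \<Rightarrow> 'k cmat)"
  by (rule bounded_linear_finite_dim) (auto intro!: linearI simp: adj_simps mscale_scaleR)

lemma bounded_linear_mscale: "bounded_linear ((*m) c :: 'k::finite cmat \<Rightarrow> 'k cmat)"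
  by (rule bounded_linear_finite_dim) (auto intro!: linearI simp: mscale_ring mscale_scaleR mult.commute)

lemma bounded_bilinear_mscale: "bounded_bilinear ((*m) :: complex \<Rightarrow> 'k::finite cmat \<Rightarrow> 'k cmat)"
proof -
  have "bilinear ((*m) :: complex \<Rightarrow> 'k cmat \<Rightarrow> 'k cmat)"
    unfolding bilinear_def
    by (auto intro!: linearI simp: mscale_ring mscale_scaleR scaleR_conv_of_real[where 'a=complex] mult.commute)
  then show ?thesis by (simp add: bilinear_conv_bounded_bilinear)
qed

lemma bounded_bilinear_mink: "bounded_bilinear (mink :: 'k::finite cvec \<Rightarrow> 'k cvec \<Rightarrow> complex)"
proof -
  have "r *\<^sub>R w = complex_of_real r *s w" for r and w :: "'k cvec"
    by (simp add: vec_eq_iff scaleR_conv_of_real[where 'a=complex])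
  then have "bilinear (mink :: 'k cvec \<Rightarrow> 'k cvec \<Rightarrow> complex)"
    unfolding bilinear_def
    by (auto intro!: linearI simp: mink_simps scaleR_conv_of_real[where 'a=complex])
  then show ?thesis by (simp add: bilinear_conv_bounded_bilinear)
qed

text \<open>The derivatives in \<open>Ck_on\<close> are taken in the whole plane, so agreement must
  hold on an open set to pass to them.\<close>

lemma Ck_on_cong:
  assumes "open S" "\<And>x. x \<in> S \<Longrightarrow> f x = g x" "Ck_on k S f"
  shows "Ck_on k S g"
  using assms(2,3)
proof (induction k arbitrary: f g)
  case 0 then show ?case by (auto cong: continuous_on_cong)
next
  case (Suc k)
  have hd: "(g has_derivative frechet_derivative f (at x)) (at x)" if "x \<in> S" for x
  proof (rule has_derivative_transform_within_open)
    show "(f has_derivative frechet_derivative f (at x)) (at x)"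
      using Suc.prems that by (auto simp: frechet_derivative_works[symmetric])
  qed (use assms Suc.prems that in auto)
  then have fd: "frechet_derivative g (at x) = frechet_derivative f (at x)" if "x \<in> S" for x
    using that frechet_derivative_at by metis
  show ?case
    unfolding Ck_on.simps
  proof (intro conjI allI ballI)
    fix x assume "x \<in> S" then show "g differentiable at x" using hd differentiable_def by blast
  next
    fix v show "Ck_on k S (\<lambda>x. frechet_derivative g (at x) v)"
      by (rule Suc.IH[of "\<lambda>x. frechet_derivative f (at x) v"]) (use Suc.prems fd in auto)
  qed
qed

text \<open>Lets the derivative be given by a formula instead of \<open>frechet_derivative\<close>;
  the closure properties below need this form for their inductions.\<close>

lemma Ck_on_SucI:
  assumes "open S" "\<And>x. x \<in> S \<Longrightarrow> (f has_derivative f' x) (at x)"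
    and "\<And>v. Ck_on k S (\<lambda>x. f' x v)"
  shows "Ck_on (Suc k) S f"
  unfolding Ck_on.simps
proof (intro conjI allI ballI)
  fix x assume "x \<in> S" then show "f differentiable at x" using assms(2) differentiable_def by blast
next
  fix v show "Ck_on k S (\<lambda>x. frechet_derivative f (at x) v)"
    by (rule Ck_on_cong[OF assms(1) _ assms(3)[of v]]) (use assms(2) frechet_derivative_at in metis)
qed

lemma Ck_on_SucD:
  assumes "Ck_on (Suc k) S f"
  shows "x \<in> S \<Longrightarrow> (f has_derivative frechet_derivative f (at x)) (at x)"
    and "Ck_on k S (\<lambda>x. frechet_derivative f (at x) v)"
  using assms by (auto simp: frechet_derivative_works[symmetric])

lemma Ck_on_Suc_imp: "Ck_on (Suc k) S f \<Longrightarrow> Ck_on k S f"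
proof (induction k arbitrary: f)
  case 0 then show ?case
    by (auto intro!: continuous_at_imp_continuous_on differentiable_imp_continuous_within)
next
  case (Suc k)
  then show ?case by (subst Ck_on.simps) (auto simp del: Ck_on.simps intro: Suc.IH Ck_on_SucD simp: Ck_on.simps(2)[of "Suc k"])
qed

lemma Ck_on_subset: "Ck_on k T f \<Longrightarrow> S \<subseteq> T \<Longrightarrow> Ck_on k S f"
  by (induction k arbitrary: f) (auto intro: continuous_on_subset)

text \<open>Frames of bundles exist only locally; this is what makes objects computed from them
  globally smooth.\<close>

lemma Ck_on_local:
  assumes "\<And>x. x \<in> S \<Longrightarrow> \<exists>T. open T \<and> x \<in> T \<and> Ck_on k (S \<inter> T) f"
  shows "Ck_on k S f"
  using assms
proof (induction k arbitrary: f)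
  case 0
  show ?case
    unfolding Ck_on.simps continuous_on_eq_continuous_within
  proof
    fix x assume x: "x \<in> S"
    then obtain T where T: "open T" "x \<in> T" "continuous_on (S \<inter> T) f" using 0[OF x] by auto
    then have "continuous (at x within S \<inter> T) f" using x by (simp add: continuous_on_eq_continuous_within)
    moreover have "at x within S \<inter> T = at x within S"
      by (rule at_within_nhd[of x T]) (use T in auto)
    ultimately show "continuous (at x within S) f" by (simp add: continuous_within)
  qed
next
  case (Suc k)
  show ?case
    unfolding Ck_on.simps
  proof (intro conjI allI ballI)
    fix x assume x: "x \<in> S"
    then obtain T where "x \<in> T" "Ck_on (Suc k) (S \<inter> T) f" using Suc.prems by meson
    with x show "f differentiable at x" by simp
  next
    fix v
    show "Ck_on k S (\<lambda>x. frechet_derivative f (at x) v)"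
    proof (rule Suc.IH)
      fix x assume "x \<in> S"
      then obtain T where "open T" "x \<in> T" "Ck_on (Suc k) (S \<inter> T) f" using Suc.prems by meson
      then show "\<exists>T. open T \<and> x \<in> T \<and> Ck_on k (S \<inter> T) (\<lambda>x. frechet_derivative f (at x) v)"
        using Ck_on_SucD(2) by blast
    qed
  qed
qed

lemma Ck_on_const: "open S \<Longrightarrow> Ck_on k S (\<lambda>x. c)"
  by (induction k arbitrary: c) (auto intro!: Ck_on_SucI[where f' = "\<lambda>x v. 0"] simp del: Ck_on.simps(2))

lemma Ck_on_add: "open S \<Longrightarrow> Ck_on k S f \<Longrightarrow> Ck_on k S g \<Longrightarrow> Ck_on k S (\<lambda>x. f x + g x)"
proof (induction k arbitrary: f g)
  case 0 then show ?case by (auto intro: continuous_on_add)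
next
  case (Suc k)
  show ?case
    by (rule Ck_on_SucI[OF Suc.prems(1)]) (auto intro!: has_derivative_add Ck_on_SucD[OF Suc.prems(2)] Ck_on_SucD[OF Suc.prems(3)] Suc.IH Suc.prems(1))
qed

lemma Ck_on_bilinear:
  assumes "bounded_bilinear pr"
  shows "open S \<Longrightarrow> Ck_on k S f \<Longrightarrow> Ck_on k S g \<Longrightarrow> Ck_on k S (\<lambda>x. pr (f x) (g x))"
proof (induction k arbitrary: f g)
  case 0 then show ?case by (auto intro: bounded_bilinear.continuous_on[OF assms])
next
  case (Suc k)
  show ?case
    by (rule Ck_on_SucI[OF Suc.prems(1)])
       (auto intro!: bounded_bilinear.FDERIV[OF assms] Ck_on_SucD[OF Suc.prems(2)] Ck_on_SucD[OF Suc.prems(3)]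
          Ck_on_add Suc.IH Suc.prems Ck_on_Suc_imp[OF Suc.prems(2)] Ck_on_Suc_imp[OF Suc.prems(3)])
qed

lemma Ck_on_linear:
  assumes "bounded_linear h"
  shows "open S \<Longrightarrow> Ck_on k S f \<Longrightarrow> Ck_on k S (\<lambda>x. h (f x))"
proof (induction k arbitrary: f)
  case 0 then show ?case by (auto intro: bounded_linear.continuous_on[OF assms])
next
  case (Suc k)
  show ?case
    by (rule Ck_on_SucI[OF Suc.prems(1)])
       (auto intro!: bounded_linear.has_derivative[OF assms] Ck_on_SucD[OF Suc.prems(2)] Suc.IH Suc.prems)
qed

text \<open>The derivative of the inverse again contains the inverse, which the induction hypothesis
  controls one order lower.\<close>

lemma Ck_on_inverse:
  fixes f :: "complex \<Rightarrow> complex"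
  shows "open S \<Longrightarrow> Ck_on k S f \<Longrightarrow> (\<And>x. x \<in> S \<Longrightarrow> f x \<noteq> 0) \<Longrightarrow> Ck_on k S (\<lambda>x. inverse (f x))"
proof (induction k arbitrary: f)
  case 0 then show ?case by (auto intro: continuous_on_inverse)
next
  case (Suc k)
  have inv: "Ck_on k S (\<lambda>x. inverse (f x))"
    by (rule Suc.IH[OF Suc.prems(1) Ck_on_Suc_imp[OF Suc.prems(2)] Suc.prems(3)])
  show ?case
  proof (rule Ck_on_SucI[OF Suc.prems(1)])
    fix x assume "x \<in> S"
    then show "((\<lambda>x. inverse (f x)) has_derivative
        (\<lambda>v. - (inverse (f x) * frechet_derivative f (at x) v * inverse (f x)))) (at x)"
      using Deriv.has_derivative_inverse[OF Suc.prems(3) Ck_on_SucD(1)[OF Suc.prems(2)]] by blast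
  next
    fix v
    show "Ck_on k S (\<lambda>x. - (inverse (f x) * frechet_derivative f (at x) v * inverse (f x)))"
      by (intro Ck_on_linear[OF bounded_linear_minus[OF bounded_linear_ident]]
          Ck_on_bilinear[OF bounded_bilinear_mult] inv Suc.prems(1) Ck_on_SucD(2)[OF Suc.prems(2)])
  qed
qed

lemma Ck_on_sum: "open S \<Longrightarrow> (\<And>i. i \<in> I \<Longrightarrow> Ck_on k S (f i)) \<Longrightarrow> Ck_on k S (\<lambda>x. \<Sum>i\<in>I. f i x)"
proof (cases "finite I")
  case True
  assume "open S" "\<And>i. i \<in> I \<Longrightarrow> Ck_on k S (f i)"
  with True show ?thesis by (induction I) (auto intro: Ck_on_const Ck_on_add)
qed (auto intro: Ck_on_const)

lemma Ck_on_prod: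
  fixes f :: "'i \<Rightarrow> complex \<Rightarrow> complex"
  shows "open S \<Longrightarrow> (\<And>i. i \<in> I \<Longrightarrow> Ck_on k S (f i)) \<Longrightarrow> Ck_on k S (\<lambda>x. \<Prod>i\<in>I. f i x)"
proof (cases "finite I")
  case True
  assume "open S" "\<And>i. i \<in> I \<Longrightarrow> Ck_on k S (f i)"
  with True show ?thesis by (induction I) (auto intro: Ck_on_const Ck_on_bilinear[OF bounded_bilinear_mult])
qed (auto intro: Ck_on_const)

lemma Ck_on_vec:
  fixes f :: "complex \<Rightarrow> 'b::euclidean_space ^ 'n"
  assumes "open S" "\<And>i. Ck_on k S (\<lambda>x. f x $ i)"
  shows "Ck_on k S f"
proof -
  have "bounded_linear (axis i :: 'b \<Rightarrow> 'b ^ 'n)" for i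
    by (rule bounded_linear_finite_dim) (auto intro!: linearI simp: axis_def vec_eq_iff)
  then have "Ck_on k S (\<lambda>x. axis i (f x $ i))" for i
    by (rule Ck_on_linear) (rule assms)+
  then have "Ck_on k S (\<lambda>x. \<Sum>i\<in>UNIV. axis i (f x $ i))"
    by (rule Ck_on_sum[OF assms(1)])
  moreover have "(\<Sum>i\<in>UNIV. axis i (f x $ i)) = f x" for x
    by (simp add: vec_eq_iff axis_def)
  ultimately show ?thesis by simp
qed

lemma Ck_on_nth: "open S \<Longrightarrow> Ck_on k S f \<Longrightarrow> Ck_on k S (\<lambda>x. f x $ i)"
  by (rule Ck_on_linear[OF bounded_linear_vec_nth])

lemma Ck_on_det:
  fixes f :: "complex \<Rightarrow> complex ^ 'n ^ 'n"
  assumes "open S" "Ck_on k S f"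
  shows "Ck_on k S (\<lambda>x. det (f x))"
  unfolding det_def
  by (intro Ck_on_sum Ck_on_bilinear[OF bounded_bilinear_mult] Ck_on_prod Ck_on_const Ck_on_nth assms)

text \<open>Cramer's rule writes the entries of the inverse as quotients of determinants, which
  reduces its smoothness to that of polynomials and of scalar inversion.\<close>

lemma matrix_inv_cramer:
  fixes A :: "'k::finite cmat"
  assumes "det A \<noteq> 0"
  shows "matrix_inv A $ i $ j = det (\<chi> r s. if s = i then (if r = j then 1 else 0) else A $ r $ s) / det A"
proof -
  from assms obtain B where "A ** B = mat 1"
    by (meson invertible_det_nz invertible_def)
  then have B: "A ** matrix_inv A = mat 1" by (simp add: matrix_inv_unique)
  have "A *v (matrix_inv A *v axis j 1) = axis j 1"
    by (simp add: matrix_vector_mul_assoc B)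
  then have "(matrix_inv A *v axis j 1) $ i = det (\<chi> r s. if s = i then axis j 1 $ r else A $ r $ s) / det A"
    by (subst (asm) cramer[OF assms]) simp
  moreover have "(matrix_inv A *v axis j 1) $ i = matrix_inv A $ i $ j"
    by (simp add: matrix_vector_mult_def axis_def if_distrib[where f = "\<lambda>x. _ * x"] cong: if_cong)
  ultimately show ?thesis by (simp add: axis_def eq_commute[of j] cong: if_cong)
qed

lemma Ck_on_matrix_inv:
  fixes f :: "complex \<Rightarrow> 'k::finite cmat"
  assumes S: "open S" and f: "Ck_on k S f" and "\<And>x. x \<in> S \<Longrightarrow> det (f x) \<noteq> 0"
  shows "Ck_on k S (\<lambda>x. matrix_inv (f x))"
proof (intro Ck_on_vec S)
  fix i j
  have "Ck_on k S (\<lambda>x. (\<chi> r s. if s = i then (if r = j then 1 else 0) else f x $ r $ s))"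
  proof (intro Ck_on_vec S)
    fix r s
    show "Ck_on k S (\<lambda>x. (\<chi> r s. if s = i then (if r = j then 1 else 0) else f x $ r $ s) $ r $ s)"
      by (cases "s = i") (simp_all add: Ck_on_const Ck_on_nth S f)
  qed
  then have "Ck_on k S (\<lambda>x. det (\<chi> r s. if s = i then (if r = j then 1 else 0) else f x $ r $ s) * inverse (det (f x)))"
    by (intro Ck_on_bilinear[OF bounded_bilinear_mult] Ck_on_det Ck_on_inverse S f assms)
  then show "Ck_on k S (\<lambda>x. matrix_inv (f x) $ i $ j)"
    by (rule Ck_on_cong[OF S, rotated]) (simp add: matrix_inv_cramer assms(3) divide_inverse)
qed

section \<open>Smooth maps and derivatives in charts\<close>

lemma chart_facts:
  assumes "conformal_atlas \<A>" "c \<in> \<A>"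
  shows chart_open: "open (fst c)" and chart_subset: "fst c \<subseteq> points \<A>"
    and chart_inv_chart: "p \<in> fst c \<Longrightarrow> chart_inv c (snd c p) = p"
    and chart_image_open: "open W \<Longrightarrow> open (snd c ` (fst c \<inter> W))"
proof -
  have h: "open (fst c)" "open (snd c ` fst c)" "homeomorphism (fst c) (snd c ` fst c) (snd c) (chart_inv c)"
    using assms by (auto simp: conformal_atlas_def)
  then show "open (fst c)" by simp
  show "fst c \<subseteq> points \<A>" using assms by (auto simp: points_def)
  show "p \<in> fst c \<Longrightarrow> chart_inv c (snd c p) = p" using h(3) by (simp add: homeomorphism_apply1)
  assume "open W"
  then have "openin (top_of_set (fst c)) (fst c \<inter> W)" by auto
  then have "openin (top_of_set (snd c ` fst c)) (snd c ` (fst c \<inter> W))"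
    using homeomorphism_imp_open_map[OF h(3)] by blast
  then show "open (snd c ` (fst c \<inter> W))" using h(2) by (simp add: openin_open_eq)
qed

lemma open_points: "conformal_atlas \<A> \<Longrightarrow> open (points \<A>)"
  unfolding points_def by (intro open_UN) (auto simp: chart_open)

lemma smooth_bilinear:
  assumes "conformal_atlas \<A>" "open W" "bounded_bilinear pr" "smooth_map_on \<A> W f" "smooth_map_on \<A> W g"
  shows "smooth_map_on \<A> W (\<lambda>p. pr (f p) (g p))"
  using assms Ck_on_bilinear[OF assms(3) chart_image_open[OF assms(1) _ assms(2)]]
  by (auto simp: smooth_map_on_def o_def)

lemma smooth_linear:
  assumes "conformal_atlas \<A>" "open W" "bounded_linear h" "smooth_map_on \<A> W f"
  shows "smooth_map_on \<A> W (\<lambda>p. h (f p))"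
  using assms Ck_on_linear[OF assms(3) chart_image_open[OF assms(1) _ assms(2)]]
  by (auto simp: smooth_map_on_def o_def)

lemma smooth_const: "conformal_atlas \<A> \<Longrightarrow> open W \<Longrightarrow> smooth_map_on \<A> W (\<lambda>p. c)"
  by (auto simp: smooth_map_on_def o_def intro!: Ck_on_const chart_image_open)

lemma smooth_add:
  assumes "conformal_atlas \<A>" "open W" "smooth_map_on \<A> W f" "smooth_map_on \<A> W g"
  shows "smooth_map_on \<A> W (\<lambda>p. f p + g p)"
  using assms unfolding smooth_map_on_def o_def
  by (intro ballI allI Ck_on_add chart_image_open[OF assms(1)]) auto

lemma smooth_minus:
  "conformal_atlas \<A> \<Longrightarrow> open W \<Longrightarrow> smooth_map_on \<A> W f \<Longrightarrow> smooth_map_on \<A> W (\<lambda>p. - f p)"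
  by (rule smooth_linear[OF _ _ bounded_linear_minus[OF bounded_linear_ident]])

lemma smooth_diff:
  "conformal_atlas \<A> \<Longrightarrow> open W \<Longrightarrow> smooth_map_on \<A> W f \<Longrightarrow> smooth_map_on \<A> W g \<Longrightarrow>
    smooth_map_on \<A> W (\<lambda>p. f p - g p)"
  using smooth_add[of \<A> W f "\<lambda>p. - g p"] smooth_minus[of \<A> W g] by simp

lemma smooth_inverse:
  fixes f :: "_ \<Rightarrow> complex"
  assumes "conformal_atlas \<A>" "open W" "smooth_map_on \<A> W f" "\<And>p. p \<in> W \<Longrightarrow> f p \<noteq> 0"
  shows "smooth_map_on \<A> W (\<lambda>p. inverse (f p))"
  unfolding smooth_map_on_def o_def
proof (intro ballI allI)
  fix c k assume c: "c \<in> \<A>"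
  show "Ck_on k (snd c ` (fst c \<inter> W)) (\<lambda>x. inverse (f (chart_inv c x)))"
    using c assms(3) unfolding smooth_map_on_def o_def
    by (intro Ck_on_inverse chart_image_open[OF assms(1) c assms(2)])
       (use assms(4) chart_inv_chart[OF assms(1) c] in fastforce)+
qed

lemma smooth_matrix_inv:
  fixes f :: "_ \<Rightarrow> 'k::finite cmat"
  assumes "conformal_atlas \<A>" "open W" "smooth_map_on \<A> W f" "\<And>p. p \<in> W \<Longrightarrow> det (f p) \<noteq> 0"
  shows "smooth_map_on \<A> W (\<lambda>p. matrix_inv (f p))"
  unfolding smooth_map_on_def o_def
proof (intro ballI allI)
  fix c k assume c: "c \<in> \<A>"
  show "Ck_on k (snd c ` (fst c \<inter> W)) (\<lambda>x. matrix_inv (f (chart_inv c x)))"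
    using c assms(3) unfolding smooth_map_on_def o_def
    by (intro Ck_on_matrix_inv chart_image_open[OF assms(1) c assms(2)])
       (use assms(4) chart_inv_chart[OF assms(1) c] in fastforce)+
qed

lemma smooth_vec:
  fixes f :: "_ \<Rightarrow> 'b::euclidean_space ^ 'n"
  assumes "conformal_atlas \<A>" "open W" "\<And>i. smooth_map_on \<A> W (\<lambda>p. f p $ i)"
  shows "smooth_map_on \<A> W f"
  using assms unfolding smooth_map_on_def o_def
  by (intro ballI allI Ck_on_vec chart_image_open[OF assms(1)]) auto

lemma smooth_subset: "smooth_map_on \<A> T f \<Longrightarrow> S \<subseteq> T \<Longrightarrow> smooth_map_on \<A> S f"
  unfolding smooth_map_on_def by (meson Ck_on_subset image_mono Int_mono order_refl)

lemma smooth_cong: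
  assumes "conformal_atlas \<A>" "open W" "\<And>p. p \<in> W \<Longrightarrow> f p = g p" "smooth_map_on \<A> W f"
  shows "smooth_map_on \<A> W g"
  unfolding smooth_map_on_def
proof (intro ballI allI)
  fix c k assume c: "c \<in> \<A>"
  show "Ck_on k (snd c ` (fst c \<inter> W)) (g \<circ> chart_inv c)"
    by (rule Ck_on_cong[OF chart_image_open[OF assms(1) c assms(2)], of "f \<circ> chart_inv c"])
       (use assms(3,4) c chart_inv_chart[OF assms(1) c] in \<open>fastforce simp: smooth_map_on_def\<close>)+
qed

lemma smooth_local:
  assumes "conformal_atlas \<A>" "\<And>p. p \<in> W \<Longrightarrow> \<exists>T. open T \<and> p \<in> T \<and> smooth_map_on \<A> (W \<inter> T) f"
  shows "smooth_map_on \<A> W f"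
  unfolding smooth_map_on_def
proof (intro ballI allI)
  fix c k assume c: "c \<in> \<A>"
  show "Ck_on k (snd c ` (fst c \<inter> W)) (f \<circ> chart_inv c)"
  proof (rule Ck_on_local)
    fix x assume "x \<in> snd c ` (fst c \<inter> W)"
    then obtain p where p: "p \<in> fst c" "p \<in> W" "x = snd c p" by auto
    then obtain T where T: "open T" "p \<in> T" "smooth_map_on \<A> (W \<inter> T) f" using assms(2) by blast
    \<comment> \<open>Injectivity of the chart: the image of an intersection is the intersection of
      the images.\<close>
    have "snd c ` (fst c \<inter> W) \<inter> snd c ` (fst c \<inter> T) \<subseteq> snd c ` (fst c \<inter> (W \<inter> T))"
      using chart_inv_chart[OF assms(1) c] by (smt (verit) Int_iff imageE image_eqI subsetI)
    then have "Ck_on k (snd c ` (fst c \<inter> W) \<inter> snd c ` (fst c \<inter> T)) (f \<circ> chart_inv c)"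
      using T(3) c unfolding smooth_map_on_def by (meson Ck_on_subset)
    then show "\<exists>T. open T \<and> x \<in> T \<and> Ck_on k (snd c ` (fst c \<inter> W) \<inter> T) (f \<circ> chart_inv c)"
      using chart_image_open[OF assms(1) c T(1)] p T(2) by blast
  qed
qed

text \<open>A relation with an explicit derivative: the rules below assemble values for composite
  maps, and uniqueness then compares them.\<close>

definition chart_deriv :: "'m chart \<Rightarrow> 'm \<Rightarrow> ('m \<Rightarrow> 'v::real_normed_vector) \<Rightarrow> (complex \<Rightarrow> 'v) \<Rightarrow> bool" where
  "chart_deriv c p f f' \<longleftrightarrow> ((f \<circ> chart_inv c) has_derivative f') (at (snd c p))"

lemma chart_deriv_exists:
  assumes "smooth_map_on \<A> W f" "c \<in> \<A>" "p \<in> fst c" "p \<in> W"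
  obtains f' where "chart_deriv c p f f'"
proof -
  have "Ck_on (Suc 0) (snd c ` (fst c \<inter> W)) (f \<circ> chart_inv c)"
    using assms by (auto simp: smooth_map_on_def simp del: Ck_on.simps)
  then show thesis using that assms Ck_on_SucD(1) unfolding chart_deriv_def by blast
qed

lemma chart_deriv_cong:
  assumes "conformal_atlas \<A>" "c \<in> \<A>" "open W" "p \<in> fst c" "p \<in> W"
    and "\<And>x. x \<in> fst c \<Longrightarrow> x \<in> W \<Longrightarrow> f x = g x" "chart_deriv c p f f'"
  shows "chart_deriv c p g f'"
  unfolding chart_deriv_def
proof (rule has_derivative_transform_within_open)
  show "((f \<circ> chart_inv c) has_derivative f') (at (snd c p))" using assms by (simp add: chart_deriv_def)
  show "open (snd c ` (fst c \<inter> W))" using assms by (intro chart_image_open)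
  show "snd c p \<in> snd c ` (fst c \<inter> W)" using assms by simp
qed (use assms(6) chart_inv_chart[OF assms(1,2)] in fastforce)

lemma chart_deriv_unique: "chart_deriv c p f f' \<Longrightarrow> chart_deriv c p f f'' \<Longrightarrow> f' = f''"
  unfolding chart_deriv_def by (rule has_derivative_unique)

lemma chart_deriv_dtriv: "chart_deriv c p f f' \<Longrightarrow> dtriv f c p v = f' v"
  unfolding chart_deriv_def dtriv_def by (metis frechet_derivative_at)

lemma chart_deriv_const: "chart_deriv c p (\<lambda>x. a) (\<lambda>v. 0)"
  by (simp add: chart_deriv_def o_def)

lemma chart_deriv_add:
  "chart_deriv c p f f' \<Longrightarrow> chart_deriv c p g g' \<Longrightarrow> chart_deriv c p (\<lambda>x. f x + g x) (\<lambda>v. f' v + g' v)"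
  by (auto simp: chart_deriv_def o_def intro: has_derivative_add)

lemma chart_deriv_diff:
  "chart_deriv c p f f' \<Longrightarrow> chart_deriv c p g g' \<Longrightarrow> chart_deriv c p (\<lambda>x. f x - g x) (\<lambda>v. f' v - g' v)"
  by (auto simp: chart_deriv_def o_def intro: has_derivative_diff)

lemma chart_deriv_linear:
  "bounded_linear h \<Longrightarrow> chart_deriv c p f f' \<Longrightarrow> chart_deriv c p (\<lambda>x. h (f x)) (\<lambda>v. h (f' v))"
  by (auto simp: chart_deriv_def o_def intro: bounded_linear.has_derivative)

lemma chart_deriv_mscale:
  "chart_deriv c p f f' \<Longrightarrow> chart_deriv c p (\<lambda>x. a *m f x) (\<lambda>v. a *m f' v)"
  by (rule chart_deriv_linear[OF bounded_linear_mscale])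

lemma chart_deriv_adj:
  "chart_deriv c p f f' \<Longrightarrow> chart_deriv c p (\<lambda>x. adj (f x)) (\<lambda>v. adj (f' v))"
  by (rule chart_deriv_linear[OF bounded_linear_adj])

lemma chart_deriv_bilinear:
  assumes "conformal_atlas \<A>" "c \<in> \<A>" "p \<in> fst c" "bounded_bilinear pr"
    and "chart_deriv c p f f'" "chart_deriv c p g g'"
  shows "chart_deriv c p (\<lambda>x. pr (f x) (g x)) (\<lambda>v. pr (f' v) (g p) + pr (f p) (g' v))"
  using bounded_bilinear.FDERIV[OF assms(4) assms(5,6)[unfolded chart_deriv_def]]
  by (simp add: chart_deriv_def o_def chart_inv_chart[OF assms(1,2,3)] add.commute)

lemma chart_deriv_real_linear: "chart_deriv c p f f' \<Longrightarrow> linear f'"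
  unfolding chart_deriv_def by (meson has_derivative_bounded_linear bounded_linear.linear)

section \<open>Orthogonal projections and null lines\<close>

text \<open>Nondegeneracy of \<open>W\<close> in matrix form: such an \<open>M\<close> splits the
  space into \<open>W\<close> and its orthogonal complement.\<close>

definition ortho_proj :: "'k::finite cvec set \<Rightarrow> 'k cmat \<Rightarrow> bool" where
  "ortho_proj W M \<longleftrightarrow> W = {w. M *v w = w} \<and> M ** M = M \<and> adj M = M"

text \<open>Two candidates for the value of \<open>proj\<close> at \<open>w\<close> differ by an
  element of \<open>W1\<close> and of \<open>W2\<close>, hence agree.\<close>

lemma proj_eqI:
  assumes "vec.subspace W1" "vec.subspace W2" "W1 \<inter> W2 = {0}"
    and M: "\<And>w. M *v w \<in> W1" "\<And>w. w - M *v w \<in> W2"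
  shows "proj W1 W2 = M"
proof -
  have "(THE u. u \<in> W1 \<and> w - u \<in> W2) = M *v w" for w
  proof (rule the_equality)
    fix u assume u: "u \<in> W1 \<and> w - u \<in> W2"
    have "u - M *v w \<in> W1" using assms(1) u M(1) by (simp add: vec.subspace_diff)
    moreover have "(w - M *v w) - (w - u) \<in> W2" using assms(2) u M(2) vec.subspace_diff by blast
    ultimately have "u - M *v w \<in> W1 \<inter> W2" by simp
    then show "u = M *v w" using assms(3) by simp
  qed (use M in auto)
  then show ?thesis by (simp add: proj_def)
qed

lemma subspace_orth: "vec.subspace (orth W)"
  by (auto simp: vec.subspace_def orth_def mink_simps)

lemma ortho_proj_orth: assumes "ortho_proj W M" shows "orth W = {w. M *v w = 0}"
proof (intro set_eqI iffI; clarsimp)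
  fix w assume w: "w \<in> orth W"
  have "mink v (M *v w) = 0" for v
  proof -
    have "M *v v \<in> W" using assms by (simp add: ortho_proj_def matrix_vector_mul_assoc)
    then have "mink (M *v v) w = 0" using w by (simp add: orth_def)
    then show ?thesis using assms by (simp add: mink_adj ortho_proj_def)
  qed
  then show "M *v w = 0" by (rule mink_all_zero)
next
  fix w assume w: "M *v w = 0"
  have "mink u w = 0" if "u \<in> W" for u
  proof -
    have "mink u w = mink (M *v u) w" using that assms by (simp add: ortho_proj_def)
    also have "\<dots> = mink u (M *v w)" using assms by (simp add: mink_adj ortho_proj_def)
    finally show ?thesis using w by simp
  qed
  then show "w \<in> orth W" by (simp add: orth_def)
qed

lemma ortho_proj_subspace: "ortho_proj W M \<Longrightarrow> vec.subspace W"
  by (auto simp: ortho_proj_def vec.subspace_def mat_vec_ring)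

lemma ortho_proj_proj:
  assumes "ortho_proj W M"
  shows "proj W (orth W) = M" "proj (orth W) W = mat 1 - M" "reflection W = 2 *m M - mat 1"
proof -
  have M: "M *v (M *v w) = M *v w" for w using assms by (simp add: ortho_proj_def matrix_vector_mul_assoc)
  have int: "W \<inter> orth W = {0}" "orth W \<inter> W = {0}"
    unfolding ortho_proj_orth[OF assms] using assms by (auto simp: ortho_proj_def)
  show *: "proj W (orth W) = M"
    by (rule proj_eqI[OF ortho_proj_subspace[OF assms] subspace_orth int(1)])
       (use assms M in \<open>auto simp: ortho_proj_orth ortho_proj_def mat_vec_ring\<close>)
  show **: "proj (orth W) W = mat 1 - M"
    by (rule proj_eqI[OF subspace_orth ortho_proj_subspace[OF assms] int(2)])
       (use M assms in \<open>auto simp: ortho_proj_orth mat_vec_ring ortho_proj_def\<close>)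
  show "reflection W = 2 *m M - mat 1"
    unfolding reflection_def * ** by (simp add: vec_eq_iff)
qed

lemma ortho_proj_map:
  fixes A :: "'k::finite cmat"
  assumes "A \<in> orthogonal_maps" "ortho_proj W M"
  shows "ortho_proj ((*v) A ` W) (A ** M ** adj A)"
  unfolding ortho_proj_def
proof (intro conjI)
  show "(A ** M ** adj A) ** (A ** M ** adj A) = A ** M ** adj A"
  proof -
    have "M ** (M ** X) = M ** X" for X :: "'k cmat" using assms(2) by (simp add: ortho_proj_def matrix_mul_assoc)
    then show ?thesis using assms by (simp add: mat_ring orthogonal_cancel)
  qed
  show "adj (A ** M ** adj A) = A ** M ** adj A" using assms by (simp add: adj_simps ortho_proj_def mat_ring)
  show "(*v) A ` W = {w. (A ** M ** adj A) *v w = w}"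
  proof (intro set_eqI iffI; clarsimp)
    fix w assume "w \<in> W" then show "(A ** M ** adj A) *v (A *v w) = A *v w"
      using assms by (simp add: mat_vec_ring orthogonal_cancel ortho_proj_def)
  next
    fix w assume w: "(A ** M ** adj A) *v w = w"
    have "adj A *v ((A ** M ** adj A) *v w) = M *v (adj A *v w)"
      by (simp add: mat_vec_ring orthogonal_cancel[OF assms(1)])
    then have "adj A *v w \<in> W" using assms(2) w by (simp add: ortho_proj_def)
    then have "A *v (adj A *v w) \<in> (*v) A ` W" by blast
    then show "w \<in> (*v) A ` W" by (simp add: orthogonal_cancel[OF assms(1)])
  qed
qed

lemma reflection_map:
  assumes "A \<in> orthogonal_maps" "ortho_proj W M"
  shows "reflection ((*v) A ` W) = A ** reflection W ** adj A"
  using ortho_proj_proj(3)[OF assms(2)] ortho_proj_proj(3)[OF ortho_proj_map[OF assms]]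
  by (simp add: mat_ring mscale_ring orthogonal_cancel[OF assms(1)])

text \<open>The dressing computations see the bundle only through its reflection. Self-adjointness
  makes the reflection an orthogonal map.\<close>

definition involution :: "'k::finite cmat \<Rightarrow> bool" where
  "involution R \<longleftrightarrow> R ** R = mat 1 \<and> adj R = R"

lemma involution_cancel:
  assumes "involution R"
  shows "R ** R = mat 1" "adj R = R" "R ** (R ** X) = X" "R *v (R *v w) = w" "R \<in> orthogonal_maps"
  using assms by (auto simp: involution_def matrix_mul_assoc matrix_vector_mul_assoc orthogonal_maps_adj)

lemma involution_reflection: assumes "ortho_proj W M" shows "involution (reflection W)"
proof -
  have "M ** M = M" "adj M = M" using assms by (auto simp: ortho_proj_def)
  then show ?thesis
    unfolding involution_def ortho_proj_proj(3)[OF assms]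
    by (simp add: mat_ring mscale_ring adj_simps) (simp add: vec_eq_iff)
qed

lemma reflection_in: "ortho_proj W M \<Longrightarrow> w \<in> W \<Longrightarrow> reflection W *v w = w"
proof -
  assume *: "ortho_proj W M" "w \<in> W"
  have "2 *s w = w + w" by (simp add: vec_eq_iff)
  then show "reflection W *v w = w"
    using * ortho_proj_proj(3)[of W M] by (auto simp: ortho_proj_def mat_vec_ring)
qed

lemma reflection_orth: "ortho_proj W M \<Longrightarrow> w \<in> orth W \<Longrightarrow> reflection W *v w = - w"
  using ortho_proj_proj(3)[of W M] by (auto simp: ortho_proj_orth mat_vec_ring)

section \<open>Rank one maps, null lines and dressing factors\<close>

definition outer :: "'k::finite cvec \<Rightarrow> 'k cvec \<Rightarrow> 'k cmat" where
  "outer s m = (\<chi> i j. s $ i * (mink_mat *v m) $ j)"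

lemma outer_vec: "outer s m *v w = mink w m *s s"
  by (simp add: vec_eq_iff outer_def matrix_vector_mult_def[of "vec_lambda _"] mink_tdot tdot_def
      sum_distrib_left sum_distrib_right mult_ac)

lemma adj_outer: "adj (outer s m) = outer m s"
  by (rule adj_eqI) (simp add: outer_vec mink_simps mink_commute mult.commute)

lemma outer_conj: "A ** outer s m ** adj A = outer (A *v s) (A *v m)"
  by (rule mat_eqI) (simp add: mat_vec_ring outer_vec mink_adj)

text \<open>The projection onto the line of \<open>s\<close> along the hyperplane orthogonal to
  \<open>m\<close>. Rescaling \<open>s\<close> or \<open>m\<close> by a non-zero factor does not
  change it, so it depends on the two lines alone.\<close>

definition line_proj :: "'k::finite cvec \<Rightarrow> 'k cvec \<Rightarrow> 'k cmat" where
  "line_proj s m = inverse (mink s m) *m outer s m"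

lemma line_proj_vec: "line_proj s m *v w = (mink w m / mink s m) *s s"
  by (simp add: line_proj_def mat_vec_ring outer_vec divide_inverse mult.commute)

lemma adj_line_proj: "adj (line_proj s m) = line_proj m s"
  by (simp add: line_proj_def adj_simps adj_outer mink_commute)

lemma line_proj_conj:
  "A \<in> orthogonal_maps \<Longrightarrow> A ** line_proj s m ** adj A = line_proj (A *v s) (A *v m)"
  by (simp add: line_proj_def mscale_ring outer_conj[symmetric] orthogonal_maps_def)

text \<open>What the projections onto two dual null lines satisfy. The mixed products vanish because
  each line is null.\<close>

definition null_pair :: "'k::finite cmat \<Rightarrow> 'k cmat \<Rightarrow> bool" where
  "null_pair P Q \<longleftrightarrow> P ** P = P \<and> Q ** Q = Q \<and> P ** Q = 0 \<and> Q ** P = 0 \<and> adj P = Q \<and> adj Q = P"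

lemma null_pair_line_proj:
  assumes "mink s s = 0" "mink m m = 0" "mink s m \<noteq> 0"
  shows "null_pair (line_proj s m) (line_proj m s)"
  unfolding null_pair_def using assms
  by (auto intro!: mat_eqI simp: mat_vec_ring line_proj_vec adj_line_proj mink_simps mink_commute[of m s])

lemma skew_null: assumes "adj X = - X" shows "mink w (X *v w) = 0"
proof -
  have "mink w (X *v w) = mink (adj X *v w) w" by (rule mink_adj')
  also have "\<dots> = - mink w (X *v w)" using assms by (simp add: minus_mat_vec mink_simps mink_commute)
  finally show ?thesis by simp
qed

text \<open>Between lines this block is the single number \<open>mink (X *v m) m\<close>, which is 0
  for skew \<open>X\<close>. This excludes double poles: conjugation by a dressing factor would
  scale the block by the square of the eigenvalue.\<close>

lemma line_proj_skew:
  assumes "adj X = - X" shows "line_proj s m ** (X ** line_proj m s) = 0"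
  by (rule mat_eqI)
     (simp add: mat_vec_ring line_proj_vec mink_simps skew_null[OF assms] mink_commute[of "X *v m"])

text \<open>Eigenvalue \<open>f\<close> on the first line, its inverse on the second, 1 on the
  complement. Taking the adjoint exchanges the lines, hence inverts the map.\<close>

definition null_fac :: "complex \<Rightarrow> 'k::finite cmat \<Rightarrow> 'k cmat \<Rightarrow> 'k cmat" where
  "null_fac f P Q = f *m P + (mat 1 - P - Q) + inverse f *m Q"

lemma null_fac_orthogonal:
  assumes "null_pair P Q" "f \<noteq> 0" shows "null_fac f P Q \<in> orthogonal_maps"
proof -
  note np = assms(1)[unfolded null_pair_def]
  have "adj (null_fac f P Q) ** null_fac f P Q = mat 1"
    using np assms(2) by (simp add: null_fac_def adj_simps mat_ring mscale_ring)
  then show ?thesis by (simp add: orthogonal_maps_adj)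
qed

text \<open>The eigenvalue on \<open>L\<close> of $q_{a,L}$ for \<open>e = 1\<close> and of $p_{a,L}$ for \<open>e = -1\<close>.\<close>

fun simple_pole :: "complex \<Rightarrow> complex \<Rightarrow> csphere \<Rightarrow> complex" where
  "simple_pole e a (Fin x) = e * (x - a) / (x + a)"
| "simple_pole e a Infty = e"

text \<open>Both kinds of dressing factors at once, with a spanning vector \<open>s\<close> of L;
  the values of \<open>e\<close> in use are 1 and -1. Non-zero multiples of \<open>s\<close> give
  the same matrix.\<close>

definition dress :: "'k::finite cmat \<Rightarrow> complex \<Rightarrow> complex \<Rightarrow> 'k cvec \<Rightarrow> csphere \<Rightarrow> 'k cmat" where
  "dress R e a s \<mu> = null_fac (simple_pole e a \<mu>) (line_proj s (R *v s)) (line_proj (R *v s) s)"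

text \<open>At \<open>-a\<close> the eigenvalue on L has its pole, at \<open>a\<close> its zero;
  elsewhere the factor is invertible.\<close>

fun admissible :: "complex \<Rightarrow> csphere \<Rightarrow> bool" where
  "admissible a (Fin x) \<longleftrightarrow> x \<noteq> a \<and> x \<noteq> - a"
| "admissible a Infty \<longleftrightarrow> True"

definition frame_vec :: "'k::finite cmat \<Rightarrow> 'k cvec \<Rightarrow> bool" where
  "frame_vec R s \<longleftrightarrow> mink s s = 0 \<and> mink s (R *v s) \<noteq> 0"

lemma frame_vec_null_pair:
  assumes "involution R" "frame_vec R s"
  shows "null_pair (line_proj s (R *v s)) (line_proj (R *v s) s)"
proof (rule null_pair_line_proj)
  show "mink (R *v s) (R *v s) = 0"
    using assms involution_cancel[OF assms(1)] by (simp add: orthogonal_maps_def frame_vec_def)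
qed (use assms in \<open>auto simp: frame_vec_def\<close>)

lemma simple_pole_nonzero: "admissible a \<mu> \<Longrightarrow> e \<noteq> 0 \<Longrightarrow> simple_pole e a \<mu> \<noteq> 0"
  by (cases \<mu>) (auto simp: add_eq_0_iff2)

lemma dress_orthogonal:
  "involution R \<Longrightarrow> frame_vec R s \<Longrightarrow> e \<noteq> 0 \<Longrightarrow> admissible a \<mu> \<Longrightarrow> dress R e a s \<mu> \<in> orthogonal_maps"
  unfolding dress_def by (intro null_fac_orthogonal frame_vec_null_pair simple_pole_nonzero)

lemma null_fac_conj:
  "A \<in> orthogonal_maps \<Longrightarrow> A ** null_fac f P Q ** adj A = null_fac f (A ** P ** adj A) (A ** Q ** adj A)"
  by (simp add: null_fac_def mat_ring mscale_ring orthogonal_cancel)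

lemma dress_conj:
  assumes "A \<in> orthogonal_maps"
  shows "A ** dress R e a s \<mu> ** adj A = dress (A ** R ** adj A) e a (A *v s) \<mu>"
  by (simp add: dress_def null_fac_conj line_proj_conj mat_vec_ring orthogonal_cancel assms)

text \<open>The reflection exchanges L with its reflected line, which inverts the eigenvalue; so
  does the change from \<open>x\<close> to \<open>-x\<close>, provided \<open>e\<close> is a
  sign.\<close>

lemma dress_reflect:
  assumes "involution R" "e * e = 1"
  shows "R ** dress R e a s (Fin x) ** R = dress R e a s (Fin (- x))"
proof -
  have "simple_pole e a (Fin (- x)) = inverse (simple_pole e a (Fin x))"
  proof -
    have "inverse e = e" using assms(2) by (simp add: inverse_unique)
    moreover have "(- x - a) / (- x + a) = (x + a) / (x - a)"
      by (metis minus_add_distrib minus_diff_eq minus_divide_divide uminus_add_conv_diff add.commute)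
    ultimately show ?thesis by (simp add: divide_inverse mult.assoc inverse_mult_distrib)
  qed
  moreover have "R ** dress R e a s (Fin x) ** adj R = dress (R ** R ** adj R) e a (R *v s) (Fin x)"
    by (rule dress_conj) (simp add: involution_cancel[OF assms(1)])
  ultimately show ?thesis
    using involution_cancel[OF assms(1)]
    by (simp add: dress_def null_fac_def algebra_simps)
qed

text \<open>The eigenvalue is homogeneous of degree 0 in \<open>x\<close> and \<open>a\<close>. This
  is why \<alpha> and \<beta> are divided by the spectral parameter.\<close>

lemma dress_scale:
  assumes "l \<noteq> 0"
  shows "dress R e (a / l) s (Fin x) = dress R e a s (Fin (l * x))"
    "dress R e (a / l) s Infty = dress R e a s Infty"
proof -
  have "e * (x - a / l) / (x + a / l) = e * (l * x - a) / (l * x + a)"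
  proof -
    have "x - a / l = (l * x - a) / l" "x + a / l = (l * x + a) / l"
      using assms by (simp_all add: field_simps)
    then show ?thesis using assms by simp
  qed
  then show "dress R e (a / l) s (Fin x) = dress R e a s (Fin (l * x))"
    by (simp add: dress_def)
qed (simp add: dress_def)

lemma span_single: "vec.span {s} = {c *s s | c. True}" for s :: "'k::finite cvec"
  by (auto simp: vec.span_singleton)

lemma map_span: "(*v) A ` vec.span {s} = vec.span {A *v s}" for A :: "'k::finite cmat"
  unfolding span_single by (auto simp: mult_vec_scale image_iff) (metis mult_vec_scale)

lemma frame_vec_iff:
  assumes "involution R" "s \<noteq> 0"
  shows "(*v) R ` vec.span {s} \<inter> orth (vec.span {s}) = {0} \<longleftrightarrow> mink s (R *v s) \<noteq> 0"
proof
  assume *: "(*v) R ` vec.span {s} \<inter> orth (vec.span {s}) = {0}"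
  have "R *v s \<noteq> 0" using assms involution_cancel(4)[OF assms(1), of s] by force
  moreover have "R *v s \<in> (*v) R ` vec.span {s}" by (simp add: vec.span_base)
  ultimately have "R *v s \<notin> orth (vec.span {s})" using * by blast
  then show "mink s (R *v s) \<noteq> 0" by (auto simp: orth_def span_single mink_simps)
next
  assume *: "mink s (R *v s) \<noteq> 0"
  show "(*v) R ` vec.span {s} \<inter> orth (vec.span {s}) = {0}"
    unfolding map_span using * by (auto simp: span_single orth_def mink_simps)
qed

text \<open>Replaces the projections defined by descriptions with rank one formulas, which can be
  conjugated and differentiated.\<close>

lemma null_line_projections:
  assumes W: "ortho_proj W M" and s: "frame_vec (reflection W) s"
  shows "pi_line W (vec.span {s}) = line_proj s (reflection W *v s)" (is "_ = ?P")
    and "pi_refl W (vec.span {s}) = line_proj (reflection W *v s) s" (is "_ = ?Q")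
    and "pi_perp W (vec.span {s}) = mat 1 - line_proj s (reflection W *v s) - line_proj (reflection W *v s) s"
proof -
  let ?m = "reflection W *v s"
  have inv: "involution (reflection W)" using W by (rule involution_reflection)
  have n: "mink s s = 0" "mink ?m ?m = 0" "mink s ?m \<noteq> 0" "mink ?m s \<noteq> 0"
    using s involution_cancel(5)[OF inv] by (auto simp: frame_vec_def orthogonal_maps_def mink_commute)
  have refl: "reflected W (vec.span {s}) = vec.span {?m}" by (simp add: reflected_def map_span)
  define U where "U = set_sum (vec.span {s}) (vec.span {?m})"
  have U: "U = {a *s s + b *s ?m | a b. True}" by (auto simp: U_def set_sum_def span_single)
  have orthU: "orth U = {x. mink s x = 0 \<and> mink ?m x = 0}"
  proof (intro set_eqI iffI)
    fix x assume x: "x \<in> orth U"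
    have "1 *s s + 0 *s ?m \<in> U" "0 *s s + 1 *s ?m \<in> U" unfolding U by blast+
    then have "mink (1 *s s + 0 *s ?m) x = 0" "mink (0 *s s + 1 *s ?m) x = 0"
      using x unfolding orth_def by blast+
    then show "x \<in> {x. mink s x = 0 \<and> mink ?m x = 0}" by (simp add: mink_simps)
  qed (auto simp: U orth_def mink_simps)
  \<comment> \<open>The prescribed complement of L is a hyperplane, the orthogonal space of the
    reflected line; this matches the kernel of \<open>line_proj\<close>.\<close>
  have S1: "set_sum (vec.span {?m}) (orth U) = {x. mink ?m x = 0}"
  proof (intro set_eqI iffI)
    fix x assume "x \<in> {x. mink ?m x = 0}"
    then have "x = (mink s x / mink s ?m) *s ?m + (x - (mink s x / mink s ?m) *s ?m)"
      "x - (mink s x / mink s ?m) *s ?m \<in> orth U" using n by (auto simp: orthU mink_simps)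
    then show "x \<in> set_sum (vec.span {?m}) (orth U)" unfolding set_sum_def span_single by blast
  qed (use n in \<open>auto simp: set_sum_def orthU span_single mink_simps\<close>)
  have S2: "set_sum (vec.span {s}) (orth U) = {x. mink s x = 0}"
  proof (intro set_eqI iffI)
    fix x assume "x \<in> {x. mink s x = 0}"
    then have "x = (mink ?m x / mink ?m s) *s s + (x - (mink ?m x / mink ?m s) *s s)"
      "x - (mink ?m x / mink ?m s) *s s \<in> orth U" using n by (auto simp: orthU mink_simps)
    then show "x \<in> set_sum (vec.span {s}) (orth U)" unfolding set_sum_def span_single by blast
  qed (use n in \<open>auto simp: set_sum_def orthU span_single mink_simps\<close>)
  have sub: "vec.subspace {x. mink ?m x = 0}" "vec.subspace {x. mink s x = 0}"
    "vec.subspace {x. mink s x = 0 \<and> mink ?m x = 0}" "vec.subspace U"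
    unfolding U by (auto simp: vec.subspace_def mink_simps)
       (metis (no_types, opaque_lifting) vector_smult_lzero add_0,
        metis (no_types, opaque_lifting) add.assoc add.left_commute vector_sadd_rdistrib,
        metis (no_types, opaque_lifting) vector_add_ldistrib vector_smult_assoc)
  show "pi_line W (vec.span {s}) = ?P"
    unfolding pi_line_def refl U_def[symmetric] S1
    by (rule proj_eqI[OF vec.subspace_span sub(1)])
       (use n in \<open>auto simp: span_single line_proj_vec mink_simps mink_commute\<close>)
  show "pi_refl W (vec.span {s}) = ?Q"
    unfolding pi_refl_def refl U_def[symmetric] S2
    by (rule proj_eqI[OF vec.subspace_span sub(2)])
       (use n in \<open>auto simp: span_single line_proj_vec mink_simps mink_commute\<close>)
  show "pi_perp W (vec.span {s}) = mat 1 - ?P - ?Q"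
    unfolding pi_perp_def refl U_def[symmetric] orthU
  proof (rule proj_eqI[OF sub(3) sub(4)])
    show "{x. mink s x = 0 \<and> mink ?m x = 0} \<inter> U = {0}"
      using n by (auto simp: U mink_simps intro!: exI[of _ "0::complex"])
    fix w
    show "(mat 1 - ?P - ?Q) *v w \<in> {x. mink s x = 0 \<and> mink ?m x = 0}"
      using n by (simp add: mat_vec_ring line_proj_vec mink_simps mink_commute)
    have "w - (mat 1 - ?P - ?Q) *v w = (mink w ?m / mink s ?m) *s s + (mink w s / mink ?m s) *s ?m"
      by (simp add: mat_vec_ring line_proj_vec)
    then show "w - (mat 1 - ?P - ?Q) *v w \<in> U" unfolding U by blast
  qed
qed

lemma factor_dress:
  assumes W: "ortho_proj W M" and s: "frame_vec (reflection W) s"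
  shows "pfactor W a (vec.span {s}) \<mu> = dress (reflection W) (-1) a s \<mu>"
    and "qfactor W a (vec.span {s}) \<mu> = dress (reflection W) 1 a s \<mu>"
proof -
  note pr = null_line_projections[OF W s]
  have *: "simple_pole (- 1) a (Fin x) = (a - x) / (a + x)"
 for x
    by (simp add: add.commute)
  show "pfactor W a (vec.span {s}) \<mu> = dress (reflection W) (-1) a s \<mu>"
  proof (cases \<mu>)
    case (Fin x)
    then show ?thesis by (simp only: pr dress_def null_fac_def * inverse_divide pfactor.simps)
  qed (simp add: pr dress_def null_fac_def minus_mscale)
  show "qfactor W a (vec.span {s}) \<mu> = dress (reflection W) 1 a s \<mu>"
    by (cases \<mu>) (simp_all add: pr dress_def null_fac_def)
qed

section \<open>Smoothness of projections\<close>

text \<open>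
  The Gram matrix of a frame, completed to a square matrix: the frame occupies the columns selected
  by the diagonal projection \<open>D\<close>, and \<open>mat 1 - D\<close> fills the remaining ones.
\<close>

lemma gram_projection:
  fixes U D :: "'k::finite cmat"
  assumes D: "adj D = D" "D ** D = D" "U ** D = U"
    and inj: "\<And>e. D *v e = e \<Longrightarrow> U *v e = 0 \<Longrightarrow> e = 0"
    and nd: "nondegenerate (range ((*v) U))"
  defines "G \<equiv> adj U ** U + (mat 1 - D)"
  shows "det G \<noteq> 0" and "ortho_proj (range ((*v) U)) (U ** matrix_inv G ** adj U)"
proof -
  have DU: "D ** adj U = adj U" using arg_cong[OF D(3), of adj] D(1) by (simp add: adj_simps)
  have DU': "D ** (adj U ** X) = adj U ** X" for X :: "'k cmat" by (simp add: matrix_mul_assoc DU)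
  have UD': "U *v (D *v e) = U *v e" for e by (simp add: matrix_vector_mul_assoc D)
  \<comment> \<open>Applying \<open>D\<close> to \<open>G *v e\<close> removes the filling term, so
    \<open>U *v e\<close> lies in the radical of the range and vanishes by nondegeneracy; the
    filling term then puts \<open>e\<close> into the range of \<open>D\<close>.\<close>
  have "e = 0" if "G *v e = 0" for e
  proof -
    have "D *v (G *v e) = adj U *v (U *v e)"
      by (simp add: G_def matrix_vector_mul_assoc mat_ring DU' D)
    then have 1: "adj U *v (U *v e) = 0" using that by simp
    with that have "D *v e = e" by (simp add: G_def mat_vec_ring)
    moreover have "mink (U *v z) (U *v e) = 0" for z by (simp add: mink_adj 1)
    then have "U *v e \<in> range ((*v) U) \<inter> orth (range ((*v) U))" by (auto simp: orth_def)
    then have "U *v e = 0" using nd by (metis nondegenerate_def singletonD)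
    ultimately show ?thesis by (rule inj)
  qed
  then obtain G' where "G' ** G = mat 1"
    using matrix_left_invertible_ker[of G] by auto
  then have GG': "G ** G' = mat 1" "G' ** G = mat 1" by (simp_all add: matrix_left_right_inverse)
  then have inv: "matrix_inv G = G'" by (simp add: matrix_inv_unique)
  show "det G \<noteq> 0" using GG' by (meson invertible_def invertible_det_nz)
  have "adj G = G" by (simp add: G_def adj_simps D)
  then have "adj G' ** G = mat 1" using arg_cong[OF GG'(1), of adj] by (simp add: adj_simps)
  then have "adj G' ** (G ** G') = G'" by (simp add: matrix_mul_assoc)
  then have adjG': "adj G' = G'" by (simp add: GG')
  \<comment> \<open>\<open>U\<close> kills the filling columns, so \<open>G\<close> and its inverse
    fix them; subtracting this part from \<open>G\<close> yields the identity that makes the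
    candidate a projection.\<close>
  have "G ** (mat 1 - D) = mat 1 - D" by (simp add: G_def mat_ring D)
  then have "G' ** (G ** (mat 1 - D)) = G' ** (mat 1 - D)" by simp
  then have G'D: "G' ** (mat 1 - D) = mat 1 - D" by (simp add: matrix_mul_assoc GG')
  have "U ** (G' ** (adj U ** U)) = U ** (G' ** G) - U ** (G' ** (mat 1 - D))"
    by (simp add: G_def mat_ring)
  then have *: "U ** (G' ** (adj U ** U)) = U" unfolding G'D by (simp add: GG' mat_ring D)
  then have **: "U ** (G' ** (adj U ** (U ** X))) = U ** X" for X :: "'k cmat"
    by (metis matrix_mul_assoc)
  show "ortho_proj (range ((*v) U)) (U ** matrix_inv G ** adj U)"
    unfolding ortho_proj_def inv
  proof (intro conjI set_eqI iffI)
    fix w assume "w \<in> range ((*v) U)"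
    then obtain e where "w = U *v e" by auto
    then show "w \<in> {w. U ** G' ** adj U *v w = w}" by (simp add: matrix_vector_mul_assoc mat_ring *)
  next
    fix w assume "w \<in> {w. U ** G' ** adj U *v w = w}"
    then have "w = U *v (G' *v (adj U *v w))" by (simp add: mat_vec_ring)
    then show "w \<in> range ((*v) U)" by blast
  qed (simp_all add: mat_ring ** adj_simps adjG')
qed

lemma smooth_mult:
  fixes f g :: "_ \<Rightarrow> 'k::finite cmat"
  shows "conformal_atlas \<A> \<Longrightarrow> open W \<Longrightarrow> smooth_map_on \<A> W f \<Longrightarrow> smooth_map_on \<A> W g \<Longrightarrow>
    smooth_map_on \<A> W (\<lambda>p. f p ** g p)"
  by (rule smooth_bilinear[OF _ _ bounded_bilinear_mat_mult])

lemma smooth_mult_vec: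
  fixes f :: "_ \<Rightarrow> 'k::finite cmat"
  shows "conformal_atlas \<A> \<Longrightarrow> open W \<Longrightarrow> smooth_map_on \<A> W f \<Longrightarrow> smooth_map_on \<A> W g \<Longrightarrow>
    smooth_map_on \<A> W (\<lambda>p. f p *v g p)"
  by (rule smooth_bilinear[OF _ _ bounded_bilinear_mat_vec])

lemma smooth_adj:
  fixes f :: "_ \<Rightarrow> 'k::finite cmat"
  shows "conformal_atlas \<A> \<Longrightarrow> open W \<Longrightarrow> smooth_map_on \<A> W f \<Longrightarrow> smooth_map_on \<A> W (\<lambda>p. adj (f p))"
  by (rule smooth_linear[OF _ _ bounded_linear_adj])

lemma smooth_mscale:
  fixes f :: "_ \<Rightarrow> 'k::finite cmat"
  shows "conformal_atlas \<A> \<Longrightarrow> open W \<Longrightarrow> smooth_map_on \<A> W f \<Longrightarrow> smooth_map_on \<A> W (\<lambda>p. a *m f p)"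
  by (rule smooth_linear[OF _ _ bounded_linear_mscale])

lemma bounded_bilinear_outer: "bounded_bilinear (outer :: 'k::finite cvec \<Rightarrow> 'k cvec \<Rightarrow> 'k cmat)"
proof -
  have r: "r *\<^sub>R w = complex_of_real r *s w" for r and w :: "'k cvec"
    by (simp add: vec_eq_iff scaleR_conv_of_real[where 'a=complex])
  have "bilinear (outer :: 'k cvec \<Rightarrow> 'k cvec \<Rightarrow> 'k cmat)"
    unfolding bilinear_def r
    by (auto intro!: linearI mat_eqI simp: outer_vec mat_vec_ring mink_simps r mscale_scaleR algebra_simps)
  then show ?thesis by (simp add: bilinear_conv_bounded_bilinear)
qed

lemma smooth_line_proj:
  fixes s m :: "_ \<Rightarrow> 'k::finite cvec"
  assumes "conformal_atlas \<A>" "open W" "smooth_map_on \<A> W s" "smooth_map_on \<A> W m"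
    and "\<And>p. p \<in> W \<Longrightarrow> mink (s p) (m p) \<noteq> 0"
  shows "smooth_map_on \<A> W (\<lambda>p. line_proj (s p) (m p))"
  unfolding line_proj_def
  by (rule smooth_bilinear[OF assms(1,2) bounded_bilinear_mscale] smooth_inverse[OF assms(1,2)]
      smooth_bilinear[OF assms(1,2) bounded_bilinear_mink] smooth_bilinear[OF assms(1,2) bounded_bilinear_outer]
      assms | assumption)+

lemma smooth_dress:
  fixes R :: "_ \<Rightarrow> 'k::finite cmat"
  assumes "conformal_atlas \<A>" "open W" "smooth_map_on \<A> W R" "smooth_map_on \<A> W s"
    and "\<And>p. p \<in> W \<Longrightarrow> frame_vec (R p) (s p)"
  shows "smooth_map_on \<A> W (\<lambda>p. dress (R p) e a (s p) \<mu>)"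
proof -
  have "smooth_map_on \<A> W (\<lambda>p. R p *v s p)" by (intro smooth_mult_vec assms)
  then have "smooth_map_on \<A> W (\<lambda>p. line_proj (s p) (R p *v s p))"
    "smooth_map_on \<A> W (\<lambda>p. line_proj (R p *v s p) (s p))"
    using assms by (auto intro!: smooth_line_proj simp: frame_vec_def mink_commute)
  then show ?thesis
    unfolding dress_def null_fac_def
    by (intro smooth_add smooth_diff smooth_mscale smooth_const assms)
qed

lemma subbundle_frame:
  assumes "subbundle \<A> k V" "p \<in> points \<A>"
  obtains W s where "open W" "p \<in> W" "W \<subseteq> points \<A>" "\<And>i. i < k \<Longrightarrow> smooth_map_on \<A> W (s i)"
    "\<And>x. x \<in> W \<Longrightarrow> V x = vec.span {s i x | i. i < k}"
proof -
  have "\<exists>W s. open W \<and> p \<in> W \<and> W \<subseteq> points \<A> \<and> (\<forall>i<k. smooth_map_on \<A> W (s i)) \<and>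
      (\<forall>x\<in>W. V x = vec.span {s i x | i. i < k})"
    using assms unfolding subbundle_def by (auto dest!: bspec)
  then show thesis using that by (elim exE conjE) (rule that, auto)
qed

text \<open>A local frame gives the projection by the Gram formula, which is smooth wherever the
  Gram matrix is invertible.\<close>

lemma bundle_projection:
  fixes V :: "('m::topological_space, 'k::finite) vbundle"
  assumes atlas: "conformal_atlas \<A>" and V: "subbundle \<A> k V" "nondeg_bundle \<A> V"
  obtains M where "\<And>p. p \<in> points \<A> \<Longrightarrow> ortho_proj (V p) (M p)" "smooth_map_on \<A> (points \<A>) M"
proof -
  have local: "\<exists>W M. open W \<and> p \<in> W \<and> W \<subseteq> points \<A> \<and> (\<forall>x\<in>W. ortho_proj (V x) (M x)) \<and> smooth_map_on \<A> W M"
    if p: "p \<in> points \<A>" for p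
  proof -
    obtain W s where W: "open W" "p \<in> W" "W \<subseteq> points \<A>"
      and s: "\<And>i. i < k \<Longrightarrow> smooth_map_on \<A> W (s i)"
      and span: "\<And>x. x \<in> W \<Longrightarrow> V x = vec.span {s i x | i. i < k}"
      by (rule subbundle_frame[OF V(1) p]) (rule that, auto)
    have dim: "vec.dim (V x) = k" if "x \<in> W" for x using V(1) W that by (auto simp: subbundle_def)
    \<comment> \<open>The rank is at most the dimension, so the frame vectors can be assigned to
      distinct columns of a square matrix.\<close>
    have "k \<le> CARD('k option)"
      using dim[OF W(2)] vec.dim_subset[of "V p" UNIV] by (simp only: vec_dim_card subset_UNIV simp_thms)
    then obtain f where f: "inj_on f {..<k}" "f ` {..<k} \<subseteq> (UNIV :: 'k option set)"
      using card_le_inj[of "{..<k}" "UNIV :: 'k option set"] by auto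
    define g where "g = inv_into {..<k} f"
    have gf: "g (f i) = i" if "i < k" for i using f that by (simp add: g_def)
    define B where "B = f ` {..<k}"
    have gB: "g b < k" "f (g b) = b" if "b \<in> B" for b
      using that by (auto simp: B_def gf)
    define D :: "'k cmat" where "D = (\<chi> a b. if a = b \<and> a \<in> B then 1 else 0)"
    define U :: "'m \<Rightarrow> 'k cmat" where "U x = (\<chi> a b. if b \<in> B then s (g b) x $ a else 0)" for x
    have Dvec: "(D *v w) $ a = (if a \<in> B then w $ a else 0)" for w a
      by (simp add: matrix_vector_mult_def D_def if_distrib[where f = "\<lambda>x. x * _"] cong: if_cong)
    have Uvec: "U x *v w = (\<Sum>i<k. w $ f i *s s i x)" for x w
    proof -
      have "U x *v w = (\<Sum>b\<in>UNIV. if b \<in> B then w $ b *s s (g b) x else 0)"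
        by (auto simp: vec_eq_iff matrix_vector_mult_def U_def intro!: sum.cong)
      also have "\<dots> = (\<Sum>b\<in>B. w $ b *s s (g b) x)"
        by (simp add: sum.If_cases)
      also have "\<dots> = (\<Sum>i<k. w $ f i *s s (g (f i)) x)"
        unfolding B_def by (simp add: sum.reindex[OF f(1)])
      finally show ?thesis by (simp add: gf)
    qed
    have D: "D ** D = D" "U x ** D = U x" "adj D = D" for x
    proof -
      show "D ** D = D" by (rule mat_eqI) (simp add: mat_vec_ring vec_eq_iff Dvec)
      show "U x ** D = U x" by (rule mat_eqI) (auto simp: mat_vec_ring Uvec Dvec B_def intro!: sum.cong)
      show "adj D = D"
        by (rule adj_eqI) (auto simp: mink_def Dvec intro!: sum.cong arg_cong2[where f = minus])
    qed
    have range: "range ((*v) (U x)) = V x" if x: "x \<in> W" for x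
    proof (intro set_eqI iffI)
      fix w assume "w \<in> range ((*v) (U x))"
      then show "w \<in> V x"
        unfolding span[OF x] Uvec by clarify (intro vec.span_sum vec.span_scale vec.span_base, auto)
    next
      have "vec.subspace (range ((*v) (U x)))"
      proof -
        have "0 = U x *v 0" "U x *v v + U x *v w = U x *v (v + w)" "c *s (U x *v v) = U x *v (c *s v)" for c v w
          by (simp_all add: mat_vec_ring)
        then show ?thesis unfolding vec.subspace_def by (blast intro: range_eqI)
      qed
      moreover have "{s i x | i. i < k} \<subseteq> range ((*v) (U x))"
      proof clarify
        fix i assume i: "i < k"
        have "U x *v axis (f i) 1 = (\<Sum>j<k. if j = i then s i x else 0)"
          unfolding Uvec using i f(1) by (intro sum.cong) (auto simp: axis_def inj_on_def)
        also have "\<dots> = s i x" using i by simp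
        finally show "s i x \<in> range ((*v) (U x))" by (metis rangeI)
      qed
      moreover fix w assume "w \<in> V x"
      ultimately show "w \<in> range ((*v) (U x))"
        unfolding span[OF x] using vec.span_minimal by blast
    qed
    \<comment> \<open>The \<open>k\<close> frame vectors span a space of dimension \<open>k\<close>,
      so they are distinct and independent.\<close>
    have inj: "e = 0" if x: "x \<in> W" and De: "D *v e = e" and Ue: "U x *v e = 0" for x e
    proof -
      define S where "S = (\<lambda>i. s i x) ` {..<k}"
      have fin: "finite S" by (simp add: S_def)
      have "S = {s i x | i. i < k}" by (auto simp: S_def)
      then have S: "V x = vec.span S" using span[OF x] by (simp only:)
      then have dS: "vec.dim (vec.span S) = k" using dim[OF x] by (simp only:)
      have "k \<le> card S" using vec.dim_le_card[of "vec.span S" S] dS by (simp add: S_def)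
      moreover have "card S \<le> k" unfolding S_def using card_image_le[of "{..<k}"] by simp
      ultimately have cS: "card S = k" by simp
      then have injs: "inj_on (\<lambda>i. s i x) {..<k}" unfolding S_def by (intro eq_card_imp_inj_on) auto
      have ind: "vec.independent S"
        by (rule vec.card_le_dim_spanning[of S "vec.span S"]) (use cS dS vec.span_superset[of S] in \<open>simp_all add: fin\<close>)
      have invs: "inv_into {..<k} (\<lambda>i. s i x) (s i x) = i" if "i < k" for i
        using inv_into_f_f[OF injs, of i] that by simp
      have z: "(\<Sum>v\<in>S. e $ f (inv_into {..<k} (\<lambda>i. s i x) v) *s v) = 0"
        using Ue unfolding S_def by (simp add: Uvec sum.reindex[OF injs] invs)
      have "e $ f i = 0" if "i < k" for i
      proof -
        have "s i x \<in> S" using that by (simp add: S_def)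
        with ind z have "e $ f (inv_into {..<k} (\<lambda>i. s i x) (s i x)) = 0"
          using vec.independentD[of S S "\<lambda>v. e $ f (inv_into {..<k} (\<lambda>i. s i x) v)" "s i x"]
          by (simp add: S_def)
        then show ?thesis using that by (simp add: invs)
      qed
      then have "(D *v e) $ a = 0" for a by (auto simp: Dvec B_def)
      then show ?thesis using De by (simp add: vec_eq_iff)
    qed
    define G where "G x = adj (U x) ** U x + (mat 1 - D)" for x
    have gram: "det (G x) \<noteq> 0" "ortho_proj (V x) (U x ** matrix_inv (G x) ** adj (U x))" if x: "x \<in> W" for x
    proof -
      have nd: "nondegenerate (range ((*v) (U x)))"
        using V(2) W x by (auto simp: range nondeg_bundle_def)
      show "det (G x) \<noteq> 0" "ortho_proj (V x) (U x ** matrix_inv (G x) ** adj (U x))"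
        using gram_projection[OF D(3,1,2) inj[OF x] nd] range[OF x] by (simp_all add: G_def)
    qed
    have sU: "smooth_map_on \<A> W U"
    proof (intro smooth_vec atlas W)
      fix a b
      show "smooth_map_on \<A> W (\<lambda>x. U x $ a $ b)"
        by (cases "b \<in> B")
           (simp_all add: U_def smooth_const[OF atlas W(1)] gB
             smooth_linear[OF atlas W(1) bounded_linear_vec_nth s])
    qed
    have "smooth_map_on \<A> W (\<lambda>x. U x ** matrix_inv (G x) ** adj (U x))"
      by (intro smooth_mult smooth_adj smooth_matrix_inv atlas W sU gram)
         (auto simp: G_def intro!: smooth_add smooth_mult smooth_adj smooth_const atlas W sU)
    with W gram(2) show ?thesis
      by (intro exI[of _ W] exI[of _ "\<lambda>x. U x ** matrix_inv (G x) ** adj (U x)"]) simp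
  qed
  \<comment> \<open>Defined from the fibre itself, so the formulas from different frames agree on
    overlaps.\<close>
  define M where "M p = proj (V p) (orth (V p))" for p
  have M: "ortho_proj (V p) (M p)" if "p \<in> points \<A>" for p
    using local[OF that] ortho_proj_proj(1) unfolding M_def by metis
  have "smooth_map_on \<A> (points \<A>) M"
  proof (rule smooth_local[OF atlas])
    fix p assume "p \<in> points \<A>"
    then obtain W N where W: "open W" "p \<in> W" "W \<subseteq> points \<A>" "\<And>x. x \<in> W \<Longrightarrow> ortho_proj (V x) (N x)"
      "smooth_map_on \<A> W N" using local by metis
    have "smooth_map_on \<A> W M"
      by (rule smooth_cong[OF atlas W(1) _ W(5)]) (use W(4) ortho_proj_proj(1) M_def in metis)
    then show "\<exists>T. open T \<and> p \<in> T \<and> smooth_map_on \<A> (points \<A> \<inter> T) M"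
      using W by (metis inf.absorb2)
  qed
  with M that show thesis by blast
qed

lemma line_frame:
  fixes L :: "('m::topological_space, 'k::finite) vbundle"
  assumes "null_line_bundle \<A> L" "p \<in> points \<A>"
  obtains W s where "open W" "p \<in> W" "W \<subseteq> points \<A>" "smooth_map_on \<A> W s"
    "\<And>x. x \<in> W \<Longrightarrow> L x = vec.span {s x}" "\<And>x. x \<in> W \<Longrightarrow> s x \<noteq> 0" "\<And>x. x \<in> W \<Longrightarrow> mink (s x) (s x) = 0"
proof -
  have L: "subbundle \<A> 1 L" "isotropic_bundle \<A> L" using assms by (auto simp: null_line_bundle_def)
  obtain W s where W: "open W" "p \<in> W" "W \<subseteq> points \<A>"
    and s: "\<And>i. i < 1 \<Longrightarrow> smooth_map_on \<A> W (s i)"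
    and span: "\<And>x. x \<in> W \<Longrightarrow> L x = vec.span {s i x | i. i < (1::nat)}"
    by (rule subbundle_frame[OF L(1) assms(2)]) (rule that, auto)
  have *: "L x = vec.span {s 0 x}" if "x \<in> W" for x
    using span[OF that] by simp
  show thesis
  proof
    fix x assume x: "x \<in> W"
    have "vec.dim (L x) = 1" using L(1) W(3) x unfolding subbundle_def by blast
    then have "vec.dim (vec.span {s 0 x}) = 1" using *[OF x] by (simp only:)
    moreover have "vec.dim (vec.span {0 :: 'k cvec}) = 0" by (metis vec.dim_empty vec.dim_span vec.span_empty vec.span_insert_0)
    ultimately show "s 0 x \<noteq> 0" by force
    have "s 0 x \<in> L x" using *[OF x] by (simp add: vec.span_base)
    then show "mink (s 0 x) (s 0 x) = 0" using L x W by (auto simp: isotropic_bundle_def isotropic_def)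
  qed (use W s * in auto)
qed

section \<open>Laurent families of connection forms\<close>

definition part10 :: "(complex \<Rightarrow> 'k::finite cmat) \<Rightarrow> complex \<Rightarrow> 'k cmat" where
  "part10 \<omega> v = (1/2) *m (\<omega> v - \<i> *m \<omega> (\<i> * v))"

definition part01 :: "(complex \<Rightarrow> 'k::finite cmat) \<Rightarrow> complex \<Rightarrow> 'k cmat" where
  "part01 \<omega> v = (1/2) *m (\<omega> v + \<i> *m \<omega> (\<i> * v))"

lemma form_part: "form10 \<omega> c p = part10 (\<omega> c p)" "form01 \<omega> c p = part01 (\<omega> c p)"
  by (auto simp: form10_def form01_def part10_def part01_def fun_eq_iff)

lemma part_sum: "part10 \<omega> v + part01 \<omega> v = \<omega> v"
  by (simp add: part10_def part01_def vec_eq_iff field_simps)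

text \<open>Multiplying twice by the imaginary unit is \<open>v \<mapsto> - v\<close>, so oddness
  makes the two parts complex linear and antilinear.\<close>

lemma part_type:
  assumes "\<And>v. \<omega> (- v) = - \<omega> v"
  shows "part10 \<omega> (\<i> * v) = \<i> *m part10 \<omega> v" "part01 \<omega> (\<i> * v) = - (\<i> *m part01 \<omega> v)"
proof -
  have "\<omega> (\<i> * (\<i> * v)) = - \<omega> v" using assms[of v] by (simp add: mult.assoc[symmetric])
  then show "part10 \<omega> (\<i> * v) = \<i> *m part10 \<omega> v" "part01 \<omega> (\<i> * v) = - (\<i> *m part01 \<omega> v)"
    by (simp_all add: part10_def part01_def vec_eq_iff algebra_simps)
qed

text \<open>The splitting into types is unique; this reads off the parts of a transformed form from
  a sum of terms of known type.\<close>

lemma part_split: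
  assumes "\<And>v. A (\<i> * v) = \<i> *m A v" "\<And>v. B (\<i> * v) = - (\<i> *m B v)" "\<And>v. \<omega> v = A v + B v"
  shows "part10 \<omega> v = A v" "part01 \<omega> v = B v"
  by (simp_all add: part10_def part01_def assms vec_eq_iff algebra_simps)

definition laurent :: "(int \<Rightarrow> complex \<Rightarrow> 'k::finite cmat) \<Rightarrow> complex \<Rightarrow> complex \<Rightarrow> 'k cmat" where
  "laurent C x v = inverse (x^2) *m C (-2) v + inverse x *m C (-1) v + C 0 v + x *m C 1 v + x^2 *m C 2 v"

text \<open>Negative powers carry (1,0)-forms and positive powers (0,1)-forms; the coefficient of
  index 0 mixes both.\<close>

definition typed :: "(int \<Rightarrow> complex \<Rightarrow> 'k::finite cmat) \<Rightarrow> bool" where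
  "typed C \<longleftrightarrow> (\<forall>v. C (-2) (\<i> * v) = \<i> *m C (-2) v \<and> C (-1) (\<i> * v) = \<i> *m C (-1) v \<and>
     C 1 (\<i> * v) = - (\<i> *m C 1 v) \<and> C 2 (\<i> * v) = - (\<i> *m C 2 v))"

definition second_form :: "'k::finite cmat \<Rightarrow> (complex \<Rightarrow> 'k cmat) \<Rightarrow> complex \<Rightarrow> 'k cmat" where
  "second_form R R' v = (-1/2) *m (R ** R' v)"

text \<open>\<open>C k\<close> is the coefficient of the power \<open>k\<close> in the connection
  minus d. At index 0, \<open>- N\<close> comes from writing the induced connection as d minus N,
  and the rest from the two subtracted ones in front of q.\<close>

definition conn_coeffs :: "(complex \<Rightarrow> 'k::finite cmat) \<Rightarrow> (complex \<Rightarrow> 'k cmat) \<Rightarrow> int \<Rightarrow> complex \<Rightarrow> 'k cmat" where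
  "conn_coeffs N q k v =
     (if k = -2 then part10 q v else if k = -1 then part10 N v else
      if k = 0 then - N v - part10 q v - part01 q v else if k = 1 then part01 N v else part01 q v)"

lemma laurent_conn_coeffs:
  "laurent (conn_coeffs N q) x v = - N v + inverse x *m part10 N v + x *m part01 N v +
      (inverse (x^2) - 1) *m part10 q v + (x^2 - 1) *m part01 q v"
  by (simp add: laurent_def conn_coeffs_def diff_mscale)

text \<open>At parameter 1 the family is d itself. Hence the value of the dressing gauge at 1 is the
  normalising factor.\<close>

lemma laurent_conn_coeffs_one: "laurent (conn_coeffs N q) 1 v = 0"
  unfolding laurent_conn_coeffs by (subst part_sum[of N v, symmetric]) simp

text \<open>
  \<open>R\<close>, \<open>R'\<close> are the values at a point of the reflection in the bundle and of its derivative. The last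
  condition says that conjugation by the reflection turns the connection of parameter \<open>x\<close> into the
  one of parameter \<open>- x\<close>.
\<close>

definition symmetric_family :: "'k::finite cmat \<Rightarrow> (complex \<Rightarrow> 'k cmat) \<Rightarrow> (int \<Rightarrow> complex \<Rightarrow> 'k cmat) \<Rightarrow>
    complex set \<Rightarrow> bool" where
  "symmetric_family R R' C G \<longleftrightarrow> typed C \<and>
     (\<forall>v. adj (C 2 v) = - C 2 v \<and> adj (C (-2) v) = - C (-2) v) \<and>
     (\<forall>x\<in>G. x \<noteq> 0 \<and> - x \<in> G \<and>
        (\<forall>v. adj (laurent C x v) = - laurent C x v \<and>
             R ** laurent C x v ** R + R ** R' v = laurent C (- x) v))"

text \<open>Differentiating \<open>R ** R = mat 1\<close> makes \<open>R'\<close> anticommute with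
  \<open>R\<close>, so N exchanges the bundle and its complement.\<close>

lemma second_form_props:
  assumes R: "involution R" and R': "R' v ** R + R ** R' v = 0" "adj (R' v) = R' v"
  shows "adj (second_form R R' v) = - second_form R R' v"
    "R ** second_form R R' v ** R = - second_form R R' v"
proof -
  have a: "R' v ** R = - (R ** R' v)" using R'(1) by (simp add: eq_neg_iff_add_eq_0)
  have b: "R ** (R ** X) = X" for X by (rule involution_cancel(3)[OF R])
  show "adj (second_form R R' v) = - second_form R R' v"
    "R ** second_form R R' v ** R = - second_form R R' v"
    by (simp_all add: second_form_def adj_simps involution_cancel[OF R] R' a b mat_ring mscale_ring)
qed

text \<open>Applied to the adjoint and to conjugation by the reflection, both complex linear, so
  that sign relations pass to the type parts.\<close>

lemma part_linear:
  assumes "\<And>v. h (\<omega> v) = s *m \<omega> v" "\<And>A B. h (A + B) = h A + h B" "\<And>A B. h (A - B) = h A - h B"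
    "\<And>a A. h (a *m A) = a *m h A"
  shows "h (part10 \<omega> v) = s *m part10 \<omega> v" "h (part01 \<omega> v) = s *m part01 \<omega> v"
  by (simp_all add: part10_def part01_def assms mscale_ring vec_eq_iff algebra_simps)

text \<open>N anticommutes with the reflection and q commutes with it, so conjugation flips exactly
  the odd powers. At index 0 the term \<open>R ** R' v\<close>, which is -2 N, restores the sign of
  N.\<close>

lemma symmetric_family_conn:
  assumes R: "involution R" and R': "\<And>v. R' v ** R + R ** R' v = 0" "\<And>v. adj (R' v) = R' v"
    "\<And>v. R' (- v) = - R' v"
    and q: "\<And>v. q (- v) = - q v" "\<And>v. adj (q v) = - q v" "\<And>v. R ** q v ** R = q v"
  shows "symmetric_family R R' (conn_coeffs (second_form R R') q) (- {0})"
proof -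
  let ?N = "second_form R R'"
  have N: "adj (?N v) = - ?N v" "R ** ?N v ** R = - ?N v" for v
    by (rule second_form_props[OF R R'(1,2)])+
  have Nodd: "?N (- v) = - ?N v" for v by (simp add: second_form_def R' mat_ring mscale_ring)
  have conj: "R ** (A + B) ** R = R ** A ** R + R ** B ** R" "R ** (A - B) ** R = R ** A ** R - R ** B ** R"
    "R ** (a *m A) ** R = a *m (R ** A ** R)" for A B a by (simp_all add: mat_ring mscale_ring)
  have pN: "adj (part10 ?N v) = - part10 ?N v" "adj (part01 ?N v) = - part01 ?N v"
     "R ** part10 ?N v ** R = - part10 ?N v" "R ** part01 ?N v ** R = - part01 ?N v" for v
    using part_linear[of adj ?N "-1" v] part_linear[of "\<lambda>X. R ** X ** R" ?N "-1" v] N conj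
    by (simp_all add: adj_simps minus_mscale)
  have pq: "adj (part10 q v) = - part10 q v" "adj (part01 q v) = - part01 q v"
     "R ** part10 q v ** R = part10 q v" "R ** part01 q v ** R = part01 q v" for v
    using part_linear[of adj q "-1" v] part_linear[of "\<lambda>X. R ** X ** R" q "1" v] q conj
    by (simp_all add: adj_simps minus_mscale)
  have RR': "R ** R' v = -2 *m ?N v" for v
    by (simp add: second_form_def)
  have "typed (conn_coeffs ?N q)"
    using part_type[of q] part_type[of ?N] q Nodd by (simp add: typed_def conn_coeffs_def)
  moreover have "adj (conn_coeffs ?N q 2 v) = - conn_coeffs ?N q 2 v \<and>
    adj (conn_coeffs ?N q (-2) v) = - conn_coeffs ?N q (-2) v" for v
    by (simp add: conn_coeffs_def pq)
  moreover have "adj (laurent (conn_coeffs ?N q) x v) = - laurent (conn_coeffs ?N q) x v" for x v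
    by (simp add: laurent_conn_coeffs adj_simps pq pN N mscale_minus)
  moreover have "R ** laurent (conn_coeffs ?N q) x v ** R + R ** R' v = laurent (conn_coeffs ?N q) (- x) v" for x v
  proof -
    have "R ** laurent (conn_coeffs ?N q) x v ** R = ?N v - inverse x *m part10 ?N v - x *m part01 ?N v +
        (inverse (x^2) - 1) *m part10 q v + (x^2 - 1) *m part01 q v"
      using N(2) pN(3,4) pq(3,4)
      by (simp add: laurent_conn_coeffs conj mat_mult_minus_left mat_mult_minus_right mscale_minus)
    then show ?thesis
      unfolding RR' by (simp add: laurent_conn_coeffs minus_mscale vec_eq_iff)
  qed
  ultimately show ?thesis by (simp add: symmetric_family_def)
qed

text \<open>For the conjugated reflection, the product with its derivative is the conjugate of
  \<open>laurent C (- l) v - laurent C l v\<close>. Only odd coefficients survive there, so they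
  form the new second fundamental form; the even extreme ones are the multiplier. Parameter
  \<open>m\<close> corresponds to \<open>m * l\<close> because the gauge trivialises the family at
  \<open>l\<close>.\<close>

lemma conn_normal_form:
  assumes C: "typed C" "l \<noteq> 0" "m \<noteq> 0"
    and sym: "\<And>v. R ** laurent C l v ** R + R ** R' v = laurent C (- l) v"
    and skew: "\<And>v. adj (laurent C l v) = - laurent C l v"
    and R: "involution R" and g: "g \<in> orthogonal_maps"
    and g': "\<And>v. g' v = g ** laurent C l v"
    and R1': "\<And>v. R1' v = g' v ** R ** adj g + g ** R' v ** adj g + g ** R ** adj (g' v)"
    and q1: "\<And>v. part10 q1 v = g ** (inverse (l^2) *m C (-2) v) ** adj g"
      "\<And>v. part01 q1 v = g ** (l^2 *m C 2 v) ** adj g"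
  shows "laurent (conn_coeffs (second_form (g ** R ** adj g) R1') q1) m v =
    g ** (laurent C (m * l) v - laurent C l v) ** adj g"
proof -
  let ?N = "second_form (g ** R ** adj g) R1'"
  have gg: "adj g ** (g ** X) = X" for X by (rule orthogonal_cancel(3)[OF g])
  have N: "?N v = g ** (inverse l *m C (-1) v) ** adj g + g ** (l *m C 1 v) ** adj g" for v
  proof -
    have "g ** R ** adj g ** R1' v = g ** (R ** laurent C l v ** R + R ** R' v - laurent C l v) ** adj g"
      by (simp add: R1' g' adj_simps skew mat_ring gg involution_cancel[OF R])
    also have "R ** laurent C l v ** R + R ** R' v - laurent C l v = (-2) *m (inverse l *m C (-1) v + l *m C 1 v)"
      unfolding sym by (simp add: laurent_def vec_eq_iff algebra_simps)
    finally show ?thesis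
      unfolding second_form_def by (simp add: mat_ring mscale_ring)
  qed
  have p: "part10 ?N v = g ** (inverse l *m C (-1) v) ** adj g" "part01 ?N v = g ** (l *m C 1 v) ** adj g"
    by (rule part_split[of "\<lambda>v. g ** (inverse l *m C (-1) v) ** adj g" "\<lambda>v. g ** (l *m C 1 v) ** adj g"];
        use C(1) N in \<open>simp add: typed_def mat_ring mscale_ring mult.commute\<close>)+
  have "laurent (conn_coeffs ?N q1) m v =
     g ** (- (inverse l *m C (-1) v) - l *m C 1 v + inverse m *m (inverse l *m C (-1) v) + m *m (l *m C 1 v) +
      (inverse (m^2) - 1) *m (inverse (l^2) *m C (-2) v) + (m^2 - 1) *m (l^2 *m C 2 v)) ** adj g"
    unfolding laurent_conn_coeffs p q1 N
    by (simp add: mat_ring mscale_ring)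
  also have "- (inverse l *m C (-1) v) - l *m C 1 v + inverse m *m (inverse l *m C (-1) v) + m *m (l *m C 1 v) +
      (inverse (m^2) - 1) *m (inverse (l^2) *m C (-2) v) + (m^2 - 1) *m (l^2 *m C 2 v) =
      laurent C (m * l) v - laurent C l v"
    by (simp add: laurent_def vec_eq_iff power_mult_distrib algebra_simps)
  finally show ?thesis .
qed

section \<open>Dressing by a simple factor\<close>

text \<open>A Laurent polynomial with a zero at \<open>a\<close> is divisible by
  \<open>x - a\<close>. Division from the top gives the coefficients of index 0 and above, division
  from the bottom the negative ones. The extreme ones acquire the values of
  \<open>(x + a) / (x - a)\<close> at infinity and 0, namely 1 and -1.\<close>

lemma shift_pole_scalar:
  fixes a x :: complex
  assumes "a \<noteq> 0" "x \<noteq> 0" "x \<noteq> a"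
    and "inverse (a^2) * g0 + inverse a * g1 + g2 + a * g3 + a^2 * g4 = 0"
  shows "(x + a) / (x - a) * (inverse (x^2) * g0 + inverse x * g1 + g2 + x * g3 + x^2 * g4) =
    inverse (x^2) * (- g0) + inverse x * (- g1 - (2 / a) * g0) + (g2 + 2 * a * (g3 + a * g4)) +
    x * (g3 + 2 * a * g4) + x^2 * g4"
proof -
  have g2: "g2 = - (inverse (a^2) * g0 + inverse a * g1 + a * g3 + a^2 * g4)"
    using assms(4) by (simp add: eq_neg_iff_add_eq_0 algebra_simps)
  have "x - a \<noteq> 0" using assms by simp
  then show ?thesis unfolding g2 using assms(1,2)
    by (simp add: divide_simps) (simp add: algebra_simps power2_eq_square)
qed

lemma shift_pole:
  assumes "a \<noteq> 0" "x \<noteq> 0" "x \<noteq> a"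
    and "inverse (a^2) *m g0 + inverse a *m g1 + g2 + a *m g3 + a^2 *m g4 = 0"
  shows "((x + a) / (x - a)) *m (inverse (x^2) *m g0 + inverse x *m g1 + g2 + x *m g3 + x^2 *m g4) =
    inverse (x^2) *m (- g0) + inverse x *m (- g1 - (2 / a) *m g0) + (g2 + (2 * a) *m (g3 + a *m g4)) +
    x *m (g3 + (2 * a) *m g4) + x^2 *m g4"
proof -
  have "inverse (a^2) * g0 $ i $ j + inverse a * g1 $ i $ j + g2 $ i $ j + a * g3 $ i $ j + a^2 * g4 $ i $ j = 0" for i j
    using arg_cong[OF assms(4), of "\<lambda>A. A $ i $ j"] by simp
  from shift_pole_scalar[OF assms(1-3) this] show ?thesis
    by (simp add: vec_eq_iff)
qed

section \<open>Blocks with respect to a pair of null lines\<close>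

definition block_diag :: "'k::finite cmat \<Rightarrow> 'k cmat \<Rightarrow> 'k cmat \<Rightarrow> 'k cmat" where
  "block_diag P Q X = P ** X ** P + Q ** X ** Q + (mat 1 - P - Q) ** X ** (mat 1 - P - Q)"

text \<open>The blocks that move one step along the chain L, middle space, reflected line.
  Conjugation by \<open>null_fac f P Q\<close> multiplies them by \<open>inverse f\<close>, and the
  mirror blocks by \<open>f\<close>.\<close>

definition block_up :: "'k::finite cmat \<Rightarrow> 'k cmat \<Rightarrow> 'k cmat \<Rightarrow> 'k cmat" where
  "block_up P Q X = (mat 1 - P - Q) ** X ** P + Q ** X ** (mat 1 - P - Q)"

lemma block_linear:
  "block_diag P Q (X + Y) = block_diag P Q X + block_diag P Q Y"
  "block_diag P Q (c *m X) = c *m block_diag P Q X"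
  "block_up P Q (X + Y) = block_up P Q X + block_up P Q Y"
  "block_up P Q (c *m X) = c *m block_up P Q X"
  supply [[simproc del: int_combine_numerals]]
  by (simp_all add: block_diag_def block_up_def mat_ring mscale_ring)

text \<open>The difference of \<open>d\<close> and the connection it induces on the decomposition given by \<open>P\<close>, \<open>Q\<close>.\<close>

definition block_beta :: "'k::finite cmat \<Rightarrow> 'k cmat \<Rightarrow> 'k cmat \<Rightarrow> 'k cmat \<Rightarrow> 'k cmat" where
  "block_beta P Q P' Q' = - (P ** P' + Q ** Q' - (mat 1 - P - Q) ** (P' + Q'))"

definition pair_deriv :: "'k::finite cmat \<Rightarrow> 'k cmat \<Rightarrow> 'k cmat \<Rightarrow> 'k cmat \<Rightarrow> bool" where
  "pair_deriv P Q P' Q' \<longleftrightarrow> P' ** P + P ** P' = P' \<and> Q' ** Q + Q ** Q' = Q' \<and>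
     P' ** Q + P ** Q' = 0 \<and> Q' ** P + Q ** P' = 0 \<and> adj P' = Q' \<and> adj Q' = P'"

lemma null_pair_rules:
  fixes P Q :: "'k::finite cmat"
  assumes "null_pair P Q"
  shows "P ** P = P" "Q ** Q = Q" "P ** Q = 0" "Q ** P = 0" "adj P = Q" "adj Q = P"
    "P ** (P ** X) = P ** X" "Q ** (Q ** X) = Q ** X" "P ** (Q ** X) = 0" "Q ** (P ** X) = 0"
  using assms by (auto simp: null_pair_def matrix_mul_assoc)

lemma pair_deriv_rules:
  fixes P Q :: "'k::finite cmat"
  assumes "pair_deriv P Q P' Q'"
  shows "P' ** P = P' - P ** P'" "Q' ** Q = Q' - Q ** Q'" "P' ** Q = - (P ** Q')" "Q' ** P = - (Q ** P')"
    "adj P' = Q'" "adj Q' = P'"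
    "P' ** (P ** X) = P' ** X - P ** (P' ** X)" "Q' ** (Q ** X) = Q' ** X - Q ** (Q' ** X)"
    "P' ** (Q ** X) = - (P ** (Q' ** X))" "Q' ** (P ** X) = - (Q ** (P' ** X))"
proof -
  note a = assms[unfolded pair_deriv_def]
  show 1: "P' ** P = P' - P ** P'" "Q' ** Q = Q' - Q ** Q'" "P' ** Q = - (P ** Q')" "Q' ** P = - (Q ** P')"
    "adj P' = Q'" "adj Q' = P'"
    using a by (auto simp: eq_diff_eq eq_neg_iff_add_eq_0)
  show "P' ** (P ** X) = P' ** X - P ** (P' ** X)" "Q' ** (Q ** X) = Q' ** X - Q ** (Q' ** X)"
    "P' ** (Q ** X) = - (P ** (Q' ** X))" "Q' ** (P ** X) = - (Q ** (P' ** X))"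
    unfolding matrix_mul_assoc 1 by (simp_all add: mat_ring)
qed

text \<open>Subtracting \<open>b\<close> from d leaves a connection for which both projections are
  parallel; in commutators this reads \<open>b ** P - P ** b = P'\<close>. It is a difference of
  metric connections, hence skew.\<close>

lemma block_beta_props:
  fixes P Q :: "'k::finite cmat"
  assumes np: "null_pair P Q" and pd: "pair_deriv P Q P' Q'"
  defines "b \<equiv> block_beta P Q P' Q'"
  shows "b ** P - P ** b = P'" "b ** Q - Q ** b = Q'" "adj b = - b"
  unfolding b_def block_beta_def
  supply [[simproc del: int_combine_numerals]]
  by (simp_all add: mat_ring null_pair_rules[OF np] pair_deriv_rules[OF pd] adj_simps)

lemma block_beta_swap: "block_beta Q P Q' P' = block_beta P Q P' Q'"
  by (simp add: block_beta_def mat_ring algebra_simps)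

text \<open>The skew off-diagonal blocks between the two null lines vanish, so only \<open>block_up\<close> and its mirror image remain.\<close>

lemma block_conj:
  fixes P Q B :: "'k::finite cmat"
  assumes np: "null_pair P Q" and f: "f \<noteq> 0" and z: "P ** (B ** Q) = 0" "Q ** (B ** P) = 0"
  shows "(block_diag P Q B + inverse f *m block_up P Q B + f *m block_up Q P B) ** null_fac f P Q =
    null_fac f P Q ** B"
proof -
  have z': "P ** (B ** (Q ** X)) = 0" "Q ** (B ** (P ** X)) = 0" for X :: "'k cmat"
    using z by (metis matrix_mul_assoc mat_mult_zero(2))+
  show ?thesis
    unfolding block_diag_def block_up_def null_fac_def
    supply [[simproc del: int_combine_numerals]]
    by (simp add: mat_ring mscale_ring null_pair_rules[OF np] z z' f)
qed

text \<open>\<open>block_beta\<close> plus \<open>Om\<close> is the difference of two connections, d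
  plus \<open>Om\<close> and the one induced by the splitting. Both preserve the line of
  \<open>s\<close>, so their difference has no component from it into the middle space.\<close>

lemma parallel_block:
  fixes P Q :: "'k::finite cmat"
  assumes np: "null_pair P Q" and P: "\<And>w. \<exists>c. P *v w = c *s s" and s: "P *v s = s"
    and ds: "P' *v s + P *v s' = s'" "Q' *v s + Q *v s' = 0"
    and par: "s' + Om *v s = k *s s"
  shows "(mat 1 - P - Q) ** (block_beta P Q P' Q' + Om) ** P = 0"
proof (rule mat_eqI)
  fix w
  have Q: "Q *v s = 0"
    using arg_cong[OF s, of "(*v) Q"] np by (simp add: null_pair_def matrix_vector_mul_assoc)
  have Om: "Om *v s = k *s s - s'" using par by (simp add: eq_diff_eq add.commute)
  have P's: "P' *v s = s' - P *v s'" "Q' *v s = - (Q *v s')" using ds by (auto simp: eq_diff_eq eq_neg_iff_add_eq_0)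
  have v: "P *v (P *v x) = P *v x" "P *v (Q *v x) = 0" "Q *v (P *v x) = 0" "Q *v (Q *v x) = Q *v x" for x
    using np by (simp_all add: null_pair_def matrix_vector_mul_assoc)
  have "(mat 1 - P - Q) *v ((block_beta P Q P' Q' + Om) *v s) = 0"
    by (simp add: block_beta_def mat_vec_ring Om P's v s Q)
  moreover obtain c where "P *v w = c *s s" using P by blast
  ultimately show "(mat 1 - P - Q) ** (block_beta P Q P' Q' + Om) ** P *v w = 0 *v w"
    by (simp add: matrix_vector_mul_assoc[symmetric] mult_vec_scale)
qed

text \<open>The diagonal blocks are kept; \<open>shift_pole\<close> is applied to the upper blocks
  with pole \<open>a\<close> and to their mirror with pole \<open>-a\<close>. The form
  \<open>b\<close> is constant in the parameter, so it joins index 0, and \<open>- b\<close> undoes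
  the passage to the induced connection.\<close>

definition dressed_coeffs :: "complex \<Rightarrow> complex \<Rightarrow> 'k::finite cmat \<Rightarrow> 'k cmat \<Rightarrow> (complex \<Rightarrow> 'k cmat) \<Rightarrow>
    (int \<Rightarrow> complex \<Rightarrow> 'k cmat) \<Rightarrow> int \<Rightarrow> complex \<Rightarrow> 'k cmat" where
  "dressed_coeffs e a P Q b C k v =
    (let D = block_diag P Q; U = block_up P Q; L = block_up Q P in
     if k = -2 then D (C (-2) v) + e *m (- U (C (-2) v)) + e *m (- L (C (-2) v)) else
     if k = -1 then D (C (-1) v) + e *m (- U (C (-1) v) - (2 / a) *m U (C (-2) v))
        + e *m (- L (C (-1) v) - (2 / - a) *m L (C (-2) v)) else
     if k = 0 then - b v + D (b v + C 0 v) + e *m (U (b v + C 0 v) + (2 * a) *m (U (C 1 v) + a *m U (C 2 v)))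
        + e *m (L (b v + C 0 v) + (2 * (- a)) *m (L (C 1 v) + (- a) *m L (C 2 v))) else
     if k = 1 then D (C 1 v) + e *m (U (C 1 v) + (2 * a) *m U (C 2 v)) + e *m (L (C 1 v) + (2 * (- a)) *m L (C 2 v)) else
     D (C 2 v) + e *m U (C 2 v) + e *m L (C 2 v))"

lemma laurent_dressed_coeffs:
  assumes a: "a \<noteq> 0" and x: "x \<noteq> 0" "x \<noteq> a" "x \<noteq> - a"
    and up: "block_up P Q (b v + laurent C a v) = 0" and lo: "block_up Q P (b v + laurent C (- a) v) = 0"
  shows "laurent (dressed_coeffs e a P Q b C) x v = - b v + block_diag P Q (b v + laurent C x v) +
    (e * (x + a) / (x - a)) *m block_up P Q (b v + laurent C x v) +
    (e * (x - a) / (x + a)) *m block_up Q P (b v + laurent C x v)"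
proof -
  have U: "block_up P Q (b v + laurent C y v) = inverse (y^2) *m block_up P Q (C (-2) v) +
     inverse y *m block_up P Q (C (-1) v) + block_up P Q (b v + C 0 v) + y *m block_up P Q (C 1 v) + y^2 *m block_up P Q (C 2 v)" for P Q y
    by (simp add: laurent_def block_linear)
  have D: "block_diag P Q (b v + laurent C y v) = inverse (y^2) *m block_diag P Q (C (-2) v) +
     inverse y *m block_diag P Q (C (-1) v) + block_diag P Q (b v + C 0 v) + y *m block_diag P Q (C 1 v) + y^2 *m block_diag P Q (C 2 v)" for y
    by (simp add: laurent_def block_linear)
  have e: "(e * z / w) *m X = e *m ((z / w) *m X)" for z w X by simp
  have na: "- a \<noteq> 0" "x - (- a) = x + a" "x + (- a) = x - a" using a by auto
  note s1 = shift_pole[OF a x(1,2) up[unfolded U]]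
  \<comment> \<open>The mirror blocks carry the inverse scalar, which is the same fraction with
    \<open>-a\<close> in place of \<open>a\<close>.\<close>
  note s2 = shift_pole[OF na(1) x(1) x(3) lo[unfolded U], unfolded na]
  show ?thesis
    unfolding e U s1 s2 D
    by (simp add: laurent_def dressed_coeffs_def Let_def mscale_ring vec_eq_iff algebra_simps)
qed

lemma block_minus:
  "block_diag P Q (- X) = - block_diag P Q X" "block_up P Q (- X) = - block_up P Q X"
  using block_linear(2)[of P Q "-1" X] block_linear(4)[of P Q "-1" X] by (simp_all add: minus_mscale)

text \<open>Dividing out the poles mixes index -1 only with -2 and index 1 only with 2, so types are
  kept.\<close>

lemma typed_dressed_coeffs: "typed C \<Longrightarrow> typed (dressed_coeffs e a P Q b C)"
  by (simp add: typed_def dressed_coeffs_def Let_def block_linear block_minus)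
     (simp add: vec_eq_iff right_diff_distrib distrib_left mult_ac)

lemma orthogonal_conj_skew:
  "adj X = - X \<Longrightarrow> adj (A ** X ** adj A) = - (A ** X ** adj A)"
  by (simp add: adj_simps mat_ring)

text \<open>For a sign, \<open>h\<close> and its inverse coincide and both off-diagonal groups are
  scaled alike. This is the situation at 0 and at infinity.\<close>

lemma null_fac_sign_conj:
  fixes P Q X :: "'k::finite cmat"
  assumes np: "null_pair P Q" and h: "h * h = 1" and z: "P ** (X ** Q) = 0" "Q ** (X ** P) = 0"
  shows "null_fac h P Q ** X ** adj (null_fac h P Q) = block_diag P Q X + h *m block_up P Q X + h *m block_up Q P X"
proof -
  have h0: "h \<noteq> 0" "inverse h = h" using h by (auto simp: inverse_unique)
  have "null_fac h P Q ** X = (block_diag P Q X + h *m block_up P Q X + h *m block_up Q P X) ** null_fac h P Q"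
    using block_conj[OF np h0(1) z] h0(2) by simp
  then show ?thesis
    using orthogonal_cancel(2)[OF null_fac_orthogonal[OF np h0(1)]] by (simp add: matrix_mul_assoc[symmetric])
qed

text \<open>The transformed form is \<open>(D ** Om - D') ** adj D\<close>, and
  \<open>D' ** adj D\<close> is skew because \<open>D\<close> stays orthogonal.\<close>

lemma gauge_skew:
  fixes D :: "'k::finite cmat"
  assumes D: "D \<in> orthogonal_maps" and D': "adj D' ** D + adj D ** D' = 0"
    and gauge: "D' = D ** Om - Om' ** D" and Om: "adj Om = - Om"
  shows "adj Om' = - Om'"
proof -
  note oc = orthogonal_cancel[OF D]
  have "Om' ** D = D ** Om - D'" using gauge by (simp add: algebra_simps)
  then have "Om' ** D ** adj D = (D ** Om - D') ** adj D" by simp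
  then have Om': "Om' = (D ** Om - D') ** adj D" by (simp add: matrix_mul_assoc[symmetric] oc)
  have "D ** (adj D' ** D + adj D ** D') ** adj D = 0" by (simp add: D')
  then have "D ** adj D' + D' ** adj D = 0" by (simp add: mat_ring oc)
  then have "D ** adj D' = - (D' ** adj D)" by (simp add: eq_neg_iff_add_eq_0)
  then show ?thesis unfolding Om' by (simp add: adj_simps Om mat_ring)
qed

text \<open>The gauges at \<open>x\<close> and \<open>-x\<close> are intertwined by the reflection
  near the point, so gauging preserves the symmetry. Primes on \<open>R\<close>, \<open>D\<close>,
  \<open>Dm\<close> are derivatives; on \<open>Om\<close>, \<open>Omm\<close> they mark the
  transformed forms.\<close>

lemma gauge_symmetric:
  fixes D :: "'k::finite cmat"
  assumes R: "involution R" and R': "R' ** R + R ** R' = 0"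
    and DR: "R ** D = Dm ** R" and dDR: "R' ** D + R ** D' = Dm' ** R + Dm ** R'"
    and D: "D ** Di = mat 1"
    and gauge: "D' = D ** Om - Om' ** D" "Dm' = Dm ** Omm - Omm' ** Dm"
    and sym: "R ** Om ** R + R ** R' = Omm"
  shows "R ** Om' ** R + R ** R' = Omm'"
proof -
  have RR: "R ** R = mat 1" "R ** (R ** X) = X" for X by (rule involution_cancel[OF R])+
  have R'R: "R' ** R = - (R ** R')" "R' ** (R ** X) = - (R ** (R' ** X))" for X
    using R' by (simp_all add: eq_neg_iff_add_eq_0 matrix_mul_assoc mat_mult_add_left[symmetric])
  have Dm: "Dm = R ** D ** R" using DR by (simp add: matrix_mul_assoc[symmetric] RR)
  have "Dm' ** R = R' ** D + R ** D' - Dm ** R'" using dDR by (simp add: algebra_simps)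
  then have "Dm' ** R ** R = (R' ** D + R ** D' - Dm ** R') ** R" by simp
  then have Dm': "Dm' = (R' ** D + R ** D' - Dm ** R') ** R" by (simp add: matrix_mul_assoc[symmetric] RR)
  have "Omm' ** Dm = Dm ** Omm - Dm'" using gauge(2) by (simp add: algebra_simps)
  then have "Omm' ** Dm ** R ** Di ** R = (Dm ** Omm - Dm') ** R ** Di ** R" by simp
  then have 1: "Omm' = (Dm ** Omm - Dm') ** R ** Di ** R"
    unfolding Dm by (simp add: mat_ring RR D)
  have Di: "D ** (Di ** X) = X" for X by (simp add: matrix_mul_assoc D)
  show ?thesis
    unfolding 1 Dm' sym[symmetric] gauge(1) Dm
    supply [[simproc del: int_combine_numerals]]
    by (simp add: mat_ring RR R'R D Di)
qed

section \<open>Derivatives at a point of a chart\<close>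

locale chart_point =
  fixes \<A> :: "'m::topological_space chart set" and c :: "'m chart" and p :: 'm
  assumes atlas: "conformal_atlas \<A>" and chart: "c \<in> \<A>" and pt: "p \<in> fst c"
begin

abbreviation der :: "('m \<Rightarrow> 'v::real_normed_vector) \<Rightarrow> (complex \<Rightarrow> 'v) \<Rightarrow> bool" where
  "der \<equiv> chart_deriv c p"

lemma pt_points: "p \<in> points \<A>"
  using chart_subset[OF atlas chart] pt by blast

lemma der_mult:
  fixes F G :: "'m \<Rightarrow> 'k::finite cmat"
  shows "der F F' \<Longrightarrow> der G G' \<Longrightarrow> der (\<lambda>x. F x ** G x) (\<lambda>v. F' v ** G p + F p ** G' v)"
  by (rule chart_deriv_bilinear[OF atlas chart pt bounded_bilinear_mat_mult])

lemma der_mult_vec: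
  fixes F :: "'m \<Rightarrow> 'k::finite cmat"
  shows "der F F' \<Longrightarrow> der s s' \<Longrightarrow> der (\<lambda>x. F x *v s x) (\<lambda>v. F' v *v s p + F p *v s' v)"
  by (rule chart_deriv_bilinear[OF atlas chart pt bounded_bilinear_mat_vec])

lemma der_cong:
  assumes "open W" "p \<in> W" "\<And>x. x \<in> W \<Longrightarrow> f x = g x" "der f f'"
  shows "der g f'"
  by (rule chart_deriv_cong[OF atlas chart assms(1) pt assms(2) _ assms(4)]) (rule assms(3))

text \<open>Turns an identity that holds near \<open>p\<close> into one between derivative values at
  \<open>p\<close>; all the differentiated relations are obtained in this way.\<close>

lemma der_eq:
  assumes "open W" "p \<in> W" "\<And>x. x \<in> W \<Longrightarrow> f x = g x" "der f f'" "der g g'"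
  shows "f' v = g' v"
  using chart_deriv_unique[OF der_cong[OF assms(1-4)] assms(5)] by simp

lemma der_odd: "der f f' \<Longrightarrow> f' (- v) = - f' v"
  by (rule linear_neg[OF chart_deriv_real_linear])

lemma involution_der:
  fixes R :: "'m \<Rightarrow> 'k::finite cmat"
  assumes "open W" "p \<in> W" "\<And>x. x \<in> W \<Longrightarrow> involution (R x)" "der R R'"
  shows "R' v ** R p + R p ** R' v = 0" "adj (R' v) = R' v"
proof -
  show "R' v ** R p + R p ** R' v = 0"
    by (rule der_eq[OF assms(1,2) _ der_mult[OF assms(4,4)] chart_deriv_const])
       (use assms(3) in \<open>auto simp: involution_def\<close>)
  show "adj (R' v) = R' v"
    by (rule der_eq[OF assms(1,2) _ chart_deriv_adj[OF assms(4)] assms(4)])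
       (use assms(3) in \<open>auto simp: involution_def\<close>)
qed

lemma orthogonal_der:
  fixes D :: "'m \<Rightarrow> 'k::finite cmat"
  assumes "open W" "p \<in> W" "\<And>x. x \<in> W \<Longrightarrow> D x \<in> orthogonal_maps" "der D D'"
  shows "adj (D' v) ** D p + adj (D p) ** D' v = 0"
  by (rule der_eq[OF assms(1,2) _ der_mult[OF chart_deriv_adj[OF assms(4)] assms(4)] chart_deriv_const])
     (use assms(3) in \<open>auto simp: orthogonal_maps_adj\<close>)

lemma null_pair_der:
  fixes P Q :: "'m \<Rightarrow> 'k::finite cmat"
  assumes W: "open W" "p \<in> W" and np: "\<And>x. x \<in> W \<Longrightarrow> null_pair (P x) (Q x)"
    and d: "der P P'" "der Q Q'"
  shows "pair_deriv (P p) (Q p) (P' v) (Q' v)"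
  unfolding pair_deriv_def
proof (intro conjI)
  note np = np[unfolded null_pair_def]
  show "P' v ** P p + P p ** P' v = P' v" by (rule der_eq[OF W _ der_mult[OF d(1,1)] d(1)]) (simp add: np)
  show "Q' v ** Q p + Q p ** Q' v = Q' v" by (rule der_eq[OF W _ der_mult[OF d(2,2)] d(2)]) (simp add: np)
  show "P' v ** Q p + P p ** Q' v = 0" by (rule der_eq[OF W _ der_mult[OF d(1,2)] chart_deriv_const]) (simp add: np)
  show "Q' v ** P p + Q p ** P' v = 0" by (rule der_eq[OF W _ der_mult[OF d(2,1)] chart_deriv_const]) (simp add: np)
  show "adj (P' v) = Q' v" by (rule der_eq[OF W _ chart_deriv_adj[OF d(1)] d(2)]) (simp add: np)
  show "adj (Q' v) = P' v" by (rule der_eq[OF W _ chart_deriv_adj[OF d(2)] d(1)]) (simp add: np)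
qed

text \<open>The last clause says that the factor gauges the family of \<open>C\<close> into that of
  \<open>C'\<close>. The two end coefficients are recorded because they become the multiplier. The
  set \<open>G\<close> loses the two parameters at which the factor degenerates.\<close>

lemma dressing_step:
  fixes R :: "'m \<Rightarrow> 'k::finite cmat"
  assumes W: "open W" "p \<in> W" and sR: "smooth_map_on \<A> W R" and ss: "smooth_map_on \<A> W s"
    and R: "\<And>x. x \<in> W \<Longrightarrow> involution (R x)" and s: "\<And>x. x \<in> W \<Longrightarrow> frame_vec (R x) (s x)"
    and R': "der R R'" and s': "der s s'"
    and C: "symmetric_family (R p) R' C G" and a: "a \<in> G" and e: "e * e = 1"
    and par: "\<And>v. \<exists>k. s' v + laurent C a v *v s p = k *s s p"
  obtains C' where "symmetric_family (R p) R' C' (G - {a, - a})"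
    "\<And>v. C' (-2) v = dress (R p) e a (s p) (Fin 0) ** C (-2) v ** adj (dress (R p) e a (s p) (Fin 0))"
    "\<And>v. C' 2 v = dress (R p) e a (s p) Infty ** C 2 v ** adj (dress (R p) e a (s p) Infty)"
    "\<And>x. x \<in> G - {a, - a} \<Longrightarrow> der (\<lambda>y. dress (R y) e a (s y) (Fin x))
       (\<lambda>v. dress (R p) e a (s p) (Fin x) ** laurent C x v - laurent C' x v ** dress (R p) e a (s p) (Fin x))"
proof -
  define P where "P y = line_proj (s y) (R y *v s y)" for y
  define Q where "Q y = line_proj (R y *v s y) (s y)" for y
  have sm: "smooth_map_on \<A> W (\<lambda>y. R y *v s y)" by (intro smooth_mult_vec atlas W sR ss)
  have "smooth_map_on \<A> W P" "smooth_map_on \<A> W Q"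
    unfolding P_def Q_def using s
    by (auto intro!: smooth_line_proj[OF atlas W(1)] sm ss simp: frame_vec_def mink_commute)
  then obtain P' Q' where P': "der P P'" and Q': "der Q Q'"
    using chart_deriv_exists[OF _ chart pt W(2)] by metis
  have np: "null_pair (P y) (Q y)" if "y \<in> W" for y
    unfolding P_def Q_def using that by (intro frame_vec_null_pair R s)
  note npp = np[OF W(2)]
  note pd = null_pair_der[OF W np P' Q']
  define b where "b v = block_beta (P p) (Q p) (P' v) (Q' v)" for v
  have bp: "b v ** P p - P p ** b v = P' v" "b v ** Q p - Q p ** b v = Q' v" "adj (b v) = - b v" for v
    using block_beta_props[OF npp pd[of v]] by (simp_all only: b_def)
  define C' where "C' = dressed_coeffs e a (P p) (Q p) b C"
  have G: "x \<noteq> 0" "- x \<in> G" if "x \<in> G" for x using C that by (auto simp: symmetric_family_def)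
  have skew: "adj (laurent C x v) = - laurent C x v" if "x \<in> G" for x v
    using C that by (auto simp: symmetric_family_def)
  have sym: "R p ** laurent C x v ** R p + R p ** R' v = laurent C (- x) v" if "x \<in> G" for x v
    using C that by (auto simp: symmetric_family_def)
  have a0: "a \<noteq> 0" using G a by blast
  have e0: "e \<noteq> 0" "inverse e = e" using e by (auto simp: inverse_unique)
  have Rp: "involution (R p)" using R W by blast
  note R'p = involution_der[OF W R R']
  have z: "P p ** (X ** Q p) = 0" "Q p ** (X ** P p) = 0" if "adj X = - X" for X
    unfolding P_def Q_def by (rule line_proj_skew[OF that])+
  have zs: "P p ** ((b v + laurent C x v) ** Q p) = 0" "Q p ** ((b v + laurent C x v) ** P p) = 0" if "x \<in> G" for x v
    by (rule z; simp add: adj_simps bp skew[OF that])+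
  have Bskew: "adj (b v + laurent C x v) = - (b v + laurent C x v)" if "x \<in> G" for x v
    by (simp add: adj_simps bp skew[OF that])
  have adjP: "adj (P p) = Q p" "adj (Q p) = P p" using npp by (simp_all add: null_pair_def)
  have adjE: "adj (mat 1 - P p - Q p) = mat 1 - P p - Q p"
    using npp by (simp add: null_pair_def adj_simps)
  have up: "block_up (P p) (Q p) (b v + laurent C a v) = 0" for v
  proof -
    obtain k where k: "s' v + laurent C a v *v s p = k *s s p" using par by blast
    have Ps: "P x *v s x = s x" "Q x *v s x = 0" if "x \<in> W" for x
      using s[OF that] by (simp_all add: P_def Q_def line_proj_vec frame_vec_def)
    have "P' v *v s p + P p *v s' v = s' v" "Q' v *v s p + Q p *v s' v = 0"
      by (rule der_eq[OF W _ der_mult_vec[OF P' s'] s'], simp add: Ps)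
         (rule der_eq[OF W _ der_mult_vec[OF Q' s'] chart_deriv_const], simp add: Ps)
    moreover have "\<exists>c. P p *v w = c *s s p" for w by (auto simp: P_def line_proj_vec)
    ultimately have 1: "(mat 1 - P p - Q p) ** (b v + laurent C a v) ** P p = 0"
      unfolding b_def by (intro parallel_block[OF npp _ _ _ _ k]) (use Ps W in auto)
    \<comment> \<open>The second summand of \<open>block_up\<close> is minus the adjoint of the
      first.\<close>
    have "adj ((mat 1 - P p - Q p) ** (b v + laurent C a v) ** P p) = - (Q p ** (b v + laurent C a v) ** (mat 1 - P p - Q p))"
      by (simp only: adj_mult adjE Bskew[OF a] adjP mat_mult_minus_left mat_mult_minus_right matrix_mul_assoc)
    then have "Q p ** (b v + laurent C a v) ** (mat 1 - P p - Q p) = 0" unfolding 1 by simp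
    with 1 show ?thesis by (simp add: block_up_def)
  qed
  have lo: "block_up (Q p) (P p) (b v + laurent C (- a) v) = 0" for v
  proof -
    obtain k where k: "s' v + laurent C a v *v s p = k *s s p" using par by blast
    let ?m = "\<lambda>x. R x *v s x" and ?m' = "\<lambda>v. R' v *v s p + R p *v s' v"
    have m': "der ?m ?m'" by (rule der_mult_vec[OF R' s'])
    have mm: "mink (?m x) (?m x) = 0" if "x \<in> W" for x
      using s[OF that] involution_cancel(5)[OF R[OF that]] by (auto simp: frame_vec_def orthogonal_maps_def)
    have Qm: "Q x *v ?m x = ?m x" "P x *v ?m x = 0" if "x \<in> W" for x
      using s[OF that] mm[OF that] by (simp_all add: P_def Q_def line_proj_vec frame_vec_def mink_commute)
    have "Q' v *v ?m p + Q p *v ?m' v = ?m' v" "P' v *v ?m p + P p *v ?m' v = 0"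
      by (rule der_eq[OF W _ der_mult_vec[OF Q' m'] m'], simp add: Qm)
         (rule der_eq[OF W _ der_mult_vec[OF P' m'] chart_deriv_const], simp add: Qm)
    moreover have "\<exists>c. Q p *v w = c *s ?m p" for w by (auto simp: Q_def line_proj_vec)
    \<comment> \<open>The reflection carries the connection at \<open>a\<close> to the one at
      \<open>-a\<close>, so the reflected generator is parallel there up to the same factor
      \<open>k\<close>.\<close>
    moreover have "?m' v + laurent C (- a) v *v ?m p = k *s ?m p"
    proof -
      have R'R: "R p *v (R' v *v (R p *v w)) = - (R' v *v w)" for w
      proof -
        have "R p ** R' v ** R p = (R p ** R' v + R' v ** R p) ** R p - R' v ** (R p ** R p)"
          by (simp add: mat_ring)
        also have "R p ** R' v + R' v ** R p = 0" using R'p(1)[of v] by (simp add: add.commute)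
        finally have "R p ** R' v ** R p = - R' v" by (simp add: involution_cancel[OF Rp])
        then show ?thesis by (metis matrix_vector_mul_assoc minus_mat_vec)
      qed
      have "?m' v + laurent C (- a) v *v ?m p = R p *v (s' v + laurent C a v *v s p)"
        unfolding sym[OF a, symmetric] by (simp add: mat_vec_ring R'R involution_cancel[OF Rp])
      then show ?thesis by (simp add: k mult_vec_scale)
    qed
    ultimately have 1: "(mat 1 - Q p - P p) ** (b v + laurent C (- a) v) ** Q p = 0"
      unfolding b_def block_beta_swap[of "P p" "Q p"]
      by (intro parallel_block[of "Q p" "P p"]) (use npp Qm W in \<open>auto simp: null_pair_def\<close>)
    have E: "mat 1 - Q p - P p = mat 1 - P p - Q p" by simp
    have "adj ((mat 1 - P p - Q p) ** (b v + laurent C (- a) v) ** Q p) = - (P p ** (b v + laurent C (- a) v) ** (mat 1 - P p - Q p))"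
      by (simp only: adj_mult adjE Bskew[OF G(2)[OF a]] adjP mat_mult_minus_left mat_mult_minus_right matrix_mul_assoc)
    then have "P p ** (b v + laurent C (- a) v) ** (mat 1 - P p - Q p) = 0" using 1 unfolding E by simp
    with 1 show ?thesis by (simp add: block_up_def E)
  qed
  let ?D = "\<lambda>x y. dress (R y) e a (s y) (Fin x)"
  have Dorth: "?D x y \<in> orthogonal_maps" if "x \<in> G - {a, - a}" "y \<in> W" for x y
    using that by (intro dress_orthogonal R s e0) auto
  have gauge: "der (?D x) (\<lambda>v. ?D x p ** laurent C x v - laurent C' x v ** ?D x p)"
    if x: "x \<in> G - {a, - a}" for x
  proof -
    define f where "f = simple_pole e a (Fin x)"
    have x': "x \<in> G" "x \<noteq> 0" "x \<noteq> a" "x \<noteq> - a" using x G by auto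
    have f0: "f \<noteq> 0" unfolding f_def using x' e0 by (intro simple_pole_nonzero) auto
    have finv: "f = e * (x - a) / (x + a)" "inverse f = e * (x + a) / (x - a)"
      unfolding f_def using e0 by (simp_all add: divide_inverse inverse_mult_distrib mult_ac)
    have D: "?D x y = null_fac f (P y) (Q y)" for y by (simp add: dress_def P_def Q_def f_def)
    have "der (?D x) (\<lambda>v. f *m P' v + (0 - P' v - Q' v) + inverse f *m Q' v)"
      unfolding D null_fac_def
      by (intro chart_deriv_add chart_deriv_diff chart_deriv_mscale P' Q' chart_deriv_const)
    moreover have "f *m P' v + (0 - P' v - Q' v) + inverse f *m Q' v =
        ?D x p ** laurent C x v - laurent C' x v ** ?D x p" for v
    proof -
      \<comment> \<open>The new form is the conjugate of \<open>b + laurent C x\<close> minus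
        \<open>b\<close>, so the gauge equation reduces to the factor's derivative being its
        commutator with \<open>b\<close>.\<close>
      have "laurent C' x v = - b v + (block_diag (P p) (Q p) (b v + laurent C x v) +
        inverse f *m block_up (P p) (Q p) (b v + laurent C x v) + f *m block_up (Q p) (P p) (b v + laurent C x v))"
        using laurent_dressed_coeffs[where b = b and C = C and v = v and e = e, OF a0 x'(2-4) up lo]
        by (simp only: finv[symmetric] C'_def add.assoc)
      then have "laurent C' x v ** ?D x p = - (b v ** ?D x p) + ?D x p ** (b v + laurent C x v)"
        using block_conj[OF npp f0 zs[OF x'(1)], of v]
        by (simp only: D mat_mult_add_left[of "- b v"] mat_mult_minus_left)
      then have "?D x p ** laurent C x v - laurent C' x v ** ?D x p = b v ** ?D x p - ?D x p ** b v"
        by (simp add: mat_ring)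
      also have "\<dots> = f *m (b v ** P p - P p ** b v) + (0 - (b v ** P p - P p ** b v) - (b v ** Q p - Q p ** b v))
          + inverse f *m (b v ** Q p - Q p ** b v)"
        by (simp add: D null_fac_def mat_ring mscale_ring algebra_simps)
      finally show ?thesis by (simp add: bp)
    qed
    ultimately show ?thesis by simp
  qed
  have sgn: "simple_pole e a (Fin 0) = - e" "simple_pole e a Infty = e" using a0 by auto
  have ends: "C' (-2) v = dress (R p) e a (s p) (Fin 0) ** C (-2) v ** adj (dress (R p) e a (s p) (Fin 0))"
    "C' 2 v = dress (R p) e a (s p) Infty ** C 2 v ** adj (dress (R p) e a (s p) Infty)" for v
  proof -
    have Cs: "adj (C (-2) v) = - C (-2) v" "adj (C 2 v) = - C 2 v" using C by (auto simp: symmetric_family_def)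
    have "(- e) * (- e) = 1" using e by simp
    from null_fac_sign_conj[OF npp this z[OF Cs(1)]] null_fac_sign_conj[OF npp e z[OF Cs(2)]]
    show "C' (-2) v = dress (R p) e a (s p) (Fin 0) ** C (-2) v ** adj (dress (R p) e a (s p) (Fin 0))"
      "C' 2 v = dress (R p) e a (s p) Infty ** C 2 v ** adj (dress (R p) e a (s p) Infty)"
      unfolding dress_def sgn P_def[symmetric] Q_def[symmetric]
      by (simp_all add: C'_def dressed_coeffs_def Let_def mscale_ring)
  qed
  have "symmetric_family (R p) R' C' (G - {a, - a})"
    unfolding symmetric_family_def
  proof (intro conjI allI ballI)
    show "typed C'" unfolding C'_def using C by (intro typed_dressed_coeffs) (simp add: symmetric_family_def)
    show "adj (C' 2 v) = - C' 2 v" "adj (C' (-2) v) = - C' (-2) v" for v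
      unfolding ends by (rule orthogonal_conj_skew; use C in \<open>simp add: symmetric_family_def\<close>)+
    fix x assume x: "x \<in> G - {a, - a}"
    then show "x \<noteq> 0" using G by blast
    show mx: "- x \<in> G - {a, - a}" using x G by auto
    fix v
    show "adj (laurent C' x v) = - laurent C' x v"
      by (rule gauge_skew[OF Dorth[OF x W(2)] orthogonal_der[OF W Dorth[OF x] gauge[OF x]] refl skew])
         (use x in auto)
    \<comment> \<open>Stated on all of \<open>W\<close>, since this intertwining has to be
      differentiated.\<close>
    have DR: "R y ** ?D x y = ?D (- x) y ** R y" if "y \<in> W" for y
      using dress_reflect[OF R[OF that] e, of a "s y" x, symmetric] involution_cancel(1)[OF R[OF that]]
      by (simp add: matrix_mul_assoc[symmetric])
    show "R p ** laurent C' x v ** R p + R p ** R' v = laurent C' (- x) v"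
      by (rule gauge_symmetric[OF Rp R'p(1) DR[OF W(2)]
            der_eq[OF W DR der_mult[OF R' gauge[OF x]] der_mult[OF gauge[OF mx] R']]
            orthogonal_cancel(2)[OF Dorth[OF x W(2)]] refl refl sym])
         (use x in auto)
  qed
  then show thesis using that ends gauge by blast
qed

end

text \<open>The gauge \<open>rstar\<close> on spanning vectors \<open>s\<close>, \<open>t\<close> of
  the two lines. The inner factor at \<alpha> moves \<open>s\<close> into the line that the second
  factor uses.\<close>

definition two_dress :: "'k::finite cmat \<Rightarrow> complex \<Rightarrow> complex \<Rightarrow> 'k cvec \<Rightarrow> 'k cvec \<Rightarrow> csphere \<Rightarrow> 'k cmat" where
  "two_dress R \<alpha> \<beta> s t \<mu> = dress R (-1) \<alpha> (dress R 1 \<beta> t (Fin \<alpha>) *v s) \<mu> ** dress R 1 \<beta> t \<mu>"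

definition dress_frames :: "'k::finite cmat \<Rightarrow> complex \<Rightarrow> complex \<Rightarrow> 'k cvec \<Rightarrow> 'k cvec \<Rightarrow> bool" where
  "dress_frames R \<alpha> \<beta> s t \<longleftrightarrow> involution R \<and> frame_vec R s \<and> frame_vec R t \<and>
     frame_vec R (dress R 1 \<beta> t (Fin \<alpha>) *v s) \<and> frame_vec R (dress R 1 \<alpha> s (Fin \<beta>) *v t)"

lemma two_dress_orthogonal:
  "dress_frames R \<alpha> \<beta> s t \<Longrightarrow> admissible \<alpha> \<mu> \<Longrightarrow> admissible \<beta> \<mu> \<Longrightarrow> two_dress R \<alpha> \<beta> s t \<mu> \<in> orthogonal_maps"
  unfolding two_dress_def dress_frames_def by (intro orthogonal_maps_mult dress_orthogonal) auto

lemma conj_mult: "A \<in> orthogonal_maps \<Longrightarrow> A ** (X ** Y) ** adj A = (A ** X ** adj A) ** (A ** Y ** adj A)"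
  by (simp add: mat_ring orthogonal_cancel)

lemma dress_conj_vec:
  assumes "A \<in> orthogonal_maps"
  shows "dress (A ** R ** adj A) e a (A *v s) \<mu> *v (A *v w) = A *v (dress R e a s \<mu> *v w)"
  unfolding dress_conj[OF assms, symmetric] by (simp add: mat_vec_ring orthogonal_cancel[OF assms])

lemma two_dress_conj:
  assumes "A \<in> orthogonal_maps"
  shows "A ** two_dress R \<alpha> \<beta> s t \<mu> ** adj A = two_dress (A ** R ** adj A) \<alpha> \<beta> (A *v s) (A *v t) \<mu>"
  unfolding two_dress_def conj_mult[OF assms] dress_conj[OF assms] dress_conj_vec[OF assms] ..

text \<open>Fixes 0 and infinity, so the values of the gauge acting on the two subbundles of a
  surface do not involve the spectral parameter.\<close>

fun sphere_scale :: "complex \<Rightarrow> csphere \<Rightarrow> csphere" where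
  "sphere_scale l (Fin x) = Fin (l * x)"
| "sphere_scale l Infty = Infty"

lemma dress_sphere_scale: "l \<noteq> 0 \<Longrightarrow> dress R e (a / l) s \<mu> = dress R e a s (sphere_scale l \<mu>)"
  by (cases \<mu>) (simp_all add: dress_scale)

lemma two_dress_scale:
  "l \<noteq> 0 \<Longrightarrow> two_dress R (\<alpha> / l) (\<beta> / l) s t \<mu> = two_dress R \<alpha> \<beta> s t (sphere_scale l \<mu>)"
  by (simp add: two_dress_def dress_sphere_scale)

lemma frame_vec_conj:
  "A \<in> orthogonal_maps \<Longrightarrow> frame_vec (A ** R ** adj A) (A *v s) \<longleftrightarrow> frame_vec R s"
  by (simp add: frame_vec_def mat_vec_ring orthogonal_cancel) (simp add: orthogonal_maps_def)

context chart_point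
begin

text \<open>The second factor acts on the family already dressed by the first. Its line is parallel
  for that family because the first factor, taken at \<alpha>, is a gauge transformation of the
  connection at \<alpha>.\<close>

lemma two_dressing:
  fixes R :: "'m \<Rightarrow> 'k::finite cmat"
  assumes W: "open W" "p \<in> W" and sR: "smooth_map_on \<A> W R"
    and ss: "smooth_map_on \<A> W s" and st: "smooth_map_on \<A> W t"
    and fr: "\<And>x. x \<in> W \<Longrightarrow> dress_frames (R x) \<alpha> \<beta> (s x) (t x)"
    and R': "der R R'" and s': "der s s'" and t': "der t t'"
    and C: "symmetric_family (R p) R' C (- {0})" and nz: "\<alpha> \<noteq> 0" "\<beta> \<noteq> 0" "\<beta> \<noteq> \<alpha>" "\<beta> \<noteq> - \<alpha>"
    and par: "\<And>v. \<exists>k. s' v + laurent C \<alpha> v *v s p = k *s s p" "\<And>v. \<exists>k. t' v + laurent C \<beta> v *v t p = k *s t p"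
  defines "r \<equiv> \<lambda>\<mu> x. two_dress (R x) \<alpha> \<beta> (s x) (t x) \<mu>"
  obtains C' where "symmetric_family (R p) R' C' (- {0, \<alpha>, - \<alpha>, \<beta>, - \<beta>})"
    "\<And>v. C' (-2) v = r (Fin 0) p ** C (-2) v ** adj (r (Fin 0) p)"
    "\<And>v. C' 2 v = r Infty p ** C 2 v ** adj (r Infty p)"
    "\<And>x. x \<notin> {0, \<alpha>, - \<alpha>, \<beta>, - \<beta>} \<Longrightarrow>
       der (r (Fin x)) (\<lambda>v. r (Fin x) p ** laurent C x v - laurent C' x v ** r (Fin x) p)"
proof -
  have fr': "involution (R x)" "frame_vec (R x) (t x)" "frame_vec (R x) (dress (R x) 1 \<beta> (t x) (Fin \<alpha>) *v s x)"
    if "x \<in> W" for x using fr[OF that] by (auto simp: dress_frames_def)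
  obtain C1 where C1: "symmetric_family (R p) R' C1 (- {0} - {\<beta>, - \<beta>})"
    "\<And>v. C1 (-2) v = dress (R p) 1 \<beta> (t p) (Fin 0) ** C (-2) v ** adj (dress (R p) 1 \<beta> (t p) (Fin 0))"
    "\<And>v. C1 2 v = dress (R p) 1 \<beta> (t p) Infty ** C 2 v ** adj (dress (R p) 1 \<beta> (t p) Infty)"
    "\<And>x. x \<in> - {0} - {\<beta>, - \<beta>} \<Longrightarrow> der (\<lambda>y. dress (R y) 1 \<beta> (t y) (Fin x))
       (\<lambda>v. dress (R p) 1 \<beta> (t p) (Fin x) ** laurent C x v - laurent C1 x v ** dress (R p) 1 \<beta> (t p) (Fin x))"
    by (rule dressing_step[OF W sR st fr'(1,2) R' t' C _ _ par(2), of 1]) (use nz in auto)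
  define u where "u x = dress (R x) 1 \<beta> (t x) (Fin \<alpha>) *v s x" for x
  have \<alpha>: "\<alpha> \<in> - {0} - {\<beta>, - \<beta>}" using nz by auto
  define D where "D = dress (R p) 1 \<beta> (t p) (Fin \<alpha>)"
  define u' where "u' v = (D ** laurent C \<alpha> v - laurent C1 \<alpha> v ** D) *v s p + D *v s' v" for v
  have u': "der u u'"
    using der_mult_vec[OF C1(4)[OF \<alpha>] s'] by (simp add: u_def[abs_def] u'_def[abs_def] D_def)
  have su: "smooth_map_on \<A> W u"
    unfolding u_def by (intro smooth_mult_vec smooth_dress atlas W sR st ss fr')
  have paru: "\<exists>k. u' v + laurent C1 \<alpha> v *v u p = k *s u p" for v
  proof -
    obtain k where k: "s' v + laurent C \<alpha> v *v s p = k *s s p" using par by blast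
    have "u' v + laurent C1 \<alpha> v *v u p = D *v (s' v + laurent C \<alpha> v *v s p)"
      by (simp add: u'_def u_def D_def[symmetric] mat_vec_ring)
    then show ?thesis unfolding k by (auto simp: mult_vec_scale u_def D_def)
  qed
  obtain C2 where C2: "symmetric_family (R p) R' C2 (- {0} - {\<beta>, - \<beta>} - {\<alpha>, - \<alpha>})"
    "\<And>v. C2 (-2) v = dress (R p) (-1) \<alpha> (u p) (Fin 0) ** C1 (-2) v ** adj (dress (R p) (-1) \<alpha> (u p) (Fin 0))"
    "\<And>v. C2 2 v = dress (R p) (-1) \<alpha> (u p) Infty ** C1 2 v ** adj (dress (R p) (-1) \<alpha> (u p) Infty)"
    "\<And>x. x \<in> - {0} - {\<beta>, - \<beta>} - {\<alpha>, - \<alpha>} \<Longrightarrow> der (\<lambda>y. dress (R y) (-1) \<alpha> (u y) (Fin x))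
       (\<lambda>v. dress (R p) (-1) \<alpha> (u p) (Fin x) ** laurent C1 x v - laurent C2 x v ** dress (R p) (-1) \<alpha> (u p) (Fin x))"
    by (rule dressing_step[OF W sR su fr'(1) fr'(3)[folded u_def] R' u' C1(1) \<alpha> _ paru, of "-1"]) auto
  show thesis
  proof
    have "- {0} - {\<beta>, - \<beta>} - {\<alpha>, - \<alpha>} = - {0, \<alpha>, - \<alpha>, \<beta>, - \<beta>}" by auto
    with C2(1) show "symmetric_family (R p) R' C2 (- {0, \<alpha>, - \<alpha>, \<beta>, - \<beta>})" by simp
    show "C2 (-2) v = r (Fin 0) p ** C (-2) v ** adj (r (Fin 0) p)" "C2 2 v = r Infty p ** C 2 v ** adj (r Infty p)" for v
      by (simp_all add: C1 C2 r_def two_dress_def u_def adj_simps matrix_mul_assoc)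
    fix x assume x: "x \<notin> {0, \<alpha>, - \<alpha>, \<beta>, - \<beta>}"
    have "der (\<lambda>y. dress (R y) (-1) \<alpha> (u y) (Fin x) ** dress (R y) 1 \<beta> (t y) (Fin x))
       (\<lambda>v. (dress (R p) (-1) \<alpha> (u p) (Fin x) ** laurent C1 x v - laurent C2 x v ** dress (R p) (-1) \<alpha> (u p) (Fin x))
              ** dress (R p) 1 \<beta> (t p) (Fin x) +
            dress (R p) (-1) \<alpha> (u p) (Fin x) **
              (dress (R p) 1 \<beta> (t p) (Fin x) ** laurent C x v - laurent C1 x v ** dress (R p) 1 \<beta> (t p) (Fin x)))"
      by (rule der_mult[OF C2(4) C1(4)]) (use x in auto)
    then show "der (r (Fin x)) (\<lambda>v. r (Fin x) p ** laurent C x v - laurent C2 x v ** r (Fin x) p)"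
      by (simp add: r_def[abs_def] two_dress_def u_def[symmetric] mat_ring)
  qed
qed

end

section \<open>Connection forms of non-degenerate bundles\<close>

text \<open>A form of smooth nondegenerate bundle that passes directly to images under smooth
  orthogonal maps, since projections and reflections are conjugated.\<close>

definition good_bundle :: "'m::topological_space chart set \<Rightarrow> ('m, 'k::finite) vbundle \<Rightarrow> bool" where
  "good_bundle \<A> V \<longleftrightarrow> (\<forall>p\<in>points \<A>. \<exists>M. ortho_proj (V p) M) \<and>
     smooth_map_on \<A> (points \<A>) (\<lambda>p. reflection (V p))"

lemma good_bundle_subbundle:
  assumes "conformal_atlas \<A>" "subbundle \<A> k V" "nondeg_bundle \<A> V"
  shows "good_bundle \<A> V"
proof -
  obtain M where M: "\<And>p. p \<in> points \<A> \<Longrightarrow> ortho_proj (V p) (M p)" "smooth_map_on \<A> (points \<A>) M"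
    by (rule bundle_projection[OF assms]) auto
  have "smooth_map_on \<A> (points \<A>) (\<lambda>p. 2 *m M p - mat 1)"
    by (intro smooth_diff smooth_mscale smooth_const assms open_points M)
  then have "smooth_map_on \<A> (points \<A>) (\<lambda>p. reflection (V p))"
    by (rule smooth_cong[OF assms(1) open_points[OF assms(1)], rotated]) (use M ortho_proj_proj in metis)
  then show ?thesis using M unfolding good_bundle_def by blast
qed

definition smooth_orthogonal :: "'m::topological_space chart set \<Rightarrow> ('m \<Rightarrow> 'k::finite cmat) \<Rightarrow> bool" where
  "smooth_orthogonal \<A> g \<longleftrightarrow> smooth_map_on \<A> (points \<A>) g \<and> (\<forall>p\<in>points \<A>. g p \<in> orthogonal_maps)"

lemma reflection_map_bundle:
  assumes "good_bundle \<A> V" "smooth_orthogonal \<A> g" "p \<in> points \<A>"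
  shows "reflection (map_bundle g V p) = g p ** reflection (V p) ** adj (g p)"
  using assms by (auto simp: good_bundle_def smooth_orthogonal_def map_bundle_def reflection_map)

lemma good_bundle_map:
  assumes "conformal_atlas \<A>" "good_bundle \<A> V" "smooth_orthogonal \<A> g"
  shows "good_bundle \<A> (map_bundle g V)"
  unfolding good_bundle_def
proof
  show "\<forall>p\<in>points \<A>. \<exists>M. ortho_proj (map_bundle g V p) M"
    using assms unfolding good_bundle_def smooth_orthogonal_def map_bundle_def by (metis ortho_proj_map)
  have "smooth_map_on \<A> (points \<A>) (\<lambda>p. g p ** reflection (V p) ** adj (g p))"
    using assms by (intro smooth_mult smooth_adj assms open_points) (auto simp: good_bundle_def smooth_orthogonal_def)
  then show "smooth_map_on \<A> (points \<A>) (\<lambda>p. reflection (map_bundle g V p))"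
    by (rule smooth_cong[OF assms(1) open_points[OF assms(1)], rotated]) (simp add: reflection_map_bundle[OF assms(2,3)])
qed

definition chart_frechet :: "('m \<Rightarrow> 'v::real_normed_vector) \<Rightarrow> 'm chart \<Rightarrow> 'm \<Rightarrow> complex \<Rightarrow> 'v" where
  "chart_frechet f c p = frechet_derivative (f \<circ> chart_inv c) (at (snd c p))"

lemma chart_frechet_eq: "chart_deriv c p f f' \<Longrightarrow> chart_frechet f c p = f'"
  unfolding chart_deriv_def chart_frechet_def by (metis frechet_derivative_at)

definition conn_form :: "('m, 'k::finite) vbundle \<Rightarrow> ('m, 'k cmat) form1 \<Rightarrow> complex \<Rightarrow> ('m, 'k cmat) form1" where
  "conn_form V q l c p =
     laurent (conn_coeffs (second_form (reflection (V p)) (chart_frechet (\<lambda>x. reflection (V x)) c p)) (q c p)) l"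

context chart_point
begin

lemma der_frechet:
  assumes "smooth_map_on \<A> W f" "p \<in> W" shows "der f (chart_frechet f c p)"
  using chart_deriv_exists[OF assms(1) chart pt assms(2)] chart_frechet_eq by metis

lemma open_pts: "open (points \<A>)" by (rule open_points[OF atlas])

lemma der_reflection: "good_bundle \<A> V \<Longrightarrow> der (\<lambda>x. reflection (V x)) (chart_frechet (\<lambda>x. reflection (V x)) c p)"
  by (rule der_frechet[OF _ pt_points]) (simp add: good_bundle_def)

lemma reflection_props:
  assumes "good_bundle \<A> V" "x \<in> points \<A>"
  shows "involution (reflection (V x))"
  using assms unfolding good_bundle_def by (metis involution_reflection)

text \<open>With the projections \<open>(1/2) *m (mat 1 + R)\<close> and
  \<open>(1/2) *m (mat 1 - R)\<close>, the product rule gives d plus half of \<open>R ** R'\<close>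
  for the induced connection.\<close>

lemma dlam_form:
  fixes V :: "('m, 'k::finite) vbundle"
  assumes V: "good_bundle \<A> V" and s: "der \<sigma> \<sigma>'"
  shows "dlam V q l \<sigma> c p v = \<sigma>' v + conn_form V q l c p v *v \<sigma> p"
proof -
  let ?R = "\<lambda>x. reflection (V x)"
  define R' where "R' = chart_frechet ?R c p"
  have R': "der ?R R'" unfolding R'_def by (rule der_reflection[OF V])
  have pr: "proj (V x) (orth (V x)) = (1/2) *m (mat 1 + ?R x)" "proj (orth (V x)) (V x) = (1/2) *m (mat 1 - ?R x)"
    if "x \<in> points \<A>" for x
  proof -
    obtain M where M: "ortho_proj (V x) M" using V \<open>x \<in> points \<A>\<close> by (auto simp: good_bundle_def)
    show "proj (V x) (orth (V x)) = (1/2) *m (mat 1 + ?R x)" "proj (orth (V x)) (V x) = (1/2) *m (mat 1 - ?R x)"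
      unfolding ortho_proj_proj[OF M] by (simp_all add: vec_eq_iff)
  qed
  have inv: "?R p ** ?R p = mat 1" using reflection_props[OF V pt_points] by (simp add: involution_def)
  have DV: "DV V \<tau> c p v = \<tau>' v - second_form (?R p) R' v *v \<tau> p" if t: "der \<tau> \<tau>'" for \<tau> \<tau>' v
  proof -
    have 1: "der (\<lambda>x. ((1/2) *m (mat 1 + ?R x)) *v \<tau> x)
        (\<lambda>v. ((1/2) *m (0 + R' v)) *v \<tau> p + ((1/2) *m (mat 1 + ?R p)) *v \<tau>' v)"
      by (intro der_mult_vec chart_deriv_mscale chart_deriv_add chart_deriv_const R' t)
    have 2: "der (\<lambda>x. ((1/2) *m (mat 1 - ?R x)) *v \<tau> x)
        (\<lambda>v. ((1/2) *m (0 - R' v)) *v \<tau> p + ((1/2) *m (mat 1 - ?R p)) *v \<tau>' v)"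
      by (intro der_mult_vec chart_deriv_mscale chart_deriv_diff chart_deriv_const R' t)
    have d1: "dtriv (\<lambda>x. proj (V x) (orth (V x)) *v \<tau> x) c p v =
        ((1/2) *m (0 + R' v)) *v \<tau> p + ((1/2) *m (mat 1 + ?R p)) *v \<tau>' v"
      by (rule chart_deriv_dtriv, rule der_cong[OF open_pts pt_points _ 1]) (simp add: pr)
    have d2: "dtriv (\<lambda>x. proj (orth (V x)) (V x) *v \<tau> x) c p v =
        ((1/2) *m (0 - R' v)) *v \<tau> p + ((1/2) *m (mat 1 - ?R p)) *v \<tau>' v"
      by (rule chart_deriv_dtriv, rule der_cong[OF open_pts pt_points _ 2]) (simp add: pr)
    have RR: "?R p *v (?R p *v w) = w" for w by (simp add: matrix_vector_mul_assoc inv)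
    show ?thesis
      unfolding DV_def d1 d2 pr[OF pt_points]
      by (simp add: second_form_def mat_vec_ring RR vec_eq_iff field_simps)
  qed
  have NV: "NV V c p = second_form (?R p) R'"
  proof
    fix v
    have "dtriv (\<lambda>x. w) c p v - DV V (\<lambda>x. w) c p v = second_form (?R p) R' v *v w" for w
      unfolding DV[OF chart_deriv_const[of c p w]] chart_deriv_dtriv[OF chart_deriv_const[of c p w]] by simp
    then show "NV V c p v = second_form (?R p) R' v" by (simp add: NV_def)
  qed
  show ?thesis
    unfolding dlam_def DV[OF s] form_part NV conn_form_def laurent_conn_coeffs R'_def[symmetric]
    by (simp add: mat_vec_ring)
qed

lemma symmetric_family_conn_form:
  assumes V: "good_bundle \<A> V"
    and q: "\<And>v. q c p (- v) = - q c p v" "\<And>v. adj (q c p v) = - q c p v"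
      "\<And>v. reflection (V p) ** q c p v ** reflection (V p) = q c p v"
  shows "symmetric_family (reflection (V p)) (chart_frechet (\<lambda>x. reflection (V x)) c p)
    (conn_coeffs (second_form (reflection (V p)) (chart_frechet (\<lambda>x. reflection (V x)) c p)) (q c p)) (- {0})"
proof (rule symmetric_family_conn)
  let ?R' = "chart_frechet (\<lambda>x. reflection (V x)) c p"
  show "?R' v ** reflection (V p) + reflection (V p) ** ?R' v = 0" "adj (?R' v) = ?R' v" for v
    by (rule involution_der[OF open_pts pt_points reflection_props[OF V] der_reflection[OF V]], assumption)+
  show "?R' (- v) = - ?R' v" for v by (rule der_odd[OF der_reflection[OF V]])
qed (rule reflection_props[OF V pt_points] q)+

text \<open>Used twice: with the trivialisation at \<open>l\<close> for the spectral deformation,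
  and with the inverse gauge at parameter 1 for the transform.\<close>

lemma conn_form_map:
  fixes V :: "('m, 'k::finite) vbundle"
  assumes V: "good_bundle \<A> V" and g: "smooth_orthogonal \<A> g"
    and C: "symmetric_family (reflection (V p)) (chart_frechet (\<lambda>x. reflection (V x)) c p) C G" "l \<in> G" "m \<noteq> 0"
    and g': "der g (\<lambda>v. g p ** laurent C l v)"
    and q1: "\<And>v. q1 c p v = g p ** (inverse (l^2) *m C (-2) v + l^2 *m C 2 v) ** adj (g p)"
  shows "conn_form (map_bundle g V) q1 m c p v =
    g p ** (laurent C (m * l) v - laurent C l v) ** adj (g p)"
proof -
  let ?R = "\<lambda>x. reflection (V x)"
  define R' where "R' = chart_frechet ?R c p"
  define g1 where "g1 v = g p ** laurent C l v" for v
  define R1' where "R1' v = (g1 v ** ?R p + g p ** R' v) ** adj (g p) + g p ** ?R p ** adj (g1 v)" for v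
  have gp: "g p \<in> orthogonal_maps" using g pt_points by (simp add: smooth_orthogonal_def)
  have "der (\<lambda>x. g x ** ?R x ** adj (g x)) R1'"
    unfolding R1'_def g1_def R'_def by (intro der_mult chart_deriv_adj g' der_reflection V)
  then have "der (\<lambda>x. reflection (map_bundle g V x)) R1'"
    by (rule der_cong[OF open_pts pt_points, rotated]) (simp add: reflection_map_bundle[OF V g])
  then have fr: "chart_frechet (\<lambda>x. reflection (map_bundle g V x)) c p = R1'" by (rule chart_frechet_eq)
  have tC: "typed C" and l0: "l \<noteq> 0" and sk: "\<And>v. adj (laurent C l v) = - laurent C l v"
    and sy: "\<And>v. ?R p ** laurent C l v ** ?R p + ?R p ** R' v = laurent C (- l) v"
    using C by (auto simp: symmetric_family_def R'_def)
  have parts: "part10 (q1 c p) v = g p ** (inverse (l^2) *m C (-2) v) ** adj (g p)"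
    "part01 (q1 c p) v = g p ** (l^2 *m C 2 v) ** adj (g p)" for v
    by (rule part_split[of "\<lambda>v. g p ** (inverse (l^2) *m C (-2) v) ** adj (g p)"
          "\<lambda>v. g p ** (l^2 *m C 2 v) ** adj (g p)"];
        use tC in \<open>simp add: typed_def q1 mat_ring mscale_ring mult.commute\<close>)+
  show ?thesis
    unfolding conn_form_def fr reflection_map_bundle[OF V g pt_points]
    by (rule conn_normal_form[OF tC l0 C(3) sy sk reflection_props[OF V pt_points] gp g1_def])
       (simp_all add: R1'_def mat_ring parts)
qed

end

text \<open>The connection differs from d by a matrix form. Constant sections turn intertwining into
  an equation for the derivative of the isometry, and the product rule gives the converse.\<close>

lemma isometry_iff:
  fixes V :: "('m::topological_space, 'k::finite) vbundle"
  assumes atlas: "conformal_atlas \<A>" and V: "good_bundle \<A> V"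
  shows "connection_isometry \<A> (dlam V q l) dtriv \<phi> \<longleftrightarrow> smooth_orthogonal \<A> \<phi> \<and>
    (\<forall>c\<in>\<A>. \<forall>p\<in>fst c. chart_deriv c p \<phi> (\<lambda>v. \<phi> p ** conn_form V q l c p v))"
proof
  assume iso: "connection_isometry \<A> (dlam V q l) dtriv \<phi>"
  then have so: "smooth_orthogonal \<A> \<phi>" by (auto simp: connection_isometry_def smooth_orthogonal_def)
  have "chart_deriv c p \<phi> (\<lambda>v. \<phi> p ** conn_form V q l c p v)" if "c \<in> \<A>" "p \<in> fst c" for c p
  proof -
    interpret chart_point \<A> c p by unfold_locales (use atlas that in auto)
    have d: "der \<phi> (chart_frechet \<phi> c p)"
      by (rule der_frechet[OF _ pt_points]) (use so in \<open>simp add: smooth_orthogonal_def\<close>)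
    have "chart_frechet \<phi> c p = (\<lambda>v. \<phi> p ** conn_form V q l c p v)"
    proof (rule ext, rule mat_eqI)
      fix v w
      have "\<phi> p *v dlam V q l (\<lambda>x. w) c p v = dtriv (\<lambda>x. \<phi> x *v w) c p v"
        using iso that smooth_const[OF atlas open_pts, of w] by (auto simp: connection_isometry_def)
      moreover have "dtriv (\<lambda>x. \<phi> x *v w) c p v = chart_frechet \<phi> c p v *v w"
        using chart_deriv_dtriv[OF der_mult_vec[OF d chart_deriv_const]] by simp
      moreover have "dlam V q l (\<lambda>x. w) c p v = conn_form V q l c p v *v w"
        using dlam_form[OF V chart_deriv_const] by simp
      ultimately show "chart_frechet \<phi> c p v *v w = (\<phi> p ** conn_form V q l c p v) *v w"
        by (simp add: mat_vec_ring)
    qed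
    with d show ?thesis by simp
  qed
  with so show "smooth_orthogonal \<A> \<phi> \<and>
    (\<forall>c\<in>\<A>. \<forall>p\<in>fst c. chart_deriv c p \<phi> (\<lambda>v. \<phi> p ** conn_form V q l c p v))" by blast
next
  assume R: "smooth_orthogonal \<A> \<phi> \<and>
    (\<forall>c\<in>\<A>. \<forall>p\<in>fst c. chart_deriv c p \<phi> (\<lambda>v. \<phi> p ** conn_form V q l c p v))"
  show "connection_isometry \<A> (dlam V q l) dtriv \<phi>"
    unfolding connection_isometry_def
  proof (intro conjI allI impI ballI)
    fix \<sigma> :: "'m \<Rightarrow> 'k cvec" and c p v
    assume s: "smooth_map_on \<A> (points \<A>) \<sigma>" and that: "c \<in> \<A>" "p \<in> fst c"
    interpret chart_point \<A> c p by unfold_locales (use atlas that in auto)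
    have s': "der \<sigma> (chart_frechet \<sigma> c p)" by (rule der_frechet[OF s pt_points])
    have "der \<phi> (\<lambda>v. \<phi> p ** conn_form V q l c p v)" using R that by blast
    from chart_deriv_dtriv[OF der_mult_vec[OF this s']]
    show "\<phi> p *v dlam V q l \<sigma> c p v = dtriv (\<lambda>x. \<phi> x *v \<sigma> x) c p v"
      by (simp add: dlam_form[OF V s'] mat_vec_ring add.commute)
  qed (use R in \<open>auto simp: smooth_orthogonal_def\<close>)
qed

text \<open>Chart domains may be disconnected, so constancy is shown on balls in charts and spreads
  over \<open>U\<close> as local constancy.\<close>

lemma derivative_zero_const:
  fixes A :: "'m::topological_space \<Rightarrow> 'v::real_normed_vector"
  assumes atlas: "conformal_atlas \<A>"
    and A: "\<And>c p. c \<in> \<A> \<Longrightarrow> p \<in> fst c \<Longrightarrow> chart_deriv c p A (\<lambda>v. 0)"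
    and U: "connected U" "U \<subseteq> points \<A>" "x \<in> U" "y \<in> U"
  shows "A x = A y"
proof (rule connected_local_const[OF U(1,3,4)], intro ballI)
  fix a assume "a \<in> U"
  then obtain c where c: "c \<in> \<A>" "a \<in> fst c" using U by (auto simp: points_def)
  have "open (snd c ` fst c)" using c atlas by (auto simp: conformal_atlas_def)
  then obtain r where r: "r > 0" "ball (snd c a) r \<subseteq> snd c ` fst c"
    using c openE by blast
  have "((A \<circ> chart_inv c) has_derivative (\<lambda>v. 0)) (at z within ball (snd c a) r)" if "z \<in> ball (snd c a) r" for z
  proof -
    have "z \<in> snd c ` fst c" using r(2) that ..
    then obtain b where "b \<in> fst c" "z = snd c b" by blast
    with A[OF c(1)] show ?thesis unfolding chart_deriv_def by (blast intro: has_derivative_at_withinI)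
  qed
  then obtain k where k: "\<And>z. z \<in> ball (snd c a) r \<Longrightarrow> (A \<circ> chart_inv c) z = k"
    using has_derivative_zero_constant[OF convex_ball] by metis
  define T where "T = fst c \<inter> snd c -` ball (snd c a) r"
  have "continuous_on (fst c) (snd c)"
    using c atlas by (auto simp: conformal_atlas_def homeomorphism_def)
  then have "open T" unfolding T_def by (intro continuous_open_preimage chart_open[OF atlas c(1)] open_ball)
  moreover have "a \<in> T" using c r by (simp add: T_def)
  moreover have "A b = k" if "b \<in> T" for b
    using k[of "snd c b"] that chart_inv_chart[OF atlas c(1)] by (simp add: T_def)
  ultimately show "\<forall>\<^sub>F b in at a within U. A a = A b"
    unfolding eventually_at_topological by metis
qed

section \<open>Baecklund transformation parameters\<close>

lemma image_mat_mult: "(*v) A ` (*v) B ` X = (*v) (A ** B) ` X" for A B :: "'k::finite cmat"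
  by (simp add: image_image matrix_vector_mul_assoc)

lemma frame_vec_nonzero: "frame_vec R s \<Longrightarrow> s \<noteq> 0"
  by (auto simp: frame_vec_def)

lemma reflected_line_iff:
  assumes "involution (reflection W)" "s \<noteq> 0" "mink s s = 0"
  shows "reflected W (vec.span {s}) \<inter> orth (vec.span {s}) = {0} \<longleftrightarrow> frame_vec (reflection W) s"
  using frame_vec_iff[OF assms(1,2)] assms(3) by (simp add: reflected_def frame_vec_def)

lemma dress_frames_conj:
  assumes "A \<in> orthogonal_maps" "l \<noteq> 0"
  shows "dress_frames (A ** R ** adj A) (\<alpha> / l) (\<beta> / l) (A *v s) (A *v t) \<longleftrightarrow> dress_frames R \<alpha> \<beta> s t"
proof -
  have inv: "involution (A ** R ** adj A) \<longleftrightarrow> involution R"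
  proof
    assume a: "involution (A ** R ** adj A)"
    have "R ** R = adj A ** ((A ** R ** adj A) ** (A ** R ** adj A)) ** A"
      by (simp add: mat_ring orthogonal_cancel[OF assms(1)])
    then have 1: "R ** R = mat 1"
      unfolding involution_cancel(1)[OF a] by (simp add: orthogonal_cancel[OF assms(1)])
    have "adj R = adj A ** adj (A ** R ** adj A) ** A"
      by (simp add: adj_simps mat_ring orthogonal_cancel[OF assms(1)])
    then have "adj R = R"
      unfolding involution_cancel(2)[OF a] by (simp add: mat_ring orthogonal_cancel[OF assms(1)])
    with 1 show "involution R" by (simp add: involution_def)
  next
    assume "involution R"
    then show "involution (A ** R ** adj A)"
      by (simp add: involution_def mat_ring adj_simps orthogonal_cancel[OF assms(1)] matrix_mul_assoc[of R R])
  qed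
  show ?thesis
    unfolding dress_frames_def dress_conj_vec[OF assms(1)] frame_vec_conj[OF assms(1)] inv
    using assms(2) by (simp add: dress_sphere_scale)
qed

locale backlund_point =
  fixes W :: "'k::finite cvec set" and M :: "'k cmat" and \<alpha> \<beta> :: complex and s t :: "'k cvec"
  assumes W: "ortho_proj W M" and fr: "dress_frames (reflection W) \<alpha> \<beta> s t"
begin

lemma dressed_lines:
  "(*v) (qfactor W \<beta> (vec.span {t}) (Fin \<alpha>)) ` vec.span {s} =
     vec.span {dress (reflection W) 1 \<beta> t (Fin \<alpha>) *v s}"
  "(*v) (qfactor W \<alpha> (vec.span {s}) (Fin \<beta>)) ` vec.span {t} =
     vec.span {dress (reflection W) 1 \<alpha> s (Fin \<beta>) *v t}"
  using fr by (auto simp only: dress_frames_def factor_dress[OF W] map_span)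

lemma factors_two_dress:
  "pfactor W \<alpha> ((*v) (qfactor W \<beta> (vec.span {t}) (Fin \<alpha>)) ` vec.span {s}) \<mu> ** qfactor W \<beta> (vec.span {t}) \<mu> =
     two_dress (reflection W) \<alpha> \<beta> s t \<mu>"
  using fr unfolding dressed_lines two_dress_def
  by (auto simp only: dress_frames_def factor_dress[OF W])

lemma lines_nondegenerate:
  "reflected W (vec.span {s}) \<inter> orth (vec.span {s}) = {0}"
  "reflected W (vec.span {t}) \<inter> orth (vec.span {t}) = {0}"
  "reflected W ((*v) (qfactor W \<beta> (vec.span {t}) (Fin \<alpha>)) ` vec.span {s}) \<inter>
     orth ((*v) (qfactor W \<beta> (vec.span {t}) (Fin \<alpha>)) ` vec.span {s}) = {0}"
  "reflected W ((*v) (qfactor W \<alpha> (vec.span {s}) (Fin \<beta>)) ` vec.span {t}) \<inter>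
     orth ((*v) (qfactor W \<alpha> (vec.span {s}) (Fin \<beta>)) ` vec.span {t}) = {0}"
  using fr reflected_line_iff[OF involution_reflection[OF W]] frame_vec_nonzero
  unfolding dressed_lines dress_frames_def frame_vec_def by blast+

end

lemma backlund_frames:
  fixes V :: "('m::topological_space, 'k::finite) vbundle"
  assumes V: "good_bundle \<A> V" and B: "backlund_parameters \<A> V q \<alpha> \<beta> L\<alpha> L\<beta>" and p: "p \<in> points \<A>"
  obtains W s t where "open W" "p \<in> W" "W \<subseteq> points \<A>" "smooth_map_on \<A> W s" "smooth_map_on \<A> W t"
    "\<And>x. x \<in> W \<Longrightarrow> L\<alpha> x = vec.span {s x}" "\<And>x. x \<in> W \<Longrightarrow> L\<beta> x = vec.span {t x}"
    "\<And>x. x \<in> W \<Longrightarrow> dress_frames (reflection (V x)) \<alpha> \<beta> (s x) (t x)"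
proof -
  have L: "null_line_bundle \<A> L\<alpha>" "null_line_bundle \<A> L\<beta>" and nz: "\<beta> \<noteq> \<alpha>" "\<beta> \<noteq> - \<alpha>"
    using B by (auto simp: backlund_parameters_def)
  have nz': "\<alpha> \<noteq> \<beta>" "\<alpha> \<noteq> - \<beta>" using nz by auto
  obtain W1 s where W1: "open W1" "p \<in> W1" "W1 \<subseteq> points \<A>" "smooth_map_on \<A> W1 s"
    "\<And>x. x \<in> W1 \<Longrightarrow> L\<alpha> x = vec.span {s x}" "\<And>x. x \<in> W1 \<Longrightarrow> s x \<noteq> 0" "\<And>x. x \<in> W1 \<Longrightarrow> mink (s x) (s x) = 0"
    using line_frame[OF L(1) p] by metis
  obtain W2 t where W2: "open W2" "p \<in> W2" "W2 \<subseteq> points \<A>" "smooth_map_on \<A> W2 t"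
    "\<And>x. x \<in> W2 \<Longrightarrow> L\<beta> x = vec.span {t x}" "\<And>x. x \<in> W2 \<Longrightarrow> t x \<noteq> 0" "\<And>x. x \<in> W2 \<Longrightarrow> mink (t x) (t x) = 0"
    using line_frame[OF L(2) p] by metis
  have "dress_frames (reflection (V x)) \<alpha> \<beta> (s x) (t x)" if x: "x \<in> W1 \<inter> W2" for x
  proof -
    have xp: "x \<in> points \<A>" using x W1 by blast
    then obtain M where M: "ortho_proj (V x) M" using V by (auto simp: good_bundle_def)
    let ?R = "reflection (V x)"
    have R: "involution ?R" using M by (rule involution_reflection)
    have La: "L\<alpha> x = vec.span {s x}" and Lb: "L\<beta> x = vec.span {t x}" using x W1 W2 by auto
    have nd: "reflected (V x) (L\<alpha> x) \<inter> orth (L\<alpha> x) = {0}" "reflected (V x) (L\<beta> x) \<inter> orth (L\<beta> x) = {0}"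
      "reflected (V x) (dressed_line V \<alpha> L\<alpha> \<beta> L\<beta> x) \<inter> orth (dressed_line V \<alpha> L\<alpha> \<beta> L\<beta> x) = {0}"
      "reflected (V x) (dressed_line V \<beta> L\<beta> \<alpha> L\<alpha> x) \<inter> orth (dressed_line V \<beta> L\<beta> \<alpha> L\<alpha> x) = {0}"
      using B xp unfolding backlund_parameters_def by blast+
    have s: "frame_vec ?R (s x)" and t: "frame_vec ?R (t x)"
      using nd(1,2) W1(6,7) W2(6,7) x reflected_line_iff[OF R] unfolding La Lb by blast+
    \<comment> \<open>At \<open>b\<close> the factor is orthogonal, so the dressed vector remains
      null and non-zero; the transversality of the dressed line supplies the remaining pairing
      condition.\<close>
    have d: "frame_vec ?R (dress ?R 1 a u (Fin b) *v w)"
      if nd: "reflected (V x) ((*v) (qfactor (V x) a (vec.span {u}) (Fin b)) ` vec.span {w}) \<inter>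
          orth ((*v) (qfactor (V x) a (vec.span {u}) (Fin b)) ` vec.span {w}) = {0}"
        and u: "frame_vec ?R u" and w: "frame_vec ?R w" and ab: "b \<noteq> a" "b \<noteq> - a" for a b u w
    proof -
      have D: "dress ?R 1 a u (Fin b) \<in> orthogonal_maps" by (intro dress_orthogonal R u) (use ab in auto)
      have "mink (dress ?R 1 a u (Fin b) *v w) (dress ?R 1 a u (Fin b) *v w) = 0"
        using D w by (simp add: orthogonal_maps_def frame_vec_def)
      moreover have "dress ?R 1 a u (Fin b) *v w \<noteq> 0"
        using orthogonal_cancel(5)[OF D, of w] frame_vec_nonzero[OF w] by force
      ultimately show ?thesis
        using nd reflected_line_iff[OF R] unfolding factor_dress(2)[OF M u] map_span by blast
    qed
    have "frame_vec ?R (dress ?R 1 \<beta> (t x) (Fin \<alpha>) *v s x)"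
      by (rule d[OF nd(4)[unfolded dressed_line_def map_bundle_def La Lb] t s nz'])
    moreover have "frame_vec ?R (dress ?R 1 \<alpha> (s x) (Fin \<beta>) *v t x)"
      by (rule d[OF nd(3)[unfolded dressed_line_def map_bundle_def La Lb] s t nz])
    ultimately show ?thesis using R s t by (simp add: dress_frames_def)
  qed
  moreover have "smooth_map_on \<A> (W1 \<inter> W2) s" "smooth_map_on \<A> (W1 \<inter> W2) t"
    using W1(4) W2(4) by (auto intro: smooth_subset)
  ultimately show thesis
    by (intro that[of "W1 \<inter> W2" s t]) (use W1 W2 in auto)
qed

section \<open>The gauge of the transform in local frames\<close>

lemma rstar_two_dress:
  assumes "good_bundle \<A> V" "x \<in> points \<A>" "L\<alpha> x = vec.span {s}" "L\<beta> x = vec.span {t}"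
    and "dress_frames (reflection (V x)) \<alpha> \<beta> s t"
  shows "rstar V \<alpha> \<beta> L\<alpha> L\<beta> \<mu> x = two_dress (reflection (V x)) \<alpha> \<beta> s t \<mu>"
proof -
  obtain M where "ortho_proj (V x) M" using assms(1,2) by (auto simp: good_bundle_def)
  then interpret backlund_point "V x" M \<alpha> \<beta> s t using assms(5) by unfold_locales
  show ?thesis
    unfolding rstar_def dressed_line_def map_bundle_def assms(3,4) by (rule factors_two_dress)
qed

lemma rstar_smooth_orthogonal:
  fixes V :: "('m::topological_space, 'k::finite) vbundle"
  assumes atlas: "conformal_atlas \<A>" and V: "good_bundle \<A> V"
    and B: "backlund_parameters \<A> V q \<alpha> \<beta> L\<alpha> L\<beta>" and ad: "admissible \<alpha> \<mu>" "admissible \<beta> \<mu>"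
  shows "smooth_orthogonal \<A> (rstar V \<alpha> \<beta> L\<alpha> L\<beta> \<mu>)"
  unfolding smooth_orthogonal_def
proof
  show "\<forall>p\<in>points \<A>. rstar V \<alpha> \<beta> L\<alpha> L\<beta> \<mu> p \<in> orthogonal_maps"
  proof
    fix p assume p: "p \<in> points \<A>"
    obtain W s t where *: "p \<in> W" "\<And>x. x \<in> W \<Longrightarrow> L\<alpha> x = vec.span {s x}"
      "\<And>x. x \<in> W \<Longrightarrow> L\<beta> x = vec.span {t x}"
      "\<And>x. x \<in> W \<Longrightarrow> dress_frames (reflection (V x)) \<alpha> \<beta> (s x) (t x)"
      by (rule backlund_frames[OF V B p]) blast
    show "rstar V \<alpha> \<beta> L\<alpha> L\<beta> \<mu> p \<in> orthogonal_maps"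
      unfolding rstar_two_dress[of \<A> V p L\<alpha> "s p" L\<beta> "t p", OF V p *(2-4)[OF *(1)]]
      by (intro two_dress_orthogonal * ad)
  qed
  show "smooth_map_on \<A> (points \<A>) (rstar V \<alpha> \<beta> L\<alpha> L\<beta> \<mu>)"
  proof (rule smooth_local[OF atlas])
    fix p assume p: "p \<in> points \<A>"
    obtain W s t where W: "open W" "p \<in> W" "W \<subseteq> points \<A>" and st: "smooth_map_on \<A> W s" "smooth_map_on \<A> W t"
      and *: "\<And>x. x \<in> W \<Longrightarrow> L\<alpha> x = vec.span {s x}" "\<And>x. x \<in> W \<Longrightarrow> L\<beta> x = vec.span {t x}"
      "\<And>x. x \<in> W \<Longrightarrow> dress_frames (reflection (V x)) \<alpha> \<beta> (s x) (t x)"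
      by (rule backlund_frames[OF V B p]) blast
    have sR: "smooth_map_on \<A> W (\<lambda>x. reflection (V x))"
      using V W(3) by (auto simp: good_bundle_def intro: smooth_subset)
    have "smooth_map_on \<A> W (\<lambda>x. two_dress (reflection (V x)) \<alpha> \<beta> (s x) (t x) \<mu>)"
      unfolding two_dress_def
      by (intro smooth_mult smooth_dress smooth_mult_vec atlas W(1) sR st)
         (use *(3) in \<open>auto simp: dress_frames_def\<close>)
    then have "smooth_map_on \<A> W (rstar V \<alpha> \<beta> L\<alpha> L\<beta> \<mu>)"
      by (rule smooth_cong[OF atlas W(1), rotated], intro rstar_two_dress[where \<A> = \<A>, symmetric] *) (use V W(3) in auto)
    then show "\<exists>T. open T \<and> p \<in> T \<and> smooth_map_on \<A> (points \<A> \<inter> T) (rstar V \<alpha> \<beta> L\<alpha> L\<beta> \<mu>)"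
      using W by (intro exI[of _ W]) (simp add: inf.absorb2)
  qed
qed

lemma map_bundle_line: "L x = vec.span {s} \<Longrightarrow> map_bundle g L x = vec.span {g x *v s}"
  by (simp add: map_bundle_def map_span)

lemma rstar_map:
  fixes V :: "('m::topological_space, 'k::finite) vbundle"
  assumes atlas: "conformal_atlas \<A>" and V: "good_bundle \<A> V"
    and B: "backlund_parameters \<A> V q \<alpha> \<beta> L\<alpha> L\<beta>" and g: "smooth_orthogonal \<A> g"
    and l: "l \<noteq> 0" and p: "p \<in> points \<A>"
  shows "rstar (map_bundle g V) (\<alpha> / l) (\<beta> / l) (map_bundle g L\<alpha>) (map_bundle g L\<beta>) \<mu> p =
    g p ** rstar V \<alpha> \<beta> L\<alpha> L\<beta> (sphere_scale l \<mu>) p ** adj (g p)"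
proof -
  obtain W s t where "p \<in> W" "\<And>x. x \<in> W \<Longrightarrow> L\<alpha> x = vec.span {s x}"
    "\<And>x. x \<in> W \<Longrightarrow> L\<beta> x = vec.span {t x}"
    "\<And>x. x \<in> W \<Longrightarrow> dress_frames (reflection (V x)) \<alpha> \<beta> (s x) (t x)"
    by (rule backlund_frames[OF V B p]) blast
  then have *: "L\<alpha> p = vec.span {s p}" "L\<beta> p = vec.span {t p}" "dress_frames (reflection (V p)) \<alpha> \<beta> (s p) (t p)"
    by auto
  have gp: "g p \<in> orthogonal_maps" using g p by (simp add: smooth_orthogonal_def)
  have fr: "dress_frames (reflection (map_bundle g V p)) (\<alpha> / l) (\<beta> / l) (g p *v s p) (g p *v t p)"
    unfolding reflection_map_bundle[OF V g p] dress_frames_conj[OF gp l] by (rule *(3))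
  show ?thesis
    unfolding rstar_two_dress[of \<A> "map_bundle g V" p "map_bundle g L\<alpha>" _ "map_bundle g L\<beta>",
        OF good_bundle_map[OF atlas V g] p map_bundle_line[of L\<alpha> p, OF *(1)] map_bundle_line[of L\<beta> p, OF *(2)] fr]
      rstar_two_dress[of \<A> V p L\<alpha> "s p" L\<beta> "t p", OF V p *] two_dress_conj[OF gp] reflection_map_bundle[OF V g p] two_dress_scale[OF l] ..
qed

lemma null_line_bundle_map:
  fixes L :: "('m::topological_space, 'k::finite) vbundle"
  assumes atlas: "conformal_atlas \<A>" and L: "null_line_bundle \<A> L" and g: "smooth_orthogonal \<A> g"
  shows "null_line_bundle \<A> (map_bundle g L)"
  unfolding null_line_bundle_def
proof
  show "isotropic_bundle \<A> (map_bundle g L)"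
    using L g by (auto simp: null_line_bundle_def isotropic_bundle_def isotropic_def map_bundle_def
        smooth_orthogonal_def orthogonal_maps_def)
  show "subbundle \<A> 1 (map_bundle g L)"
    unfolding subbundle_def
  proof (intro ballI conjI)
    fix p assume p: "p \<in> points \<A>"
    obtain W s where W: "open W" "p \<in> W" "W \<subseteq> points \<A>" "smooth_map_on \<A> W s"
      "\<And>x. x \<in> W \<Longrightarrow> L x = vec.span {s x}" "\<And>x. x \<in> W \<Longrightarrow> s x \<noteq> 0" "\<And>x. x \<in> W \<Longrightarrow> mink (s x) (s x) = 0"
      using line_frame[OF L p] by metis
    have gL: "map_bundle g L x = vec.span {g x *v s x}" if "x \<in> W" for x
      using W(5)[OF that] by (rule map_bundle_line)
    have gp: "g p \<in> orthogonal_maps" using g p by (simp add: smooth_orthogonal_def)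
    then have "g p *v s p \<noteq> 0" using orthogonal_cancel(5)[OF gp, of "s p"] W by force
    then have "vec.independent {g p *v s p}" by simp
    then show "vec.dim (map_bundle g L p) = 1"
      unfolding gL[OF W(2)] by (simp add: vec.dim_span_eq_card_independent)
    show "vec.subspace (map_bundle g L p)" unfolding gL[OF W(2)] by (rule vec.subspace_span)
    have "smooth_map_on \<A> W g" using g W(3) by (auto simp: smooth_orthogonal_def intro: smooth_subset)
    then have sm: "smooth_map_on \<A> W (\<lambda>x. g x *v s x)" by (intro smooth_mult_vec atlas W)
    show "\<exists>W s. open W \<and> p \<in> W \<and> W \<subseteq> points \<A> \<and> (\<forall>i<1. smooth_map_on \<A> W (s i)) \<and>
        (\<forall>x\<in>W. map_bundle g L x = vec.span {s i x |i. i < (1::nat)})"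
      by (rule exI[of _ W], rule exI[of _ "\<lambda>i x. g x *v s x"]) (use W gL sm in auto)
  qed
qed

context chart_point
begin

lemma spectral_multiplier_form:
  assumes "g p \<in> orthogonal_maps"
  shows "spectral_multiplier g q l c p v =
    g p ** (inverse (l^2) *m conn_coeffs N (q c p) (-2) v + l^2 *m conn_coeffs N (q c p) 2 v) ** adj (g p)"
  by (simp add: spectral_multiplier_def Ad_def matrix_inv_orthogonal[OF assms] form_part conn_coeffs_def)

lemma parallel_frame:
  fixes V :: "('m, 'k::finite) vbundle"
  assumes V: "good_bundle \<A> V" and par: "parallel \<A> (dlam V q l) L"
    and W: "open W" "p \<in> W" "W \<subseteq> points \<A>" "smooth_map_on \<A> W s" "\<And>x. x \<in> W \<Longrightarrow> L x = vec.span {s x}"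
    and s': "der s s'"
  shows "\<exists>k. s' v + conn_form V q l c p v *v s p = k *s s p"
proof -
  have "local_section \<A> L W s" using W by (auto simp: local_section_def vec.span_base)
  then have "dlam V q l s c p v \<in> L p" using par chart pt W(2) unfolding parallel_def by blast
  then show ?thesis unfolding dlam_form[OF V s'] W(5)[OF W(2)] span_single by blast
qed

text \<open>Frames are chosen near the point and disappear again from the result, because
  \<open>rstar\<close> is defined by the lines.\<close>

lemma rstar_gauge:
  fixes V :: "('m, 'k::finite) vbundle"
  assumes V: "good_bundle \<A> V" and B: "backlund_parameters \<A> V q \<alpha> \<beta> L\<alpha> L\<beta>"
    and q: "\<And>v. q c p (- v) = - q c p v" "\<And>v. adj (q c p v) = - q c p v"
      "\<And>v. reflection (V p) ** q c p v ** reflection (V p) = q c p v"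
  defines "r \<equiv> rstar V \<alpha> \<beta> L\<alpha> L\<beta>"
  obtains C' where "symmetric_family (reflection (V p)) (chart_frechet (\<lambda>x. reflection (V x)) c p) C'
      (- {0, \<alpha>, - \<alpha>, \<beta>, - \<beta>})"
    "\<And>v. C' (-2) v = r (Fin 0) p ** form10 q c p v ** adj (r (Fin 0) p)"
    "\<And>v. C' 2 v = r Infty p ** form01 q c p v ** adj (r Infty p)"
    "\<And>x. x \<notin> {0, \<alpha>, - \<alpha>, \<beta>, - \<beta>} \<Longrightarrow>
       der (r (Fin x)) (\<lambda>v. r (Fin x) p ** conn_form V q x c p v - laurent C' x v ** r (Fin x) p)"
proof -
  obtain W s t where W: "open W" "p \<in> W" "W \<subseteq> points \<A>" and st: "smooth_map_on \<A> W s" "smooth_map_on \<A> W t"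
    and *: "\<And>x. x \<in> W \<Longrightarrow> L\<alpha> x = vec.span {s x}" "\<And>x. x \<in> W \<Longrightarrow> L\<beta> x = vec.span {t x}"
    "\<And>x. x \<in> W \<Longrightarrow> dress_frames (reflection (V x)) \<alpha> \<beta> (s x) (t x)"
    by (rule backlund_frames[OF V B pt_points]) blast
  have sR: "smooth_map_on \<A> W (\<lambda>x. reflection (V x))"
    using V W(3) by (auto simp: good_bundle_def intro: smooth_subset)
  have nz: "\<alpha> \<noteq> 0" "\<beta> \<noteq> 0" "\<beta> \<noteq> \<alpha>" "\<beta> \<noteq> - \<alpha>"
    and par: "parallel \<A> (dlam V q \<alpha>) L\<alpha>" "parallel \<A> (dlam V q \<beta>) L\<beta>"
    using B by (auto simp: backlund_parameters_def)
  note s' = der_frechet[OF st(1) W(2)] and t' = der_frechet[OF st(2) W(2)]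
  have r: "r \<mu> x = two_dress (reflection (V x)) \<alpha> \<beta> (s x) (t x) \<mu>" if "x \<in> W" for x \<mu>
    unfolding r_def using that W(3) by (intro rstar_two_dress[OF V]) (auto simp: *)
  let ?R' = "chart_frechet (\<lambda>x. reflection (V x)) c p"
  let ?r = "two_dress (reflection (V p)) \<alpha> \<beta> (s p) (t p)"
  let ?C = "conn_coeffs (second_form (reflection (V p)) ?R') (q c p)"
  have cf: "laurent ?C x = conn_form V q x c p" for x by (simp add: conn_form_def)
  show thesis
  proof (rule two_dressing[where R = "\<lambda>x. reflection (V x)" and s = s and t = t,
        OF W(1,2) sR st *(3) der_reflection[OF V] s' t' symmetric_family_conn_form[where q = q, OF V q] nz])
    show "\<exists>k. chart_frechet s c p v + laurent ?C \<alpha> v *v s p = k *s s p" for v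
      unfolding cf by (rule parallel_frame[OF V par(1) W st(1) *(1) s'])
    show "\<exists>k. chart_frechet t c p v + laurent ?C \<beta> v *v t p = k *s t p" for v
      unfolding cf by (rule parallel_frame[OF V par(2) W st(2) *(2) t'])
    fix C' assume C': "symmetric_family (reflection (V p)) ?R' C' (- {0, \<alpha>, - \<alpha>, \<beta>, - \<beta>})"
    "\<And>v. C' (-2) v = ?r (Fin 0) ** ?C (-2) v **
        adj (?r (Fin 0))"
    "\<And>v. C' 2 v = ?r Infty ** ?C 2 v **
        adj (?r Infty)"
    "\<And>x. x \<notin> {0, \<alpha>, - \<alpha>, \<beta>, - \<beta>} \<Longrightarrow>
       der (\<lambda>y. two_dress (reflection (V y)) \<alpha> \<beta> (s y) (t y) (Fin x))
         (\<lambda>v. ?r (Fin x) ** laurent ?C x v -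
            laurent C' x v ** ?r (Fin x))"
    show thesis
    proof
      show "C' (-2) v = r (Fin 0) p ** form10 q c p v ** adj (r (Fin 0) p)"
        "C' 2 v = r Infty p ** form01 q c p v ** adj (r Infty p)" for v
        by (simp_all add: C'(2,3) r[OF W(2)] conn_coeffs_def form_part)
      fix x assume "x \<notin> {0, \<alpha>, - \<alpha>, \<beta>, - \<beta>}"
      from der_cong[OF W(1,2) r[symmetric] C'(4)[OF this]]
      show "der (r (Fin x)) (\<lambda>v. r (Fin x) p ** conn_form V q x c p v - laurent C' x v ** r (Fin x) p)"
        by (simp add: r[OF W(2)] cf)
    qed (rule C'(1))
  qed
qed

end

section \<open>The permutability of spectral deformation and Baecklund transformation\<close>

lemma harmonic_multiplier:
  fixes V :: "('m::topological_space, 'k::finite) vbundle"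
  assumes V: "good_bundle \<A> V" and h: "constrained_harmonic \<A> V q" and c: "c \<in> \<A>" "p \<in> fst c"
  shows "q c p (- v) = - q c p v" "adj (q c p v) = - q c p v"
    "reflection (V p) ** q c p v ** reflection (V p) = q c p v"
proof -
  have "linear (q c p)" using h c unfolding constrained_harmonic_def one_form_def by blast
  then show "q c p (- v) = - q c p v" by (rule linear_neg)
  have "p \<in> points \<A>" using c by (auto simp: points_def)
  then obtain M where M: "ortho_proj (V p) M" using V by (auto simp: good_bundle_def)
  have R: "involution (reflection (V p))" using M by (rule involution_reflection)
  have "q c p v \<in> set_sum (Wedge2 (V p)) (Wedge2 (orth (V p)))"
    using h c unfolding constrained_harmonic_def by blast
  then obtain X Y where XY: "q c p v = X + Y" "X \<in> Wedge2 (V p)" "Y \<in> Wedge2 (orth (V p))"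
    by (auto simp: set_sum_def)
  show "adj (q c p v) = - q c p v" using Wedge2_skew[OF XY(2)] Wedge2_skew[OF XY(3)] by (simp add: XY(1) adj_simps)
  have "reflection (V p) ** X ** adj (reflection (V p)) = X"
    by (rule Wedge2_conj[OF involution_cancel(5)[OF R] XY(2), of 1]) (simp_all add: reflection_in[OF M])
  moreover have "reflection (V p) ** Y ** adj (reflection (V p)) = Y"
    by (rule Wedge2_conj[OF involution_cancel(5)[OF R] XY(3), of "-1"]) (simp_all add: reflection_orth[OF M])
  ultimately show "reflection (V p) ** q c p v ** reflection (V p) = q c p v"
    by (simp add: XY(1) involution_cancel[OF R] mat_ring)
qed

text \<open>The trivialisation at \<open>l\<close> carries the whole family: the deformed connection
  at \<open>a / l\<close> is the conjugate by \<phi> of the original one at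
  \<open>a\<close>.\<close>

lemma parallel_map:
  fixes V :: "('m::topological_space, 'k::finite) vbundle"
  assumes atlas: "conformal_atlas \<A>" and V: "good_bundle \<A> V" and h: "constrained_harmonic \<A> V q"
    and iso: "connection_isometry \<A> (dlam V q l) dtriv \<phi>" and l: "l \<noteq> 0" and a: "a \<noteq> 0"
    and par: "parallel \<A> (dlam V q a) L"
  shows "parallel \<A> (dlam (map_bundle \<phi> V) (spectral_multiplier \<phi> q l) (a / l)) (map_bundle \<phi> L)"
  unfolding parallel_def
proof (intro allI impI ballI)
  fix W \<sigma> c p v
  assume \<sigma>: "local_section \<A> (map_bundle \<phi> L) W \<sigma>" and c: "c \<in> \<A>" "p \<in> fst c \<inter> W"
  interpret chart_point \<A> c p by unfold_locales (use atlas c in auto)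
  have \<phi>: "smooth_orthogonal \<A> \<phi>" and \<phi>': "der \<phi> (\<lambda>v. \<phi> p ** conn_form V q l c p v)"
    using iso c unfolding isometry_iff[OF atlas V] by auto
  have W: "open W" "p \<in> W" "W \<subseteq> points \<A>" "smooth_map_on \<A> W \<sigma>" "\<And>x. x \<in> W \<Longrightarrow> \<sigma> x \<in> map_bundle \<phi> L x"
    using \<sigma> c by (auto simp: local_section_def)
  have \<phi>o: "\<phi> x \<in> orthogonal_maps" if "x \<in> W" for x using \<phi> W(3) that by (auto simp: smooth_orthogonal_def)
  \<comment> \<open>Pull the section back by the inverse isometry, so that parallelism of
    \<open>L\<close> applies to it.\<close>
  define \<tau> where "\<tau> x = adj (\<phi> x) *v \<sigma> x" for x
  have "smooth_map_on \<A> W \<phi>" using \<phi> W(3) by (auto simp: smooth_orthogonal_def intro: smooth_subset)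
  then have sm: "smooth_map_on \<A> W \<tau>" unfolding \<tau>_def by (intro smooth_mult_vec smooth_adj atlas W)
  have \<tau>L: "\<tau> x \<in> L x" if "x \<in> W" for x
    using W(5)[OF that] orthogonal_cancel(5)[OF \<phi>o[OF that]] by (auto simp: \<tau>_def map_bundle_def)
  define \<tau>' where "\<tau>' = chart_frechet \<tau> c p"
  have \<tau>': "der \<tau> \<tau>'" unfolding \<tau>'_def by (rule der_frechet[OF sm W(2)])
  have \<sigma>': "der \<sigma> (\<lambda>v. (\<phi> p ** conn_form V q l c p v) *v \<tau> p + \<phi> p *v \<tau>' v)"
    by (rule der_cong[OF W(1,2) _ der_mult_vec[OF \<phi>' \<tau>']]) (simp add: \<tau>_def orthogonal_cancel[OF \<phi>o])
  let ?C = "conn_coeffs (second_form (reflection (V p)) (chart_frechet (\<lambda>x. reflection (V x)) c p)) (q c p)"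
  have cf: "laurent ?C x = conn_form V q x c p" for x by (simp add: conn_form_def)
  have q: "q c p (- v) = - q c p v" "adj (q c p v) = - q c p v"
    "reflection (V p) ** q c p v ** reflection (V p) = q c p v" for v
    using harmonic_multiplier[OF V h chart pt] by auto
  have "conn_form (map_bundle \<phi> V) (spectral_multiplier \<phi> q l) (a / l) c p v =
      \<phi> p ** (laurent ?C (a / l * l) v - laurent ?C l v) ** adj (\<phi> p)"
  proof (rule conn_form_map[OF V \<phi> symmetric_family_conn_form[where q = q, OF V q]])
    show "spectral_multiplier \<phi> q l c p v = \<phi> p ** (inverse (l^2) *m ?C (-2) v + l^2 *m ?C 2 v) ** adj (\<phi> p)" for v
      by (rule spectral_multiplier_form[where g = \<phi>, OF \<phi>o[OF W(2)]])
  qed (use l a \<phi>' in \<open>auto simp: cf\<close>)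
  then have "dlam (map_bundle \<phi> V) (spectral_multiplier \<phi> q l) (a / l) \<sigma> c p v = \<phi> p *v dlam V q a \<tau> c p v"
    using l unfolding dlam_form[OF good_bundle_map[OF atlas V \<phi>] \<sigma>'] dlam_form[OF V \<tau>'] cf
    by (simp add: mat_vec_ring \<tau>_def)
  moreover have "dlam V q a \<tau> c p v \<in> L p"
    using par sm \<tau>L W c unfolding parallel_def local_section_def by blast
  ultimately show "dlam (map_bundle \<phi> V) (spectral_multiplier \<phi> q l) (a / l) \<sigma> c p v \<in> map_bundle \<phi> L p"
    by (simp add: map_bundle_def)
qed

lemma backlund_parameters_map:
  fixes V :: "('m::topological_space, 'k::finite) vbundle"
  assumes atlas: "conformal_atlas \<A>" and V: "good_bundle \<A> V" and h: "constrained_harmonic \<A> V q"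
    and iso: "connection_isometry \<A> (dlam V q l) dtriv \<phi>"
    and l: "l \<notin> {0, \<alpha>, - \<alpha>, \<beta>, - \<beta>}" and B: "backlund_parameters \<A> V q \<alpha> \<beta> L\<alpha> L\<beta>"
  shows "backlund_parameters \<A> (map_bundle \<phi> V) (spectral_multiplier \<phi> q l) (\<alpha> / l) (\<beta> / l)
       (map_bundle \<phi> L\<alpha>) (map_bundle \<phi> L\<beta>)"
  unfolding backlund_parameters_def
proof (intro conjI ballI)
  have \<phi>: "smooth_orthogonal \<A> \<phi>" using iso unfolding isometry_iff[OF atlas V] by blast
  have l0: "l \<noteq> 0" using l by simp
  have b: "\<alpha> \<noteq> 0" "\<beta> \<noteq> 0" "\<beta> \<noteq> \<alpha>" "\<beta> \<noteq> - \<alpha>" "null_line_bundle \<A> L\<alpha>" "null_line_bundle \<A> L\<beta>"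
    "parallel \<A> (dlam V q \<alpha>) L\<alpha>" "parallel \<A> (dlam V q \<beta>) L\<beta>"
    using B by (auto simp: backlund_parameters_def)
  \<comment> \<open>The values 1 and -1 are avoided because \<open>l\<close> differs from \<alpha>,
    \<beta> and their negatives.\<close>
  show "\<alpha> / l \<notin> {-1, 0, 1}" "\<beta> / l \<notin> {-1, 0, 1}" "\<beta> / l \<noteq> \<alpha> / l" "\<beta> / l \<noteq> - (\<alpha> / l)"
    using l b by (auto simp: field_simps)
  show "null_line_bundle \<A> (map_bundle \<phi> L\<alpha>)" "null_line_bundle \<A> (map_bundle \<phi> L\<beta>)"
    by (intro null_line_bundle_map atlas b \<phi>)+
  show "parallel \<A> (dlam (map_bundle \<phi> V) (spectral_multiplier \<phi> q l) (\<alpha> / l)) (map_bundle \<phi> L\<alpha>)"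
    "parallel \<A> (dlam (map_bundle \<phi> V) (spectral_multiplier \<phi> q l) (\<beta> / l)) (map_bundle \<phi> L\<beta>)"
    by (rule parallel_map[OF atlas V h iso l0]; fact b)+
  fix L p
  assume L: "L \<in> {map_bundle \<phi> L\<alpha>, map_bundle \<phi> L\<beta>,
      dressed_line (map_bundle \<phi> V) (\<alpha> / l) (map_bundle \<phi> L\<alpha>) (\<beta> / l) (map_bundle \<phi> L\<beta>),
      dressed_line (map_bundle \<phi> V) (\<beta> / l) (map_bundle \<phi> L\<beta>) (\<alpha> / l) (map_bundle \<phi> L\<alpha>)}"
    and p: "p \<in> points \<A>"
  obtain W s t where "p \<in> W" "\<And>x. x \<in> W \<Longrightarrow> L\<alpha> x = vec.span {s x}"
    "\<And>x. x \<in> W \<Longrightarrow> L\<beta> x = vec.span {t x}"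
    "\<And>x. x \<in> W \<Longrightarrow> dress_frames (reflection (V x)) \<alpha> \<beta> (s x) (t x)"
    by (rule backlund_frames[OF V B p]) blast
  then have *: "L\<alpha> p = vec.span {s p}" "L\<beta> p = vec.span {t p}" "dress_frames (reflection (V p)) \<alpha> \<beta> (s p) (t p)"
    by auto
  have gp: "\<phi> p \<in> orthogonal_maps" using \<phi> p by (simp add: smooth_orthogonal_def)
  have fr: "dress_frames (reflection (map_bundle \<phi> V p)) (\<alpha> / l) (\<beta> / l) (\<phi> p *v s p) (\<phi> p *v t p)"
    unfolding reflection_map_bundle[OF V \<phi> p] dress_frames_conj[OF gp l0] by (rule *(3))
  obtain M where "ortho_proj (map_bundle \<phi> V p) M"
    using good_bundle_map[OF atlas V \<phi>] p by (auto simp: good_bundle_def)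
  then interpret backlund_point "map_bundle \<phi> V p" M "\<alpha> / l" "\<beta> / l" "\<phi> p *v s p" "\<phi> p *v t p"
    using fr by unfold_locales
  have lines: "map_bundle \<phi> L\<alpha> p = vec.span {\<phi> p *v s p}" "map_bundle \<phi> L\<beta> p = vec.span {\<phi> p *v t p}"
    by (rule map_bundle_line[of L\<alpha> p, OF *(1)], rule map_bundle_line[of L\<beta> p, OF *(2)])
  have dl: "dressed_line U a K b K' p = (*v) (qfactor (U p) a (K p) (Fin b)) ` K' p" for U a K b K'
    by (simp only: dressed_line_def map_bundle_def)
  show "reflected (map_bundle \<phi> V p) (L p) \<inter> orth (L p) = {0}"
    using L by (elim insertE emptyE) (simp_all only: dl lines lines_nondegenerate)
qed

text \<open>The quotient of two trivialisations has zero derivative: the connection form appears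
  once directly and once through an adjoint, with opposite signs.\<close>

lemma isometry_unique:
  fixes V :: "('m::topological_space, 'k::finite) vbundle"
  assumes atlas: "conformal_atlas \<A>" and V: "good_bundle \<A> V"
    and iso: "connection_isometry \<A> (dlam V q l) dtriv \<phi>" "connection_isometry \<A> (dlam V q l) dtriv \<psi>"
    and U: "connected U" "U \<subseteq> points \<A>"
  obtains A where "A \<in> orthogonal_maps" "\<And>p. p \<in> U \<Longrightarrow> \<phi> p = A ** \<psi> p"
proof (cases "U = {}")
  case False
  then obtain u where u: "u \<in> U" by blast
  define A where "A p = \<phi> p ** adj (\<psi> p)" for p
  have so: "smooth_orthogonal \<A> \<phi>" "smooth_orthogonal \<A> \<psi>"
    and der: "\<And>c p. c \<in> \<A> \<Longrightarrow> p \<in> fst c \<Longrightarrow> chart_deriv c p \<phi> (\<lambda>v. \<phi> p ** conn_form V q l c p v)"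
      "\<And>c p. c \<in> \<A> \<Longrightarrow> p \<in> fst c \<Longrightarrow> chart_deriv c p \<psi> (\<lambda>v. \<psi> p ** conn_form V q l c p v)"
    using iso unfolding isometry_iff[OF atlas V] by auto
  have o: "\<phi> p \<in> orthogonal_maps" "\<psi> p \<in> orthogonal_maps" if "p \<in> points \<A>" for p
    using so that by (auto simp: smooth_orthogonal_def)
  have "chart_deriv c p A (\<lambda>v. 0)" if c: "c \<in> \<A>" "p \<in> fst c" for c p
  proof -
    interpret chart_point \<A> c p by unfold_locales (use atlas c in auto)
    let ?Om = "conn_form V q l c p"
    \<comment> \<open>Skewness follows from the existence of an orthogonal trivialisation.\<close>
    have skew: "adj (?Om v) = - ?Om v" for v
      using orthogonal_der[OF open_pts pt_points o(2) der(2)[OF c], of v]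
      by (simp add: adj_simps mat_ring orthogonal_cancel[OF o(2)[OF pt_points]] eq_neg_iff_add_eq_0)
    have "chart_deriv c p A (\<lambda>v. (\<phi> p ** ?Om v) ** adj (\<psi> p) + \<phi> p ** adj (\<psi> p ** ?Om v))"
      unfolding A_def by (intro der_mult chart_deriv_adj der c)
    then show ?thesis by (simp add: adj_simps skew mat_ring)
  qed
  then have A: "A p = A u" if "p \<in> U" for p
    using derivative_zero_const[OF atlas _ U that u] by blast
  show thesis
  proof
    show "A u \<in> orthogonal_maps"
      unfolding A_def using u U by (intro orthogonal_maps_mult orthogonal_maps_adj_mem o) auto
    fix p assume p: "p \<in> U"
    then have "\<psi> p \<in> orthogonal_maps" using o U by blast
    then show "\<phi> p = A u ** \<psi> p"
      unfolding A[OF p, symmetric] by (simp add: A_def matrix_mul_assoc[symmetric] orthogonal_cancel)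
  qed
qed (use that orthogonal_maps_one in auto)

text \<open>The constant compares the two isometries alone, so one map serves all pairs of bundles
  in \<open>P\<close> simultaneously.\<close>

lemma coincide_up_to_constantI:
  fixes V :: "('m::topological_space, 'k::finite) vbundle"
  assumes atlas: "conformal_atlas \<A>" and V: "good_bundle \<A> V"
    and iso: "connection_isometry \<A> (dlam V q l) dtriv \<phi>" "connection_isometry \<A> (dlam V q l) dtriv \<psi>"
    and P: "\<And>E K p. (E, K) \<in> P \<Longrightarrow> p \<in> points \<A> \<Longrightarrow> E p = map_bundle \<phi> K p"
  shows "coincide_up_to_constant \<A> ((\<lambda>(E, K). (E, map_bundle \<psi> K)) ` P)"
  unfolding coincide_up_to_constant_def
proof (intro allI impI)
  fix U assume U: "open U \<and> connected U \<and> U \<subseteq> points \<A>"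
  then obtain A where A: "A \<in> orthogonal_maps" "\<And>p. p \<in> U \<Longrightarrow> \<phi> p = A ** \<psi> p"
    using isometry_unique[OF atlas V iso] by metis
  have "fst x p = (*v) A ` map_bundle \<psi> (snd x) p" if EK: "x \<in> P" "p \<in> U" for x p
  proof -
    have "fst x p = map_bundle \<phi> (snd x) p" using P[of "fst x" "snd x"] EK U by auto
    then show ?thesis by (simp add: map_bundle_def A(2)[OF EK(2)] image_mat_mult)
  qed
  with A(1) show "\<exists>A\<in>orthogonal_maps. \<forall>(E, F)\<in>(\<lambda>(E, K). (E, map_bundle \<psi> K)) ` P. \<forall>p\<in>U. E p = (*v) A ` F p"
    by (intro bexI[of _ A]) (simp_all add: split_beta)
qed

text \<open>
  The isometry of the transformed connection is \<open>\<phi> r(l)\<^sup>-\<^sup>1 r(1)\<close>, where \<open>r\<close> is the dressing gauge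
  \<open>rstar\<close>: it maps \<open>d\<^sup>l\<close> to the connection of parameter \<open>l\<close> of the dressed family.
\<close>

definition backlund_isometry :: "('m, 'k::finite) vbundle \<Rightarrow> complex \<Rightarrow> complex \<Rightarrow> ('m, 'k) vbundle \<Rightarrow>
    ('m, 'k) vbundle \<Rightarrow> complex \<Rightarrow> ('m \<Rightarrow> 'k cmat) \<Rightarrow> 'm \<Rightarrow> 'k cmat" where
  "backlund_isometry V \<alpha> \<beta> L\<alpha> L\<beta> l \<phi> p =
     \<phi> p ** adj (rstar V \<alpha> \<beta> L\<alpha> L\<beta> (Fin l) p) ** rstar V \<alpha> \<beta> L\<alpha> L\<beta> (Fin 1) p"

locale backlund_setting =
  fixes \<A> :: "'m::topological_space chart set" and V L\<alpha> L\<beta> :: "('m, 'k::finite) vbundle"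
    and q :: "('m, 'k cmat) form1" and \<phi> :: "'m \<Rightarrow> 'k cmat" and \<alpha> \<beta> l :: complex
  assumes atlas: "conformal_atlas \<A>" and harmonic: "constrained_harmonic \<A> V q"
    and params: "backlund_parameters \<A> V q \<alpha> \<beta> L\<alpha> L\<beta>"
    and l: "l \<notin> {0, \<alpha>, - \<alpha>, \<beta>, - \<beta>}"
    and iso: "connection_isometry \<A> (dlam V q l) dtriv \<phi>"
begin

abbreviation r where "r \<equiv> rstar V \<alpha> \<beta> L\<alpha> L\<beta>"
abbreviation Vs where "Vs \<equiv> backlund V \<alpha> \<beta> L\<alpha> L\<beta>"
abbreviation qs where "qs \<equiv> backlund_multiplier V \<alpha> \<beta> L\<alpha> L\<beta> q"
abbreviation \<psi> where "\<psi> \<equiv> backlund_isometry V \<alpha> \<beta> L\<alpha> L\<beta> l \<phi>"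

lemma V: "good_bundle \<A> V"
  using harmonic good_bundle_subbundle[OF atlas] by (auto simp: constrained_harmonic_def)

lemma \<phi>: "smooth_orthogonal \<A> \<phi>"
  using iso unfolding isometry_iff[OF atlas V] by blast

lemma nz: "l \<noteq> 0" "1 \<notin> {0, \<alpha>, - \<alpha>, \<beta>, - \<beta>}"
proof -
  show "1 \<notin> {0, \<alpha>, - \<alpha>, \<beta>, - \<beta>}"
    using params by (auto simp: backlund_parameters_def eq_commute[of 1] minus_equation_iff[of _ 1])
qed (use l in auto)

lemma r: "y \<notin> {0, \<alpha>, - \<alpha>, \<beta>, - \<beta>} \<Longrightarrow> smooth_orthogonal \<A> (r (Fin y))" "smooth_orthogonal \<A> (r Infty)"
  "smooth_orthogonal \<A> (r (Fin 0))"
proof -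
  have "\<alpha> \<noteq> 0" "\<beta> \<noteq> 0" using params by (auto simp: backlund_parameters_def)
  then show "y \<notin> {0, \<alpha>, - \<alpha>, \<beta>, - \<beta>} \<Longrightarrow> smooth_orthogonal \<A> (r (Fin y))" "smooth_orthogonal \<A> (r Infty)"
    "smooth_orthogonal \<A> (r (Fin 0))"
    by (auto intro!: rstar_smooth_orthogonal[OF atlas V params])
qed

lemma r_orth: "p \<in> points \<A> \<Longrightarrow> r (Fin l) p \<in> orthogonal_maps" "p \<in> points \<A> \<Longrightarrow> r (Fin 1) p \<in> orthogonal_maps"
  "p \<in> points \<A> \<Longrightarrow> r Infty p \<in> orthogonal_maps" "p \<in> points \<A> \<Longrightarrow> r (Fin 0) p \<in> orthogonal_maps"
  "p \<in> points \<A> \<Longrightarrow> \<phi> p \<in> orthogonal_maps"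
  using r(1)[OF l] r(1)[OF nz(2)] r(2,3) \<phi> by (auto simp: smooth_orthogonal_def)

lemma r_inv: "smooth_orthogonal \<A> (\<lambda>p. matrix_inv (r (Fin 1) p))"
proof -
  have "smooth_map_on \<A> (points \<A>) (\<lambda>p. adj (r (Fin 1) p))"
    using r(1)[OF nz(2)] by (intro smooth_adj atlas open_points) (simp add: smooth_orthogonal_def)
  then have "smooth_map_on \<A> (points \<A>) (\<lambda>p. matrix_inv (r (Fin 1) p))"
    by (rule smooth_cong[OF atlas open_points[OF atlas], rotated]) (simp add: matrix_inv_orthogonal[OF r_orth(2)])
  then show ?thesis
    by (simp add: smooth_orthogonal_def matrix_inv_orthogonal[OF r_orth(2)] orthogonal_maps_adj_mem r_orth)
qed

lemma good_backlund: "good_bundle \<A> Vs"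
  unfolding backlund_def by (rule good_bundle_map[OF atlas V r_inv])

lemma isometry_backlund:
  "connection_isometry \<A> (dlam Vs qs l) dtriv
     \<psi>"
  unfolding isometry_iff[OF atlas good_backlund]
proof (intro conjI ballI)
  show "smooth_orthogonal \<A> \<psi>"
    unfolding smooth_orthogonal_def
  proof
    show "smooth_map_on \<A> (points \<A>) \<psi>"
      unfolding backlund_isometry_def[abs_def] using r(1)[OF l] r(1)[OF nz(2)] \<phi>
      by (intro smooth_mult smooth_adj atlas open_points) (auto simp: smooth_orthogonal_def)
    show "\<forall>p\<in>points \<A>. \<psi> p \<in> orthogonal_maps"
      unfolding backlund_isometry_def by (intro ballI orthogonal_maps_mult orthogonal_maps_adj_mem r_orth)
  qed
  fix c p assume c: "c \<in> \<A>" "p \<in> fst c"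
  interpret chart_point \<A> c p by unfold_locales (use atlas c in auto)
  have q: "q c p (- v) = - q c p v" "adj (q c p v) = - q c p v"
    "reflection (V p) ** q c p v ** reflection (V p) = q c p v" for v
    using harmonic_multiplier[OF V harmonic chart pt] by auto
  show "der \<psi> (\<lambda>v. \<psi> p ** conn_form Vs qs l c p v)"
  proof (rule rstar_gauge[where q = q, OF V params q])
    fix C
    assume C: "symmetric_family (reflection (V p)) (chart_frechet (\<lambda>x. reflection (V x)) c p) C
        (- {0, \<alpha>, - \<alpha>, \<beta>, - \<beta>})"
      "\<And>v. C (-2) v = r (Fin 0) p ** form10 q c p v ** adj (r (Fin 0) p)"
      "\<And>v. C 2 v = r Infty p ** form01 q c p v ** adj (r Infty p)"
      "\<And>x. x \<notin> {0, \<alpha>, - \<alpha>, \<beta>, - \<beta>} \<Longrightarrow>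
         der (r (Fin x)) (\<lambda>v. r (Fin x) p ** conn_form V q x c p v - laurent C x v ** r (Fin x) p)"
    define rl where "rl = r (Fin l) p"
    define r1 where "r1 = r (Fin 1) p"
    have ro: "rl \<in> orthogonal_maps" "r1 \<in> orthogonal_maps" using r_orth pt_points by (auto simp: rl_def r1_def)
    have inv1: "matrix_inv r1 = adj r1" "matrix_inv (adj r1) = r1"
      using ro(2) by (simp_all add: matrix_inv_orthogonal orthogonal_maps_adj_mem)
    have skewC: "adj (laurent C x v) = - laurent C x v" if "x \<notin> {0, \<alpha>, - \<alpha>, \<beta>, - \<beta>}" for x v
      using C(1) that by (auto simp: symmetric_family_def)
    \<comment> \<open>The original form vanishes at parameter 1, so only the dressed one remains in
      the gauge equation.\<close>
    have d1: "der (r (Fin 1)) (\<lambda>v. - (laurent C 1 v ** r1))"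
      using C(4)[OF nz(2)] by (simp add: conn_form_def laurent_conn_coeffs_one r1_def)
    \<comment> \<open>Hence the inverse gauge trivialises the dressed family at 1, as
      \<open>conn_form_map\<close> requires.\<close>
    have ginv: "der (\<lambda>p. matrix_inv (r (Fin 1) p)) (\<lambda>v. matrix_inv (r (Fin 1) p) ** laurent C 1 v)"
    proof -
      have "der (\<lambda>p. matrix_inv (r (Fin 1) p)) (\<lambda>v. adj (- (laurent C 1 v ** r1)))"
        by (rule der_cong[OF open_pts pt_points _ chart_deriv_adj[OF d1]]) (simp add: matrix_inv_orthogonal r_orth)
      then show ?thesis
        by (simp add: adj_simps skewC[OF nz(2)] mat_ring inv1 r1_def[symmetric])
    qed
    have mult: "qs c p v =
        matrix_inv (r (Fin 1) p) ** (inverse (1^2) *m C (-2) v + 1^2 *m C 2 v) ** adj (matrix_inv (r (Fin 1) p))" for v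
      unfolding backlund_multiplier_def Ad_def C(2,3) r1_def[symmetric] inv1
      by (simp add: matrix_inv_orthogonal r_orth pt_points)
    have cf: "conn_form Vs qs l c p v =
        adj r1 ** (laurent C l v - laurent C 1 v) ** r1" for v
      unfolding backlund_def
      using conn_form_map[where g = "\<lambda>p. matrix_inv (r (Fin 1) p)" and C = C and l = 1 and m = l
          and ?q1.0 = "qs", OF V r_inv C(1) _ nz(1) ginv mult, of v] nz(2)
      by (simp add: r1_def[symmetric] inv1)
    have dl: "der (r (Fin l)) (\<lambda>v. rl ** conn_form V q l c p v - laurent C l v ** rl)"
      using C(4)[OF l] by (simp add: rl_def)
    have d\<phi>: "der \<phi> (\<lambda>v. \<phi> p ** conn_form V q l c p v)"
      using iso c unfolding isometry_iff[OF atlas V] by blast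
    let ?Om = "conn_form V q l c p"
    have skew: "adj (?Om v) = - ?Om v" for v
      using orthogonal_der[OF open_pts pt_points r_orth(5) d\<phi>, of v]
      by (simp add: adj_simps mat_ring orthogonal_cancel[OF r_orth(5)[OF pt_points]] eq_neg_iff_add_eq_0)
    \<comment> \<open>By skewness the two terms in the original form cancel, leaving the difference
      of the dressed forms at \<open>l\<close> and at 1.\<close>
    have "der \<psi> (\<lambda>v. ((\<phi> p ** ?Om v) ** adj (r (Fin l) p) + \<phi> p ** adj (rl ** ?Om v - laurent C l v ** rl)) ** r (Fin 1) p +
        (\<phi> p ** adj (r (Fin l) p)) ** (- (laurent C 1 v ** r1)))"
      unfolding backlund_isometry_def[abs_def] by (intro der_mult chart_deriv_adj d\<phi> dl d1)
    moreover have "((\<phi> p ** ?Om v) ** adj (r (Fin l) p) + \<phi> p ** adj (rl ** ?Om v - laurent C l v ** rl)) ** r (Fin 1) p +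
        (\<phi> p ** adj (r (Fin l) p)) ** (- (laurent C 1 v ** r1)) =
        \<psi> p ** (adj r1 ** (laurent C l v - laurent C 1 v) ** r1)" for v
      by (simp add: backlund_isometry_def r1_def[symmetric] rl_def[symmetric] adj_simps mat_ring skew skewC[OF l]
          orthogonal_cancel[OF ro(1)] orthogonal_cancel[OF ro(2)])
    ultimately show ?thesis by (simp add: cf)
  qed
qed

lemma transport:
  assumes p: "p \<in> points \<A>"
  shows "rstar (map_bundle \<phi> V) (\<alpha> / l) (\<beta> / l) (map_bundle \<phi> L\<alpha>) (map_bundle \<phi> L\<beta>) (Fin 1) p =
      \<phi> p ** r (Fin l) p ** adj (\<phi> p)"
    and "rstar (map_bundle \<phi> V) (\<alpha> / l) (\<beta> / l) (map_bundle \<phi> L\<alpha>) (map_bundle \<phi> L\<beta>) Infty p =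
      \<phi> p ** r Infty p ** adj (\<phi> p)"
    and "rstar (map_bundle \<phi> V) (\<alpha> / l) (\<beta> / l) (map_bundle \<phi> L\<alpha>) (map_bundle \<phi> L\<beta>) (Fin 0) p =
      \<phi> p ** r (Fin 0) p ** adj (\<phi> p)"
  using rstar_map[OF atlas V params \<phi> nz(1) p] by simp_all

lemma inverse_transport:
  assumes p: "p \<in> points \<A>"
  shows "matrix_inv (\<phi> p ** r (Fin l) p ** adj (\<phi> p)) = \<phi> p ** adj (r (Fin l) p) ** adj (\<phi> p)"
  using r_orth[OF p] by (simp add: matrix_inv_orthogonal orthogonal_maps_mult orthogonal_maps_adj_mem adj_simps matrix_mul_assoc)

text \<open>In \<psi> the gauge at 1 cancels against its inverse in the definition of the transform.
  Both sides become the image under \<phi> and the inverse gauge at \<open>l\<close>, applied after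
  the value at infinity or 0 in the case of surfaces.\<close>

lemma backlund_transport:
  assumes p: "p \<in> points \<A>"
  shows "backlund (map_bundle \<phi> V) (\<alpha> / l) (\<beta> / l) (map_bundle \<phi> L\<alpha>) (map_bundle \<phi> L\<beta>) p =
      map_bundle \<psi> Vs p"
    and "backlund10 (map_bundle \<phi> V) (\<alpha> / l) (\<beta> / l) (map_bundle \<phi> L\<alpha>) (map_bundle \<phi> L\<beta>) (map_bundle \<phi> \<Delta>) p =
      map_bundle \<psi> (backlund10 V \<alpha> \<beta> L\<alpha> L\<beta> \<Delta>) p"
    and "backlund01 (map_bundle \<phi> V) (\<alpha> / l) (\<beta> / l) (map_bundle \<phi> L\<alpha>) (map_bundle \<phi> L\<beta>) (map_bundle \<phi> \<Delta>) p =
      map_bundle \<psi> (backlund01 V \<alpha> \<beta> L\<alpha> L\<beta> \<Delta>) p"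
  unfolding backlund_def backlund10_def backlund01_def map_bundle_def[of _ _ p] transport[OF p] inverse_transport[OF p]
  by (simp_all add: backlund_isometry_def image_mat_mult
      matrix_inv_orthogonal[OF r_orth(2)[OF p]] matrix_mul_assoc[symmetric]
      orthogonal_cancel[OF r_orth(2)[OF p]] orthogonal_cancel[OF r_orth(5)[OF p]])

end

theorem theorem6p37:
  fixes \<A> :: "'m::{t2_space, second_countable_topology} chart set"
    and V L\<alpha> L\<beta> :: "('m, 'k::finite) vbundle"
    and q :: "('m, 'k cmat) form1"
    and \<phi> :: "'m \<Rightarrow> 'k cmat"
    and \<alpha> \<beta> l :: complex
    and n :: nat
  assumes "n \<ge> 3" and "CARD('k) = n + 1"
    and "conformal_atlas \<A>"
    and "constrained_harmonic \<A> V q"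
    and "backlund_parameters \<A> V q \<alpha> \<beta> L\<alpha> L\<beta>"
    and "l \<notin> {0, \<alpha>, - \<alpha>, \<beta>, - \<beta>}"
    and "connection_isometry \<A> (dlam V q l) dtriv \<phi>"
  shows
    "backlund_parameters \<A> (map_bundle \<phi> V) (spectral_multiplier \<phi> q l) (\<alpha> / l) (\<beta> / l)
       (map_bundle \<phi> L\<alpha>) (map_bundle \<phi> L\<beta>) \<and>
     (\<exists>\<phi>s. connection_isometry \<A>
       (dlam (backlund V \<alpha> \<beta> L\<alpha> L\<beta>) (backlund_multiplier V \<alpha> \<beta> L\<alpha> L\<beta> q) l) dtriv \<phi>s) \<and>
     (\<forall>\<phi>s. connection_isometry \<A>
         (dlam (backlund V \<alpha> \<beta> L\<alpha> L\<beta>) (backlund_multiplier V \<alpha> \<beta> L\<alpha> L\<beta> q) l) dtriv \<phi>s \<longrightarrow>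
       coincide_up_to_constant \<A>
         {(backlund (map_bundle \<phi> V) (\<alpha> / l) (\<beta> / l) (map_bundle \<phi> L\<alpha>) (map_bundle \<phi> L\<beta>),
           map_bundle \<phi>s (backlund V \<alpha> \<beta> L\<alpha> L\<beta>))}) \<and>
     (\<forall>\<Delta>10 \<Delta>01 \<phi>s.
       constrained_willmore \<A> q \<Delta>10 \<Delta>01 \<and> qd_central_sphere_congruence \<A> V q \<Delta>10 \<Delta>01 \<and>
       connection_isometry \<A>
         (dlam (backlund V \<alpha> \<beta> L\<alpha> L\<beta>) (backlund_multiplier V \<alpha> \<beta> L\<alpha> L\<beta> q) l) dtriv \<phi>s \<longrightarrow>
       coincide_up_to_constant \<A>
         {(backlund10 (map_bundle \<phi> V) (\<alpha> / l) (\<beta> / l) (map_bundle \<phi> L\<alpha>) (map_bundle \<phi> L\<beta>)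
             (map_bundle \<phi> \<Delta>10),
           map_bundle \<phi>s (backlund10 V \<alpha> \<beta> L\<alpha> L\<beta> \<Delta>10)),
          (backlund01 (map_bundle \<phi> V) (\<alpha> / l) (\<beta> / l) (map_bundle \<phi> L\<alpha>) (map_bundle \<phi> L\<beta>)
             (map_bundle \<phi> \<Delta>01),
           map_bundle \<phi>s (backlund01 V \<alpha> \<beta> L\<alpha> L\<beta> \<Delta>01))})"
proof -
  interpret backlund_setting \<A> V L\<alpha> L\<beta> q \<phi> \<alpha> \<beta> l
    using assms(3-7) by unfold_locales
  \<comment> \<open>The explicit isometry \<psi> gives exact equality; an arbitrary one is then
    compared with it.\<close>
  note coincide = coincide_up_to_constantI[OF atlas good_backlund isometry_backlund]
  show ?thesis
  proof (intro conjI allI impI)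
    show "backlund_parameters \<A> (map_bundle \<phi> V) (spectral_multiplier \<phi> q l) (\<alpha> / l) (\<beta> / l)
       (map_bundle \<phi> L\<alpha>) (map_bundle \<phi> L\<beta>)"
      by (rule backlund_parameters_map[OF atlas V harmonic iso l params])
    show "\<exists>\<phi>s. connection_isometry \<A>
       (dlam (backlund V \<alpha> \<beta> L\<alpha> L\<beta>) (backlund_multiplier V \<alpha> \<beta> L\<alpha> L\<beta> q) l) dtriv \<phi>s"
      using isometry_backlund by blast
  next
    fix \<phi>s
    assume "connection_isometry \<A>
      (dlam (backlund V \<alpha> \<beta> L\<alpha> L\<beta>) (backlund_multiplier V \<alpha> \<beta> L\<alpha> L\<beta> q) l) dtriv \<phi>s"
    then show "coincide_up_to_constant \<A>
         {(backlund (map_bundle \<phi> V) (\<alpha> / l) (\<beta> / l) (map_bundle \<phi> L\<alpha>) (map_bundle \<phi> L\<beta>),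
           map_bundle \<phi>s (backlund V \<alpha> \<beta> L\<alpha> L\<beta>))}"
      using coincide[of _ "{(backlund (map_bundle \<phi> V) (\<alpha> / l) (\<beta> / l) (map_bundle \<phi> L\<alpha>) (map_bundle \<phi> L\<beta>),
        backlund V \<alpha> \<beta> L\<alpha> L\<beta>)}"] backlund_transport(1) by simp
  next
    fix \<Delta>10 \<Delta>01 \<phi>s
    assume *: "constrained_willmore \<A> q \<Delta>10 \<Delta>01 \<and> qd_central_sphere_congruence \<A> V q \<Delta>10 \<Delta>01 \<and>
      connection_isometry \<A>
         (dlam (backlund V \<alpha> \<beta> L\<alpha> L\<beta>) (backlund_multiplier V \<alpha> \<beta> L\<alpha> L\<beta> q) l) dtriv \<phi>s"
    have "coincide_up_to_constant \<A> ((\<lambda>(E, K). (E, map_bundle \<phi>s K)) `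
      {(backlund10 (map_bundle \<phi> V) (\<alpha> / l) (\<beta> / l) (map_bundle \<phi> L\<alpha>) (map_bundle \<phi> L\<beta>) (map_bundle \<phi> \<Delta>10),
        backlund10 V \<alpha> \<beta> L\<alpha> L\<beta> \<Delta>10),
       (backlund01 (map_bundle \<phi> V) (\<alpha> / l) (\<beta> / l) (map_bundle \<phi> L\<alpha>) (map_bundle \<phi> L\<beta>) (map_bundle \<phi> \<Delta>01),
        backlund01 V \<alpha> \<beta> L\<alpha> L\<beta> \<Delta>01)})"
      by (rule coincide[OF *[THEN conjunct2, THEN conjunct2]]) (auto simp: backlund_transport)
    then show "coincide_up_to_constant \<A>
         {(backlund10 (map_bundle \<phi> V) (\<alpha> / l) (\<beta> / l) (map_bundle \<phi> L\<alpha>) (map_bundle \<phi> L\<beta>)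
             (map_bundle \<phi> \<Delta>10),
           map_bundle \<phi>s (backlund10 V \<alpha> \<beta> L\<alpha> L\<beta> \<Delta>10)),
          (backlund01 (map_bundle \<phi> V) (\<alpha> / l) (\<beta> / l) (map_bundle \<phi> L\<alpha>) (map_bundle \<phi> L\<beta>)
             (map_bundle \<phi> \<Delta>01),
           map_bundle \<phi>s (backlund01 V \<alpha> \<beta> L\<alpha> L\<beta> \<Delta>01))}"
      by simp
  qed
qed

end
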